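(* Let $N\ge 1$ be an integer and let $a,b,c$ be integers such that neither $ac$ nor $bc$ is divisible by $N$. Then $$\int_{c/N}^{i\infty}\eta(g_a,g_b)=\frac{1}{4\pi}\,L\bigl(f(\tau)-f(i\infty),2\bigr),$$ where the weight $2$ modular form $f=f_{a,b;c}$ is given by $$f_{a,b;c}:=e_{a,bc}\,e_{b,-ac}-e_{a,-bc}\,e_{b,ac}.$$
   Context: Notation. $\mathbb H=\{\tau\in\mathbb C:\operatorname{Im}\tau>0\}$, $q=\exp(2\pi i\tau)$ for $\tau\in\mathbb H$, and $\zeta_N:=\exp(2\pi i/N)$. $\{x\}$ denotes the fractional part of a real number $x$, and $B(x):=\{x\}^2-\{x\}+\tfrac16$. Modular units: for an integer $a$ and $\tau\in\mathbb H$, $$g_a(\tau):=q^{N B(a/N)/2}\prod_{\substack{n\ge1\\ n\equiv a\bmod N}}(1-q^n)\prod_{\substack{n\ge1\\ n\equiv -a\bmod N}}(1-q^n),$$ where $q^{\alpha}$ means $\exp(2\pi i\alpha\tau)$. The regulator 1-form: for functions $g,h$ that are holomorphic and nowhere vanishing on $\mathbb H$, $$\eta(g,h):=\log|g|\,\mathrm d\arg h-\log|h|\,\mathrm d\arg g,\qquad \mathrm d\arg g:=\operatorname{Im}(\mathrm dg/g).$$ This is a real closed 1-form on $\mathbb H$. The integral $\int_{c/N}^{i\infty}$ is taken along the vertical line $\tau=c/N+it$, with $t$ running from $0$ to $\infty$. Eisenstein series: for integers $a,b$ not divisible by $N$, $$e_{a,b}(\tau):=\frac12\left(\frac{1+\zeta_N^a}{1-\zeta_N^a}+\frac{1+\zeta_N^b}{1-\zeta_N^b}\right)+\sum_{m,n\ge1}\bigl(\zeta_N^{am+bn}-\zeta_N^{-(am+bn)}\bigr)q^{mn};$$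 these are weight $1$ level $N^2$ Eisenstein series. $L$-value: $f(\tau)$ has a $q$-expansion $f(\tau)=f(i\infty)+\sum_{n\ge1}c_nq^n$ with constant term $f(i\infty)$. $L(f(\tau)-f(i\infty),s)$ denotes the $L$-series $\sum_{n\ge1}c_n n^{-s}$ (convergent for $\operatorname{Re}s$ large enough), and its value at $s=2$ is understood by analytic continuation in $s$. *)

theory Defs
  imports "HOL-Complex_Analysis.Complex_Analysis" "HOL-Number_Theory.Cong"
begin

definition qpar :: "complex \<Rightarrow> complex" where
  "qpar \<tau> = exp (2 * of_real pi * \<i> * \<tau>)"

definition zeta :: "nat \<Rightarrow> complex" where
  "zeta N = exp (2 * of_real pi * \<i> / of_nat N)"

definition B2 :: "real \<Rightarrow> real" where
  "B2 x = (frac x)\<^sup>2 - frac x + 1 / 6"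

definition modular_unit :: "nat \<Rightarrow> int \<Rightarrow> complex \<Rightarrow> complex" where
  "modular_unit N a \<tau> =
     exp (2 * of_real pi * \<i> * of_real (real N * B2 (of_int a / real N) / 2) * \<tau>)
     * (\<Prod>n. if n \<ge> 1 \<and> [int n = a] (mod int N) then 1 - qpar \<tau> ^ n else 1)
     * (\<Prod>n. if n \<ge> 1 \<and> [int n = - a] (mod int N) then 1 - qpar \<tau> ^ n else 1)"

text \<open>A real 1-form on an open subset of the plane is a function of a point
  and a tangent vector.\<close>

definition darg :: "(complex \<Rightarrow> complex) \<Rightarrow> complex \<Rightarrow> complex \<Rightarrow> real" where
  "darg g \<tau> v = Im (deriv g \<tau> * v / g \<tau>)"

definition regulator_form ::
    "(complex \<Rightarrow> complex) \<Rightarrow> (complex \<Rightarrow> complex) \<Rightarrow> complex \<Rightarrow> complex \<Rightarrow> real" where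
  "regulator_form g h \<tau> v =
     ln (cmod (g \<tau>)) * darg h \<tau> v - ln (cmod (h \<tau>)) * darg g \<tau> v"

text \<open>The integral of a 1-form along the line \<open>x + i t\<close>, whose tangent vector is \<open>\<i>\<close>,
  as \<open>t\<close> runs from 0 to infinity. The Henstock-Kurzweil integral includes the improper
  integral at both ends.\<close>

definition has_vertical_integral ::
    "(complex \<Rightarrow> complex \<Rightarrow> real) \<Rightarrow> real \<Rightarrow> real \<Rightarrow> bool" where
  "has_vertical_integral \<omega> I x \<longleftrightarrow>
     ((\<lambda>t. \<omega> (Complex x t) \<i>) has_integral I) {0<..}"

definition eisenstein :: "nat \<Rightarrow> int \<Rightarrow> int \<Rightarrow> complex \<Rightarrow> complex" where
  "eisenstein N a b \<tau> =
     1 / 2 * ((1 + zeta N powi a) / (1 - zeta N powi a)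
            + (1 + zeta N powi b) / (1 - zeta N powi b))
     + (\<Sum>\<^sub>\<infinity>(m, n)\<in>{1..} \<times> {1..}.
          (zeta N powi (a * int m + b * int n) - zeta N powi (- (a * int m + b * int n)))
          * qpar \<tau> ^ (m * n))"

definition f_abc :: "nat \<Rightarrow> int \<Rightarrow> int \<Rightarrow> int \<Rightarrow> complex \<Rightarrow> complex" where
  "f_abc N a b c \<tau> =
     eisenstein N a (b * c) \<tau> * eisenstein N b (- (a * c)) \<tau>
     - eisenstein N a (- (b * c)) \<tau> * eisenstein N b (a * c) \<tau>"

definition has_q_expansion :: "(complex \<Rightarrow> complex) \<Rightarrow> (nat \<Rightarrow> complex) \<Rightarrow> bool" where
  "has_q_expansion f c \<longleftrightarrow> (\<forall>\<tau>. Im \<tau> > 0 \<longrightarrow> (\<lambda>n. c n * qpar \<tau> ^ n) sums f \<tau>)"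

text \<open>The Dirichlet series \<open>\<Sum>n\<ge>1. c n / n powr z\<close> converges on some right half-plane, and its
  sum continues holomorphically to a right half-plane containing \<open>s\<close>, with value \<open>v\<close> there.
  Half-planes are connected and nested, so \<open>v\<close> is unique. The coefficient \<open>c 0\<close> plays no role.\<close>

definition has_L_value :: "(nat \<Rightarrow> complex) \<Rightarrow> complex \<Rightarrow> complex \<Rightarrow> bool" where
  "has_L_value c s v \<longleftrightarrow>
     (\<exists>F \<sigma>\<^sub>0 \<sigma>\<^sub>1. \<sigma>\<^sub>1 < Re s \<and> F holomorphic_on {z. \<sigma>\<^sub>1 < Re z} \<and>
        (\<forall>z. \<sigma>\<^sub>1 < Re z \<and> \<sigma>\<^sub>0 < Re z \<longrightarrow>
           (\<lambda>n. c (Suc n) / of_nat (Suc n) powr z) sums F z) \<and>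
        F s = v)"

lemma has_L_value_unique:
  assumes "has_L_value c s v" "has_L_value c s w"
  shows "v = w"
proof -
  obtain F \<sigma>0 \<sigma>1 where F: "\<sigma>1 < Re s" "F holomorphic_on {z. \<sigma>1 < Re z}" "F s = v"
    "\<And>z. \<sigma>1 < Re z \<and> \<sigma>0 < Re z \<Longrightarrow> (\<lambda>n. c (Suc n) / of_nat (Suc n) powr z) sums F z"
    using assms(1) unfolding has_L_value_def by blast
  obtain G \<rho>0 \<rho>1 where G: "\<rho>1 < Re s" "G holomorphic_on {z. \<rho>1 < Re z}" "G s = w"
    "\<And>z. \<rho>1 < Re z \<and> \<rho>0 < Re z \<Longrightarrow> (\<lambda>n. c (Suc n) / of_nat (Suc n) powr z) sums G z"
    using assms(2) unfolding has_L_value_def by blast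
  define \<mu> where "\<mu> = max \<sigma>1 \<rho>1"
  define \<nu> where "\<nu> = Max {\<sigma>0, \<sigma>1, \<rho>0, \<rho>1}"
  define S where "S = {z. \<mu> < Re z}"
  define T where "T = {z. \<nu> < Re z}"
  have "T \<subseteq> S" by (auto simp: S_def T_def \<mu>_def \<nu>_def)
  have "F s - G s = 0"
  proof (rule analytic_continuation_open[where s = T and s' = S and f = "\<lambda>z. F z - G z" and g = "\<lambda>_. 0"])
    show "open T" "open S" unfolding S_def T_def by (rule open_halfspace_Re_gt)+
    have "of_real (\<nu> + 1) \<in> T" by (simp add: T_def)
    then show "T \<noteq> {}" by blast
    show "connected S" unfolding S_def
      by (intro convex_connected convex_halfspace_Re_gt)
    show "(\<lambda>z. F z - G z) holomorphic_on S"
      using F(2) G(2) by (intro holomorphic_intros) 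
        (auto elim!: holomorphic_on_subset simp: S_def \<mu>_def)
    show "F z - G z = 0" if "z \<in> T" for z
      using sums_unique2[OF F(4) G(4)] that by (simp add: T_def \<nu>_def)
    show "s \<in> S" using F(1) G(1) by (simp add: S_def \<mu>_def)
  qed (use \<open>T \<subseteq> S\<close> in auto)
  then show ?thesis using F(3) G(3) by simp
qed

end

theory Submission
  imports Defs "HOL-Real_Asymp.Real_Asymp"
begin

text \<open>The proof is the method of Rogers and Zudilin. Put \<open>r = 1 / N\<^sup>2\<close>. On the line \<open>\<tau> = c / N + i t\<close>
  the power \<open>q^(m n)\<close> is \<open>exp (- 2 \<pi> m n t)\<close> times an \<open>N\<close>-th root of unity, and the two factors of
  the integrand become Lambert series, that is sums over \<open>m, n \<ge> 1\<close> of \<open>exp (- 2 \<pi> m n t)\<close> with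
  coefficients that depend on \<open>m\<close> and \<open>n\<close> modulo \<open>N\<close>. The function \<open>log |g_a|\<close> has the weight
  \<open>1 / m\<close>, and \<open>d arg g_b\<close> has the weight \<open>n\<close>. The unit \<open>g_a\<close> on this line is a value of a theta
  function at an \<open>N\<close>-division point, so the transformation \<open>\<tau> \<mapsto> - 1 / \<tau>\<close> of theta functions rewrites
  \<open>log |g_a|\<close> at \<open>t\<close> as a multiple of \<open>B2 (a c / N) / t\<close> plus a Lambert series
  at \<open>r / t\<close> (\<open>log_inversion\<close>). The product of the two Lambert series is then a fourfold sum of
  \<open>(n\<^sub>2 / m\<^sub>1) exp (- 2 \<pi> (m\<^sub>1 n\<^sub>1 r / t + m\<^sub>2 n\<^sub>2 t))\<close> with periodic coefficients. Substituting \<open>t = (m\<^sub>1 / n\<^sub>2) u\<close> in each term cancels the weight against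
  \<open>dt\<close> and turns the exponent into \<open>n\<^sub>1 n\<^sub>2 r / u + m\<^sub>1 m\<^sub>2 u\<close> (\<open>rogers_zudilin\<close>). The variables
  have been regrouped, and the new integrand is \<open>P(u) G(u)\<close>, where \<open>P\<close> and \<open>G\<close> are Lambert series of
  Eisenstein series of weight one at \<open>u\<close> and at \<open>r / u\<close>. A second inversion gives
  \<open>G(u) = u (cot (\<pi> b / N) + 4 H(u))\<close> (\<open>weight_one_inversion\<close>), so the integrand is \<open>u\<close> times
  a product of two Eisenstein series on the imaginary axis, up to a constant term of \<open>P\<close> that is
  missing. The elementary term of \<open>log |g_a|\<close> supplies exactly this constant: its integral against
  \<open>d arg g_b\<close> and the first moment of \<open>H\<close> are both evaluated in closed form, by the Fourier series of
  \<open>B2\<close> and the partial fractions of the cotangent, and they agree (\<open>log_darg_integral\<close>).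
  Antisymmetrising in \<open>a\<close> and \<open>b\<close>, the regulator integral is a multiple of the integral of
  \<open>u (f(i u) - f(i \<infinity>))\<close>, which is the Mellin transform that computes the L-value at \<open>2\<close>
  (\<open>L_value_at_2\<close>).

  Only the modulus of the theta function and its logarithmic derivative enter. The two sides of the
  theta transformation are entire functions of \<open>z\<close> with a bounded quotient, hence proportional by
  Liouville's theorem, and the duplication formula shows that the constant has modulus one
  (\<open>theta_norm_transform\<close>). A value at a division point gives the inversion of \<open>log |g_a|\<close>, its
  derivative in \<open>\<tau>\<close> gives that of \<open>d arg g_b\<close>, and its logarithmic derivative in \<open>z\<close>, after a finite
  Fourier transform, gives that of the Eisenstein series of weight one.

  For the analytic continuation, \<open>f(i u)\<close> remains bounded as \<open>u \<rightarrow> 0\<close>, since each of the two products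
  contains one factor that decays rapidly there (\<open>PG_products_bounded\<close>). Hence the Mellin transform
  is holomorphic on a half-plane that contains \<open>2\<close> (\<open>mellin_holomorphic\<close>).\<close>

(* The infix stands for absolute summability of families, not for integrability over a counting measure. *)
no_notation Infinite_Set_Sum.abs_summable_on (infix \<open>abs'_summable'_on\<close> 50)

section \<open>Lambert series\<close>

abbreviation nome :: "real \<Rightarrow> real" where
  "nome t \<equiv> exp (- (2 * pi * t))"

abbreviation pairs :: "(nat \<times> nat) set" where
  "pairs \<equiv> {1..} \<times> {1..}"

definition lambert :: "(nat \<Rightarrow> nat \<Rightarrow> 'a) \<Rightarrow> 'a \<Rightarrow> 'a::{real_normed_field,banach}" where
  "lambert c q = (\<Sum>\<^sub>\<infinity>(m, n)\<in>pairs. c m n * q ^ (m * n))"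

definition poly_growth :: "(nat \<Rightarrow> nat \<Rightarrow> 'a::real_normed_vector) \<Rightarrow> bool" where
  "poly_growth c \<longleftrightarrow> (\<exists>K p. \<forall>m\<ge>1. \<forall>n\<ge>1. norm (c m n) \<le> K * real (m * n) ^ p)"

lemma poly_growthI:
  assumes "\<And>m n. m \<ge> 1 \<Longrightarrow> n \<ge> 1 \<Longrightarrow> norm (c m n) \<le> K * real (m * n) ^ p"
  shows "poly_growth c"
  using assms unfolding poly_growth_def by blast

lemma poly_growthE:
  assumes "poly_growth c"
  obtains K p where "K \<ge> 0"
    "\<And>m n. m \<ge> 1 \<Longrightarrow> n \<ge> 1 \<Longrightarrow> norm (c m n) \<le> K * real (m * n) ^ p"
proof -
  obtain K p where *: "\<And>m n. m \<ge> 1 \<Longrightarrow> n \<ge> 1 \<Longrightarrow> norm (c m n) \<le> K * real (m * n) ^ p"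
    using assms unfolding poly_growth_def by blast
  show ?thesis
  proof (rule that[of "\<bar>K\<bar>" p])
    fix m n :: nat assume mn: "m \<ge> 1" "n \<ge> 1"
    have "norm (c m n) \<le> K * real (m * n) ^ p" by (rule *[OF mn])
    also have "\<dots> \<le> \<bar>K\<bar> * real (m * n) ^ p" by (intro mult_right_mono) auto
    finally show "norm (c m n) \<le> \<bar>K\<bar> * real (m * n) ^ p" .
  qed simp
qed

lemma poly_growth_bounded:
  assumes "\<And>m n. m \<ge> 1 \<Longrightarrow> n \<ge> 1 \<Longrightarrow> norm (c m n) \<le> K"
  shows "poly_growth c"
  by (rule poly_growthI[of c K 0]) (use assms in simp)

lemma poly_growth_add:
  assumes "poly_growth c" "poly_growth d"
  shows "poly_growth (\<lambda>m n. c m n + d m n)"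
proof -
  obtain K p where K: "K \<ge> 0" "\<And>m n. m \<ge> 1 \<Longrightarrow> n \<ge> 1 \<Longrightarrow> norm (c m n) \<le> K * real (m * n) ^ p"
    using assms(1) by (rule poly_growthE) blast
  obtain L r where L: "L \<ge> 0" "\<And>m n. m \<ge> 1 \<Longrightarrow> n \<ge> 1 \<Longrightarrow> norm (d m n) \<le> L * real (m * n) ^ r"
    using assms(2) by (rule poly_growthE) blast
  show ?thesis
  proof (rule poly_growthI)
    fix m n :: nat assume mn: "m \<ge> 1" "n \<ge> 1"
    have ge: "real (m * n) \<ge> 1" using mn by (metis mult_le_mono nat_mult_1 of_nat_1 of_nat_mono)
    have "norm (c m n + d m n) \<le> norm (c m n) + norm (d m n)" by (rule norm_triangle_ineq)
    also have "\<dots> \<le> K * real (m * n) ^ p + L * real (m * n) ^ r"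
      by (intro add_mono K L mn)
    also have "\<dots> \<le> K * real (m * n) ^ (p + r) + L * real (m * n) ^ (p + r)"
      by (intro add_mono mult_left_mono power_increasing K L ge) auto
    finally show "norm (c m n + d m n) \<le> (K + L) * real (m * n) ^ (p + r)"
      by (simp add: distrib_right)
  qed
qed

lemma poly_growth_mult:
  fixes c d :: "nat \<Rightarrow> nat \<Rightarrow> 'a::real_normed_algebra"
  assumes "poly_growth c" "poly_growth d"
  shows "poly_growth (\<lambda>m n. c m n * d m n)"
proof -
  obtain K p where K: "K \<ge> 0" "\<And>m n. m \<ge> 1 \<Longrightarrow> n \<ge> 1 \<Longrightarrow> norm (c m n) \<le> K * real (m * n) ^ p"
    using assms(1) by (rule poly_growthE) blast
  obtain L r where L: "L \<ge> 0" "\<And>m n. m \<ge> 1 \<Longrightarrow> n \<ge> 1 \<Longrightarrow> norm (d m n) \<le> L * real (m * n) ^ r"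
    using assms(2) by (rule poly_growthE) blast
  show ?thesis
  proof (rule poly_growthI)
    fix m n :: nat assume mn: "m \<ge> 1" "n \<ge> 1"
    have "norm (c m n * d m n) \<le> norm (c m n) * norm (d m n)" by (rule norm_mult_ineq)
    also have "\<dots> \<le> (K * real (m * n) ^ p) * (L * real (m * n) ^ r)"
      by (intro mult_mono K L mn) (use K in auto)
    finally show "norm (c m n * d m n) \<le> (K * L) * real (m * n) ^ (p + r)"
      by (simp add: power_add mult_ac)
  qed
qed

lemma poly_growth_mn: "poly_growth (\<lambda>m n. of_nat (m * n) :: 'a::real_normed_field)"
  by (rule poly_growthI[of _ 1 1]) (simp add: norm_mult)

lemma poly_growth_const: "poly_growth (\<lambda>m n. k)"
  by (rule poly_growth_bounded[of _ "norm k"]) simp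

lemma inverse_squares_summable:
  shows "summable (\<lambda>n. 1 / real n ^ 2)" and "summable (\<lambda>n. 1 / real (Suc n) ^ 2)"
    and "(\<lambda>n. 1 / real n ^ 2) summable_on {1..}"
proof -
  show sm: "summable (\<lambda>n. 1 / real n ^ 2)"
    using inverse_power_summable[of 2, where 'a = real] by (simp add: divide_inverse)
  then show "summable (\<lambda>n. 1 / real (Suc n) ^ 2)"
    by (rule iffD2[OF summable_Suc_iff[of "\<lambda>n. 1 / real n ^ 2"]])
  have "(\<lambda>n. 1 / real n ^ 2) summable_on UNIV"
    using sm by (intro norm_summable_imp_summable_on) simp
  then show "(\<lambda>n. 1 / real n ^ 2) summable_on {1..}"
    by (rule summable_on_subset_banach) simp
qed

lemma inverse_power_summable_pairs:
  assumes "k \<ge> 2"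
  shows "(\<lambda>(m, n). 1 / real (m * n) ^ k) summable_on pairs"
proof -
  have *: "(\<lambda>n. 1 / real n ^ k) summable_on {1..}"
  proof (rule summable_on_subset_banach)
    have "summable (\<lambda>n. norm (1 / real n ^ k))"
      using inverse_power_summable[of k, where 'a=real] assms by (simp add: divide_inverse)
    then show "(\<lambda>n. 1 / real n ^ k) summable_on UNIV"
      by (rule norm_summable_imp_summable_on)
  qed simp
  then obtain S where S: "((\<lambda>n. 1 / real n ^ k) has_sum S) {1..}"
    using summable_on_def by blast
  show ?thesis
  proof (rule summable_on_SigmaI[where g = "\<lambda>m. 1 / real m ^ k * S"])
    fix m :: nat assume "m \<in> {1..}"
    show "((\<lambda>y. case (m, y) of (m, n) \<Rightarrow> 1 / real (m * n) ^ k) has_sum 1 / real m ^ k * S) {1..}"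
      using has_sum_cmult_right[OF S, of "1 / real m ^ k"] by (simp add: power_mult_distrib)
  qed (use summable_on_cmult_left[OF *, of S] in auto)
qed

lemma power_le_fact_exp:
  fixes y :: real
  assumes "y \<ge> 0"
  shows "y ^ n \<le> fact n * exp y"
proof -
  have "(\<Sum>i\<in>{n}. y ^ i /\<^sub>R fact i) \<le> (\<Sum>i. y ^ i /\<^sub>R fact i)"
    by (rule sum_le_suminf) (use assms summable_exp_generic[of y] in auto)
  then have "y ^ n / fact n \<le> exp y"
    by (simp add: exp_def divide_inverse mult.commute)
  then show ?thesis by (simp add: field_simps)
qed

lemma exp_power_decay:
  fixes t :: real
  assumes "t > 0" "x > 0"
  shows "exp (- (2 * pi * t)) ^ x \<le> fact k / t ^ k / real x ^ k"
proof -
  have "(t * x) ^ k \<le> fact k * exp (t * x)"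
    by (rule power_le_fact_exp) (use assms in simp)
  also have "t * x \<le> 2 * pi * t * x"
    using assms pi_gt3 by (simp add: field_simps)
  then have "fact k * exp (t * x) \<le> fact k * exp (2 * pi * t * x)" by simp
  finally have "(t * x) ^ k * exp (- (2 * pi * t * x)) \<le> fact k"
    by (simp add: exp_minus field_simps)
  then have "exp (- (2 * pi * t * x)) \<le> fact k / (t ^ k * real x ^ k)"
    using assms by (simp add: field_simps)
  moreover have "exp (- (2 * pi * t)) ^ x = exp (- (2 * pi * t * x))"
    by (simp add: exp_of_nat_mult[symmetric] mult_ac)
  ultimately show ?thesis by simp
qed

text \<open>As \<open>exp (- y)\<close> beats every power of \<open>1 / y\<close>, the Lambert series on the imaginary axis is
  dominated by a convergent double series \<open>1 / (m n)\<^sup>2\<close>, with a factor that decays like any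
  prescribed power of \<open>t\<close>.\<close>

lemma lambert_term_bound:
  assumes "poly_growth c"
  obtains K p where "K \<ge> 0"
    "\<And>m n k t. m \<ge> 1 \<Longrightarrow> n \<ge> 1 \<Longrightarrow> k \<ge> p \<Longrightarrow> t > 0 \<Longrightarrow>
       norm (c m n) * exp (- (2 * pi * t)) ^ (m * n) \<le> K * fact k / t ^ k * (1 / real (m * n) ^ 2)"
proof -
  obtain K p where K: "K \<ge> 0" "\<And>m n. m \<ge> 1 \<Longrightarrow> n \<ge> 1 \<Longrightarrow> norm (c m n) \<le> K * real (m * n) ^ p"
    using assms by (rule poly_growthE) blast
  show ?thesis
  proof (rule that[of K "p + 2"])
    fix m n k :: nat and t :: real
    assume *: "m \<ge> 1" "n \<ge> 1" "k \<ge> p + 2" "t > 0"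
    define x where "x = m * n"
    have x: "x \<ge> 1" using * by (simp add: x_def)
    have "norm (c m n) * exp (- (2 * pi * t)) ^ x
          \<le> (K * real x ^ p) * (fact k / t ^ k / real x ^ k)"
      using K(2)[OF *(1,2)] x K(1) * by (intro mult_mono exp_power_decay) (auto simp: x_def)
    also have "\<dots> = K * fact k / t ^ k * (real x ^ p / real x ^ k)" by simp
    also have "\<dots> \<le> K * fact k / t ^ k * (1 / real x ^ 2)"
    proof (rule mult_left_mono)
      have "real x ^ p * real x ^ 2 \<le> real x ^ k"
        unfolding power_add[symmetric] by (rule power_increasing) (use * x in auto)
      then show "real x ^ p / real x ^ k \<le> 1 / (real x)\<^sup>2"
        using x by (simp add: field_simps)
    qed (use K * in auto)
    finally show "norm (c m n) * exp (- (2 * pi * t)) ^ (m * n)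
                  \<le> K * fact k / t ^ k * (1 / real (m * n) ^ 2)"
      by (simp add: x_def)
  qed (use K in auto)
qed

lemma lambert_abs_summable:
  fixes q :: "'a::{real_normed_field,banach}"
  assumes "poly_growth c" "norm q < 1"
  shows "(\<lambda>(m, n). c m n * q ^ (m * n)) abs_summable_on pairs"
proof (cases "q = 0")
  case True
  have "(\<lambda>(m, n). c m n * q ^ (m * n)) abs_summable_on pairs \<longleftrightarrow> (\<lambda>_. 0::real) summable_on pairs"
    by (rule summable_on_cong) (use True in auto)
  then show ?thesis by simp
next
  case False
  obtain K p where K: "K \<ge> 0"
    "\<And>m n k t. m \<ge> 1 \<Longrightarrow> n \<ge> 1 \<Longrightarrow> k \<ge> p \<Longrightarrow> t > 0 \<Longrightarrow>
       norm (c m n) * exp (- (2 * pi * t)) ^ (m * n) \<le> K * fact k / t ^ k * (1 / real (m * n) ^ 2)"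
    using lambert_term_bound[OF assms(1)] by blast
  define t where "t = - ln (norm q) / (2 * pi)"
  have t: "t > 0" "exp (- (2 * pi * t)) = norm q"
    using False assms by (auto simp: t_def divide_less_0_iff)
  have "(\<lambda>x. K * fact p / t ^ p * (case x of (m, n) \<Rightarrow> 1 / real (m * n) ^ 2)) summable_on pairs"
    by (intro summable_on_cmult_right inverse_power_summable_pairs) simp
  then show ?thesis
  proof (rule summable_on_comparison_test)
    fix x assume "x \<in> pairs"
    then show "norm (case x of (m, n) \<Rightarrow> c m n * q ^ (m * n)) \<le>
               K * fact p / t ^ p * (case x of (m, n) \<Rightarrow> 1 / real (m * n) ^ 2)"
      using K(2)[of "fst x" "snd x" p t] t by (auto simp: norm_mult norm_power mult_ac)
  qed auto
qed

lemma lambert_has_sum: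
  fixes q :: "'a::{real_normed_field,banach}"
  assumes "poly_growth c" "norm q < 1"
  shows "((\<lambda>(m, n). c m n * q ^ (m * n)) has_sum lambert c q) pairs"
  unfolding lambert_def
  using abs_summable_summable[OF lambert_abs_summable[OF assms]] by (rule has_sum_infsum)

lemma lambert_eqI:
  fixes q :: "'a::{real_normed_field,banach}"
  assumes "((\<lambda>(m, n). c m n * q ^ (m * n)) has_sum S) pairs"
  shows "lambert c q = S"
  unfolding lambert_def using assms by (rule infsumI)

lemma lambert_cong:
  assumes "\<And>m n. m \<ge> 1 \<Longrightarrow> n \<ge> 1 \<Longrightarrow> c m n * q ^ (m * n) = d m n * r ^ (m * n)"
  shows "lambert c q = lambert d r"
  unfolding lambert_def by (rule infsum_cong) (use assms in auto)

lemma lambert_add: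
  fixes q :: "'a::{real_normed_field,banach}"
  assumes "poly_growth c" "poly_growth d" "norm q < 1"
  shows "lambert (\<lambda>m n. c m n + d m n) q = lambert c q + lambert d q"
  using has_sum_add[OF lambert_has_sum[OF assms(1,3)] lambert_has_sum[OF assms(2,3)]]
  by (intro lambert_eqI) (simp add: case_prod_unfold distrib_right)

lemma lambert_cmult:
  fixes q :: "'a::{real_normed_field,banach}"
  shows "lambert (\<lambda>m n. k * c m n) q = k * lambert c q"
  unfolding lambert_def infsum_cmult_right'[symmetric]
  by (rule infsum_cong) (auto simp: mult_ac)

lemma lambert_uminus:
  fixes q :: "'a::{real_normed_field,banach}"
  shows "lambert (\<lambda>m n. - c m n) q = - lambert c q"
  using lambert_cmult[of "-1" c q] by simp

lemma poly_growth_uminus: "poly_growth c \<Longrightarrow> poly_growth (\<lambda>m n. - c m n)"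
  by (simp add: poly_growth_def)

lemma lambert_diff:
  fixes q :: "'a::{real_normed_field,banach}"
  assumes "poly_growth c" "poly_growth d" "norm q < 1"
  shows "lambert (\<lambda>m n. c m n - d m n) q = lambert c q - lambert d q"
  using lambert_add[OF assms(1) poly_growth_uminus[OF assms(2)] assms(3)]
  by (simp add: lambert_uminus)

lemma poly_growth_sum:
  assumes "finite A" "\<And>i. i \<in> A \<Longrightarrow> poly_growth (c i)"
  shows "poly_growth (\<lambda>m n. \<Sum>i\<in>A. c i m n)"
  using assms
proof (induction A rule: finite_induct)
  case empty
  show ?case using poly_growth_const[of 0] by simp
next
  case (insert i A)
  then show ?case using poly_growth_add[of "c i" "\<lambda>m n. \<Sum>i\<in>A. c i m n"] by simp
qed

lemma lambert_sum:
  fixes q :: "'a::{real_normed_field,banach}"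
  assumes "finite A" "\<And>i. i \<in> A \<Longrightarrow> poly_growth (c i)" "norm q < 1"
  shows "lambert (\<lambda>m n. \<Sum>i\<in>A. c i m n) q = (\<Sum>i\<in>A. lambert (c i) q)"
  using assms
proof (induction A rule: finite_induct)
  case empty
  show ?case by (simp add: lambert_def case_prod_unfold)
next
  case (insert i A)
  then show ?case
    using lambert_add[of "c i" "\<lambda>m n. \<Sum>i\<in>A. c i m n" q] poly_growth_sum[of A c] by simp
qed

lemma lambert_swap:
  fixes q :: "'a::{real_normed_field,banach}"
  shows "lambert (\<lambda>m n. c n m) q = lambert c q"
  unfolding lambert_def
  by (rule infsum_reindex_bij_witness[of _ prod.swap prod.swap]) (auto simp: mult.commute)

lemma Re_lambert:
  assumes "poly_growth c" "\<bar>x\<bar> < 1"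
  shows "Re (lambert c (of_real x)) = lambert (\<lambda>m n. Re (c m n)) x"
    and "Im (lambert c (of_real x)) = lambert (\<lambda>m n. Im (c m n)) x"
proof -
  have *: "((\<lambda>(m, n). c m n * of_real x ^ (m * n)) has_sum lambert c (of_real x)) pairs"
    by (rule lambert_has_sum) (use assms in auto)
  show "Re (lambert c (of_real x)) = lambert (\<lambda>m n. Re (c m n)) x"
    by (rule lambert_eqI[symmetric])
       (use has_sum_Re[OF *] in \<open>simp add: case_prod_unfold of_real_power[symmetric] del: of_real_power\<close>)
  show "Im (lambert c (of_real x)) = lambert (\<lambda>m n. Im (c m n)) x"
    by (rule lambert_eqI[symmetric])
       (use has_sum_Im[OF *] in \<open>simp add: case_prod_unfold of_real_power[symmetric] del: of_real_power\<close>)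
qed

lemma lambert_of_real:
  assumes "poly_growth c" "\<bar>x\<bar> < 1"
  shows "lambert (\<lambda>m n. of_real (c m n)) (complex_of_real x) = of_real (lambert c x)"
  by (rule lambert_eqI)
     (use has_sum_of_real[OF lambert_has_sum[OF assms(1)], of x] assms(2) in
      \<open>simp add: case_prod_unfold\<close>)

subsection \<open>Growth on the imaginary axis\<close>

text \<open>The free exponent serves both ends of the half-line: \<open>k = p\<close> bounds the growth as \<open>t \<rightarrow> 0\<close>, and
  large \<open>k\<close> gives decay faster than any power as \<open>t \<rightarrow> \<infinity>\<close>.\<close>

lemma lambert_decay:
  assumes "poly_growth (c :: nat \<Rightarrow> nat \<Rightarrow> real)"
  obtains p where "\<And>k. k \<ge> p \<Longrightarrow> \<exists>C\<ge>0. \<forall>t>0. \<bar>lambert c (nome t)\<bar> \<le> C / t ^ k"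
proof -
  obtain K p where K: "K \<ge> 0"
    "\<And>m n k t. m \<ge> 1 \<Longrightarrow> n \<ge> 1 \<Longrightarrow> k \<ge> p \<Longrightarrow> t > 0 \<Longrightarrow>
       norm (c m n) * exp (- (2 * pi * t)) ^ (m * n) \<le> K * fact k / t ^ k * (1 / real (m * n) ^ 2)"
    using lambert_term_bound[OF assms(1)] by blast
  define S where "S = (\<Sum>\<^sub>\<infinity>(m, n)\<in>pairs. 1 / real (m * n) ^ 2)"
  have S0: "S \<ge> 0" unfolding S_def by (rule infsum_nonneg) auto
  have S: "((\<lambda>(m, n). 1 / real (m * n) ^ 2) has_sum S) pairs"
    unfolding S_def by (rule has_sum_infsum) (rule inverse_power_summable_pairs, simp)
  show ?thesis
  proof (rule that)
    fix k assume k: "k \<ge> p"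
    show "\<exists>C\<ge>0. \<forall>t>0. \<bar>lambert c (nome t)\<bar> \<le> C / t ^ k"
    proof (intro exI[of _ "K * fact k * S"] conjI allI impI)
      show "K * fact k * S \<ge> 0" using K S0 by simp
      fix t :: real assume t: "t > 0"
      have q: "norm (nome t) < 1" using t by simp
      have "poly_growth (\<lambda>m n. \<bar>c m n\<bar>)" using assms by (simp add: poly_growth_def)
      from lambert_has_sum[OF this q]
      have 1: "((\<lambda>(m, n). \<bar>c m n\<bar> * nome t ^ (m * n)) has_sum lambert (\<lambda>m n. \<bar>c m n\<bar>) (nome t)) pairs" .
      have 2: "((\<lambda>x. K * fact k / t ^ k * (case x of (m, n) \<Rightarrow> 1 / real (m * n) ^ 2))
                has_sum K * fact k / t ^ k * S) pairs"
        by (rule has_sum_cmult_right[OF S])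
      have 3: "lambert (\<lambda>m n. \<bar>c m n\<bar>) (nome t) \<le> K * fact k * S / t ^ k"
        using has_sum_mono[OF 1 2] K(2)[OF _ _ k t] by (auto simp: case_prod_unfold)
      have "\<bar>lambert c (nome t)\<bar> \<le> lambert (\<lambda>m n. \<bar>c m n\<bar>) (nome t)"
        using norm_infsum_bound[OF lambert_abs_summable[OF assms q]]
        unfolding lambert_def by (simp add: case_prod_unfold abs_mult)
      with 3 show "\<bar>lambert c (nome t)\<bar> \<le> K * fact k * S / t ^ k" by linarith
    qed
  qed
qed

subsection \<open>Power series form and derivative\<close>

text \<open>The coefficient of \<open>q^k\<close> in a Lambert series, a divisor sum.\<close>

definition dirichlet_coeff :: "(nat \<Rightarrow> nat \<Rightarrow> 'a::comm_monoid_add) \<Rightarrow> nat \<Rightarrow> 'a" where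
  "dirichlet_coeff c k = (\<Sum>(m, n) | (m, n) \<in> pairs \<and> m * n = k. c m n)"

lemma factor_pairs_subset: "{(m, n). (m, n) \<in> pairs \<and> m * n = k} \<subseteq> {1..k} \<times> {1..k}"
  by auto

lemma finite_factor_pairs: "finite {(m, n). (m, n) \<in> pairs \<and> m * n = k}"
  by (rule finite_subset[OF factor_pairs_subset]) auto

lemma card_factor_pairs: "card {(m, n). (m, n) \<in> pairs \<and> m * n = k} \<le> k"
proof -
  have "card {(m, n). (m, n) \<in> pairs \<and> m * n = k} \<le> card {1..k}"
    by (rule card_inj_on_le[of fst]) (auto simp: inj_on_def)
  then show ?thesis by simp
qed

lemma dirichlet_coeff_0 [simp]: "dirichlet_coeff c 0 = 0"
proof -
  have "{(m, n). (m, n) \<in> pairs \<and> m * n = 0} = {}" by auto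
  then show ?thesis unfolding dirichlet_coeff_def by (metis sum.empty)
qed

lemma dirichlet_coeff_mn:
  "dirichlet_coeff (\<lambda>m n. of_nat (m * n) * c m n) k = of_nat k * (dirichlet_coeff c k :: 'a::comm_semiring_1)"
  unfolding dirichlet_coeff_def sum_distrib_left by (rule sum.cong) auto

lemma dirichlet_coeff_growth:
  fixes c :: "nat \<Rightarrow> nat \<Rightarrow> 'a::real_normed_vector"
  assumes "poly_growth c"
  obtains K p where "K \<ge> 0" "\<And>k. norm (dirichlet_coeff c k) \<le> K * real k ^ p"
proof -
  obtain K p where K: "K \<ge> 0" "\<And>m n. m \<ge> 1 \<Longrightarrow> n \<ge> 1 \<Longrightarrow> norm (c m n) \<le> K * real (m * n) ^ p"
    using assms by (rule poly_growthE) blast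
  show ?thesis
  proof (rule that[of K "Suc p"])
    fix k
    have "norm (dirichlet_coeff c k) \<le> real (card {(m, n). (m, n) \<in> pairs \<and> m * n = k}) * (K * real k ^ p)"
      unfolding dirichlet_coeff_def
    proof (rule sum_norm_bound)
      fix x assume "x \<in> {(m, n). (m, n) \<in> pairs \<and> m * n = k}"
      then show "norm (case x of (m, n) \<Rightarrow> c m n) \<le> K * real k ^ p"
        using K(2)[of "fst x" "snd x"] by auto
    qed
    also have "\<dots> \<le> real k * (K * real k ^ p)"
      by (intro mult_right_mono) (use card_factor_pairs K in auto)
    finally show "norm (dirichlet_coeff c k) \<le> K * real k ^ Suc p" by (simp add: mult_ac)
  qed (use K in auto)
qed

lemma lambert_sums:
  fixes q :: "'a::{real_normed_field,banach}"
  assumes "poly_growth c" "norm q < 1"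
  shows "(\<lambda>k. dirichlet_coeff c k * q ^ k) sums lambert c q"
proof -
  let ?B = "\<lambda>k. {(m, n). (m, n) \<in> pairs \<and> m * n = k}"
  have "((\<lambda>(m, n). c m n * q ^ (m * n)) has_sum lambert c q) pairs"
    by (rule lambert_has_sum[OF assms])
  also have "?this \<longleftrightarrow> ((\<lambda>(k, m, n). c m n * q ^ k) has_sum lambert c q) (Sigma UNIV ?B)"
    by (rule has_sum_reindex_bij_witness[of _ snd "\<lambda>(m, n). (m * n, m, n)"]) auto
  finally have *: "((\<lambda>(k, m, n). c m n * q ^ k) has_sum lambert c q) (Sigma UNIV ?B)" .
  have "((\<lambda>k. dirichlet_coeff c k * q ^ k) has_sum lambert c q) UNIV"
  proof (rule has_sum_SigmaD[OF *])
    fix k :: nat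
    show "((\<lambda>y. case (k, y) of (k, m, n) \<Rightarrow> c m n * q ^ k) has_sum dirichlet_coeff c k * q ^ k) (?B k)"
      by (rule has_sum_finiteI[OF finite_factor_pairs])
         (simp add: dirichlet_coeff_def sum_distrib_right case_prod_unfold)
  qed
  then show ?thesis by (rule has_sum_imp_sums)
qed

lemma lambert_has_field_derivative:
  fixes q :: complex
  assumes c: "poly_growth c" and q: "norm q < 1" "q \<noteq> 0"
  shows "(lambert c has_field_derivative lambert (\<lambda>m n. of_nat (m * n) * c m n) q / q) (at q)"
proof -
  let ?A = "dirichlet_coeff c"
  obtain r where r: "norm q < r" "r < 1" using q(1) dense by blast
  have nr: "norm (of_real r :: complex) < 1"
    using r norm_ge_zero[of q] unfolding norm_of_real by linarith
  have "((\<lambda>x. \<Sum>k. ?A k * x ^ k) has_field_derivative (\<Sum>k. diffs ?A k * q ^ k)) (at q)"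
    by (rule termdiffs_strong[where K = "of_real r"])
       (use lambert_sums[OF c nr] r norm_ge_zero[of q] in \<open>auto simp: sums_iff\<close>)
  moreover have "(\<Sum>k. diffs ?A k * q ^ k) = lambert (\<lambda>m n. of_nat (m * n) * c m n) q / q"
  proof -
    have "(\<lambda>k. of_nat k * ?A k * q ^ k) sums lambert (\<lambda>m n. of_nat (m * n) * c m n) q"
      using lambert_sums[OF poly_growth_mult[OF poly_growth_mn c] q(1)]
      by (simp only: dirichlet_coeff_mn)
    then have "(\<lambda>k. of_nat (Suc k) * ?A (Suc k) * q ^ Suc k) sums lambert (\<lambda>m n. of_nat (m * n) * c m n) q"
      by (subst sums_Suc_iff) simp
    from sums_divide[OF this, of q]
    have "(\<lambda>k. diffs ?A k * q ^ k) sums (lambert (\<lambda>m n. of_nat (m * n) * c m n) q / q)"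
      using q by (simp add: diffs_def mult_ac)
    then show ?thesis by (simp add: sums_iff)
  qed
  ultimately have D: "((\<lambda>x. \<Sum>k. ?A k * x ^ k) has_field_derivative
      lambert (\<lambda>m n. of_nat (m * n) * c m n) q / q) (at q)" by simp
  show ?thesis
  proof (rule has_field_derivative_transform_within_open[OF D, of "ball 0 1"])
    fix x :: complex assume "x \<in> ball 0 1"
    then show "(\<Sum>k. ?A k * x ^ k) = lambert c x"
      using lambert_sums[OF c, of x] by (simp add: sums_iff)
  qed (use q in auto)
qed

lemma norm_qpar_less_1: "Im \<tau> > 0 \<Longrightarrow> norm (qpar \<tau>) < 1"
  by (simp add: qpar_def norm_exp_eq_Re)

lemma qpar_nonzero [simp]: "qpar \<tau> \<noteq> 0"
  by (simp add: qpar_def)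

lemma qpar_add: "qpar (x + y) = qpar x * qpar y"
  by (simp add: qpar_def exp_add distrib_left)

lemma qpar_power: "qpar x ^ n = qpar (of_nat n * x)"
  by (simp add: qpar_def exp_of_nat_mult[symmetric] mult_ac)

lemma qpar_imag: "qpar (Complex 0 t) = of_real (exp (- (2 * pi * t)))"
  by (simp add: qpar_def Complex_eq mult_ac flip: exp_of_real)

lemma lambert_qpar_has_field_derivative:
  assumes "poly_growth c" "Im \<tau> > 0"
  shows "((\<lambda>\<tau>. lambert c (qpar \<tau>)) has_field_derivative
          2 * of_real pi * \<i> * lambert (\<lambda>m n. of_nat (m * n) * c m n) (qpar \<tau>)) (at \<tau>)"
proof -
  have "(qpar has_field_derivative qpar \<tau> * (2 * of_real pi * \<i>)) (at \<tau>)"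
    unfolding qpar_def by (auto intro!: derivative_eq_intros)
  from DERIV_chain2[OF lambert_has_field_derivative[OF assms(1) norm_qpar_less_1[OF assms(2)]] this]
  show ?thesis by (simp add: field_simps)
qed

section \<open>Infinite products and their logarithms\<close>

lemma norm_power_div_le:
  fixes x :: complex
  assumes "m \<ge> 1"
  shows "norm (x ^ m / of_nat m) \<le> norm x ^ m"
proof -
  have "norm x ^ m / real m \<le> norm x ^ m / 1"
    by (rule divide_left_mono) (use assms in auto)
  then show ?thesis by (simp add: norm_divide norm_power)
qed

text \<open>Expanding \<open>Ln (1 - x n)\<close> in powers of \<open>x n\<close> gives a double series, which converges absolutely because
  all \<open>|x n|\<close> stay below a common bound \<open>r < 1\<close>.\<close>

lemma prodinf_one_minus_eq_exp:
  fixes x :: "nat \<Rightarrow> complex"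
  assumes sm: "summable (\<lambda>n. norm (x n))" and lt: "\<And>n. norm (x n) < 1"
  shows "(\<lambda>(m, n). x n ^ m / of_nat m) abs_summable_on {1..} \<times> UNIV"
    and "(\<Prod>n. 1 - x n) = exp (- (\<Sum>\<^sub>\<infinity>(m, n)\<in>{1..} \<times> UNIV. x n ^ m / of_nat m))"
proof -
  obtain M where M: "\<And>n. n \<ge> M \<Longrightarrow> norm (x n) < 1 / 2"
    using summable_LIMSEQ_zero[OF sm] order_tendstoD(2)[of "\<lambda>n. norm (x n)" 0 sequentially "1/2"]
    unfolding eventually_sequentially by auto
  \<comment> \<open>Beyond \<open>M\<close> the terms are smaller than \<open>1 / 2\<close>, and finitely many terms have a maximum below \<open>1\<close>.\<close>
  define r where "r = Max (insert (1/2) ((\<lambda>n. norm (x n)) ` {..<M}))"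
  have r1: "r < 1" unfolding r_def using lt by (subst Max_less_iff) auto
  have r: "norm (x n) \<le> r" for n
  proof (cases "n < M")
    case True
    then show ?thesis unfolding r_def by (intro Max_ge) auto
  next
    case False
    then have "norm (x n) \<le> 1 / 2" using M[of n] by simp
    also have "\<dots> \<le> r" unfolding r_def by (intro Max_ge) auto
    finally show ?thesis .
  qed
  have S0: "(\<lambda>n. norm (x n) / (1 - norm (x n))) summable_on UNIV"
  proof (rule summable_on_comparison_test)
    show "(\<lambda>n. norm (x n) / (1 - r)) summable_on UNIV"
      using norm_summable_imp_summable_on[of "\<lambda>n. norm (x n) / (1 - r)"] summable_divide[OF sm, of "1 - r"] r1
      by simp
    show "norm (x n) / (1 - norm (x n)) \<le> norm (x n) / (1 - r)" for n
      using r[of n] r1 by (intro divide_left_mono mult_pos_pos) auto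
  qed (use lt in \<open>auto simp: less_imp_le\<close>)
  have S1: "(\<lambda>(n, m). norm (x n) ^ m) summable_on UNIV \<times> {1..}"
  proof (rule summable_on_SigmaI[OF _ S0])
    fix n
    show "((\<lambda>y. case (n, y) of (n, m) \<Rightarrow> norm (x n) ^ m) has_sum norm (x n) / (1 - norm (x n))) {1..}"
      using has_sum_geometric_from_1[of "norm (x n)"] lt[of n] by simp
  qed auto
  have S2: "(\<lambda>(n, m). x n ^ m / of_nat m) abs_summable_on UNIV \<times> {1..}"
  proof (rule summable_on_comparison_test[OF S1])
    fix y :: "nat \<times> nat" assume "y \<in> UNIV \<times> {1..}"
    then show "norm (case y of (n, m) \<Rightarrow> x n ^ m / of_nat m) \<le> (case y of (n, m) \<Rightarrow> norm (x n) ^ m)"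
      by (auto intro: norm_power_div_le)
  qed auto
  have swap: "(\<lambda>(m, n). norm (x n ^ m / of_nat m)) summable_on ({1..} \<times> UNIV) \<longleftrightarrow>
        (\<lambda>(n, m). norm (x n ^ m / of_nat m)) summable_on (UNIV \<times> {1..})"
    by (rule summable_on_reindex_bij_witness[of _ prod.swap prod.swap]) auto
  then show "(\<lambda>(m, n). x n ^ m / of_nat m) abs_summable_on {1..} \<times> UNIV"
    using S2 by (simp add: case_prod_unfold)
  define S where "S = (\<Sum>\<^sub>\<infinity>(m, n)\<in>{1..} \<times> UNIV. x n ^ m / of_nat m)"
  have S_eq: "S = (\<Sum>\<^sub>\<infinity>(n, m)\<in>UNIV \<times> {1..}. x n ^ m / of_nat m)"
    unfolding S_def by (rule infsum_reindex_bij_witness[of _ prod.swap prod.swap]) auto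
  have hs: "((\<lambda>(n, m). x n ^ m / of_nat m) has_sum S) (UNIV \<times> {1..})"
    unfolding S_eq by (rule has_sum_infsum) (rule abs_summable_summable[OF S2])
  have "((\<lambda>n. - Ln (1 - x n)) has_sum S) UNIV"
  proof (rule has_sum_SigmaD[OF hs])
    fix n
    have "(-1) ^ m * (- z) ^ m = z ^ m" for z :: complex and m
      unfolding power_mult_distrib[symmetric] by simp
    then have eq: "- ((-1) ^ Suc m / of_nat m * (- x n) ^ m) = x n ^ m / of_nat m" for m
      by simp
    have "(\<lambda>m. (-1) ^ Suc m / of_nat m * (- x n) ^ m) sums Ln (1 + (- x n))"
      by (rule Ln_series) (use lt in auto)
    from sums_minus[OF this] have sm: "(\<lambda>m. x n ^ m / of_nat m) sums (- Ln (1 - x n))"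
      unfolding eq by simp
    have "((\<lambda>m. x n ^ m / of_nat m) has_sum (- Ln (1 - x n))) UNIV"
    proof (rule norm_summable_imp_has_sum[OF _ sm])
      show "summable (\<lambda>m. norm (x n ^ m / of_nat m))"
      proof (rule summable_comparison_test')
        show "summable (\<lambda>m. norm (x n) ^ m)" using lt[of n] by (simp add: summable_geometric)
        show "norm (norm (x n ^ m / of_nat m)) \<le> norm (x n) ^ m" if "m \<ge> 1" for m
          using norm_power_div_le[OF that, of "x n"] by (simp only: real_norm_def abs_norm_cancel)
      qed
    qed
    also have "?this \<longleftrightarrow> ((\<lambda>m. x n ^ m / of_nat m) has_sum (- Ln (1 - x n))) {1..}"
      by (rule has_sum_cong_neutral) (auto simp: not_le)
    finally show "((\<lambda>m. case (n, m) of (n, m) \<Rightarrow> x n ^ m / of_nat m) has_sum (- Ln (1 - x n))) {1..}"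
      by simp
  qed
  from sums_minus[OF has_sum_imp_sums[OF this]]
  have "(\<lambda>n. Ln (1 - x n)) sums (- S)" by simp
  then have "(\<Prod>n. exp (Ln (1 - x n))) = exp (- S)"
    by (subst prodinf_exp) (auto simp: sums_iff)
  moreover have "exp (Ln (1 - x n)) = 1 - x n" for n
    using lt[of n] by (intro exp_Ln) auto
  ultimately show "(\<Prod>n. 1 - x n) = exp (- (\<Sum>\<^sub>\<infinity>(m, n)\<in>{1..} \<times> UNIV. x n ^ m / of_nat m))"
    by (simp add: S_def)
qed

text \<open>The q-Pochhammer symbol \<open>(w; q)\<^sub>\<infinity>\<close>.\<close>

definition qpoch :: "complex \<Rightarrow> complex \<Rightarrow> complex" where
  "qpoch w q = (\<Prod>n. 1 - w * q ^ n)"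

context
  fixes q :: complex
  assumes q: "norm q < 1"
begin

lemma qpoch_summable: "summable (\<lambda>n. norm (w * q ^ n))"
  using q by (auto simp: norm_mult norm_power intro: summable_mult summable_geometric)

lemma qpoch_convergent: "convergent_prod (\<lambda>n. 1 - w * q ^ n)"
proof -
  have "abs_convergent_prod (\<lambda>n. 1 + (- (w * q ^ n)))"
    using qpoch_summable[of w] by (subst abs_convergent_prod_conv_summable) simp
  then show ?thesis using abs_convergent_prod_imp_convergent_prod by fastforce
qed

lemma qpoch_LIMSEQ: "(\<lambda>K. \<Prod>n<K. 1 - w * q ^ n) \<longlonglongrightarrow> qpoch w q"
  using convergent_prod_LIMSEQ[OF qpoch_convergent, of w]
  unfolding qpoch_def by (subst LIMSEQ_lessThan_iff_atMost)

end

context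
  fixes q :: complex
  assumes q: "norm q < 1"
begin

lemma qpoch_shift: "qpoch w q = (1 - w) * qpoch (q * w) q"
proof -
  have "(\<lambda>K. \<Prod>n<Suc K. 1 - w * q ^ n) \<longlonglongrightarrow> qpoch w q"
    using qpoch_LIMSEQ[OF q, of w] by (rule LIMSEQ_Suc)
  moreover have "(\<lambda>K. \<Prod>n<Suc K. 1 - w * q ^ n) = (\<lambda>K. (1 - w) * (\<Prod>n<K. 1 - (q * w) * q ^ n))"
    by (subst prod.lessThan_Suc_shift) (simp add: mult_ac)
  moreover have "(\<lambda>K. (1 - w) * (\<Prod>n<K. 1 - (q * w) * q ^ n)) \<longlonglongrightarrow> (1 - w) * qpoch (q * w) q"
    by (intro tendsto_intros qpoch_LIMSEQ q)
  ultimately show ?thesis using LIMSEQ_unique by metis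
qed

lemma qpoch_holomorphic: "(\<lambda>w. qpoch w q) holomorphic_on UNIV"
proof (rule holomorphic_uniform_sequence[where f = "\<lambda>K w. \<Prod>n<K. 1 - w * q ^ n"])
  fix x :: complex
  have "uniformly_convergent_on (cball x 1) (\<lambda>K w. \<Prod>n<K. 1 - w * q ^ n)"
  proof (rule uniformly_convergent_on_prod')
    have "uniformly_convergent_on (cball x 1) (\<lambda>N w. \<Sum>n<N. norm (w * q ^ n))"
    proof (rule Weierstrass_m_test')
      show "summable (\<lambda>n. (norm x + 1) * norm q ^ n)"
        using q by (intro summable_mult summable_geometric) auto
      fix n w assume "w \<in> cball x 1"
      then have "norm w \<le> norm x + 1"
        using norm_triangle_ineq2[of w x] by (simp add: dist_norm norm_minus_commute)
      then show "norm (norm (w * q ^ n)) \<le> (norm x + 1) * norm q ^ n"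
        unfolding real_norm_def abs_norm_cancel
        by (simp only: norm_mult norm_power) (intro mult_right_mono, auto)
    qed
    then show "uniformly_convergent_on (cball x 1) (\<lambda>N w. \<Sum>n<N. norm (1 - w * q ^ n - 1))"
      by simp
  qed (auto intro!: continuous_intros)
  then have "uniform_limit (cball x 1) (\<lambda>K w. \<Prod>n<K. 1 - w * q ^ n)
               (\<lambda>w. lim (\<lambda>K. \<Prod>n<K. 1 - w * q ^ n)) sequentially"
    by (simp add: uniformly_convergent_uniform_limit_iff)
  moreover have "(\<lambda>w. lim (\<lambda>K. \<Prod>n<K. 1 - w * q ^ n)) = (\<lambda>w. qpoch w q)"
    using limI[OF qpoch_LIMSEQ[OF q]] by blast
  ultimately show "\<exists>d>0. cball x d \<subseteq> UNIV \<and>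
      uniform_limit (cball x d) (\<lambda>K w. \<Prod>n<K. 1 - w * q ^ n) (\<lambda>w. qpoch w q) sequentially"
    by (intro exI[of _ 1]) auto
qed (auto intro!: holomorphic_intros)

text \<open>With \<open>qpoch_square\<close>, this yields the duplication formula of the theta function: separating even and
  odd powers of \<open>q\<close> produces the half periods \<open>\<tau> / 2\<close>, and \<open>1 - x\<^sup>2 = (1 - x) (1 + x)\<close> the half
  period \<open>1 / 2\<close>.\<close>

lemma qpoch_even_odd: "qpoch w q = qpoch w (q\<^sup>2) * qpoch (w * q) (q\<^sup>2)"
proof -
  have q2: "norm (q\<^sup>2) < 1" using q by (simp add: norm_power power_less_one_iff)
  have split: "(\<Prod>n<2*K. 1 - w * q ^ n) = (\<Prod>n<K. 1 - w * (q\<^sup>2) ^ n) * (\<Prod>n<K. 1 - (w * q) * (q\<^sup>2) ^ n)" for K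
  proof (induction K)
    case (Suc K)
    have "2 * Suc K = Suc (Suc (2 * K))" by simp
    moreover have "w * q ^ (2 * K) = w * (q\<^sup>2) ^ K" "w * q ^ Suc (2 * K) = (w * q) * (q\<^sup>2) ^ K"
      by (simp_all only: power_Suc power_mult mult.assoc)
    ultimately show ?case
      by (simp only: prod.lessThan_Suc Suc.IH) (simp only: mult_ac)
  qed simp
  have "(\<lambda>K. \<Prod>n<2*K. 1 - w * q ^ n) \<longlonglongrightarrow> qpoch w q"
    using LIMSEQ_subseq_LIMSEQ[OF qpoch_LIMSEQ[OF q, of w], of "\<lambda>K. 2 * K"]
    by (simp add: o_def strict_mono_def)
  then have "(\<lambda>K. (\<Prod>n<K. 1 - w * (q\<^sup>2) ^ n) * (\<Prod>n<K. 1 - (w * q) * (q\<^sup>2) ^ n)) \<longlonglongrightarrow> qpoch w q"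
    unfolding split .
  then show ?thesis
    by (rule LIMSEQ_unique) (intro tendsto_mult qpoch_LIMSEQ[OF q2])
qed

lemma qpoch_square: "qpoch (w\<^sup>2) (q\<^sup>2) = qpoch w q * qpoch (- w) q"
proof -
  have "(\<lambda>K. \<Prod>n<K. 1 - w\<^sup>2 * (q\<^sup>2) ^ n) = (\<lambda>K. (\<Prod>n<K. 1 - w * q ^ n) * (\<Prod>n<K. 1 - (- w) * q ^ n))"
    unfolding prod.distrib[symmetric]
    by (intro ext prod.cong refl)
       (simp add: algebra_simps power2_eq_square power_mult_distrib)
  moreover have "\<dots> \<longlonglongrightarrow> qpoch w q * qpoch (- w) q"
    by (intro tendsto_mult qpoch_LIMSEQ q)
  moreover have "norm (q\<^sup>2) < 1" using q by (simp add: norm_power power_less_one_iff)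
  then have "(\<lambda>K. \<Prod>n<K. 1 - w\<^sup>2 * (q\<^sup>2) ^ n) \<longlonglongrightarrow> qpoch (w\<^sup>2) (q\<^sup>2)"
    by (rule qpoch_LIMSEQ)
  ultimately show ?thesis using LIMSEQ_unique by metis
qed

lemma qpoch_nonzero:
  assumes "norm w < 1"
  shows "qpoch w q \<noteq> 0"
proof -
  have "norm (w * q ^ n) < 1" for n
  proof -
    have "norm (w * q ^ n) \<le> norm w * 1"
      unfolding norm_mult norm_power using q by (intro mult_left_mono power_le_one) auto
    then show ?thesis using assms by simp
  qed
  from prodinf_one_minus_eq_exp(2)[OF qpoch_summable[OF q] this]
  show ?thesis by (simp add: qpoch_def)
qed

lemma qpoch_exp:
  assumes "norm w < 1"
  shows "(\<lambda>(m, n). w ^ m * q ^ (n * m) / of_nat m) abs_summable_on {1..} \<times> UNIV"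
    and "qpoch w q = exp (- (\<Sum>\<^sub>\<infinity>(m, n)\<in>{1..} \<times> UNIV. w ^ m * q ^ (n * m) / of_nat m))"
proof -
  have *: "norm (w * q ^ n) < 1" for n
  proof -
    have "norm (w * q ^ n) \<le> norm w * 1"
      unfolding norm_mult norm_power using q by (intro mult_left_mono power_le_one) auto
    then show ?thesis using assms by simp
  qed
  show "(\<lambda>(m, n). w ^ m * q ^ (n * m) / of_nat m) abs_summable_on {1..} \<times> UNIV"
    and "qpoch w q = exp (- (\<Sum>\<^sub>\<infinity>(m, n)\<in>{1..} \<times> UNIV. w ^ m * q ^ (n * m) / of_nat m))"
    using prodinf_one_minus_eq_exp[OF qpoch_summable[OF q] *]
    unfolding qpoch_def power_mult_distrib power_mult by blast+
qed

text \<open>Summing the double series for the logarithm over \<open>n\<close> first leaves a power series in \<open>w\<close>, which may be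
  differentiated term by term. The coefficient at \<open>m = 0\<close> is \<open>1 / 0 = 0\<close>, as it should be.\<close>

lemma qpoch_exp_power_series:
  assumes "norm w < 1"
  shows "(\<lambda>m. 1 / (of_nat m * (1 - q ^ m)) * w ^ m) sums
           (\<Sum>\<^sub>\<infinity>(m, n)\<in>{1..} \<times> UNIV. w ^ m * q ^ (n * m) / of_nat m)"
proof -
  have hs: "((\<lambda>(m, n). w ^ m * q ^ (n * m) / of_nat m) has_sum
        (\<Sum>\<^sub>\<infinity>(m, n)\<in>{1..} \<times> UNIV. w ^ m * q ^ (n * m) / of_nat m)) ({1..} \<times> UNIV)"
    by (rule has_sum_infsum) (rule abs_summable_summable[OF qpoch_exp(1)[OF assms]])
  have "((\<lambda>m. 1 / (of_nat m * (1 - q ^ m)) * w ^ m) has_sum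
        (\<Sum>\<^sub>\<infinity>(m, n)\<in>{1..} \<times> UNIV. w ^ m * q ^ (n * m) / of_nat m)) {1..}"
  proof (rule has_sum_SigmaD[OF hs])
    fix m :: nat assume "m \<in> {1..}"
    then have qm: "norm (q ^ m) < 1" using q by (simp add: norm_power power_less_one_iff)
    have "((\<lambda>n. (q ^ m) ^ n) has_sum (1 / (1 - q ^ m))) UNIV"
      by (rule norm_summable_imp_has_sum)
         (use qm geometric_sums[OF qm] in \<open>auto simp: norm_power intro: summable_geometric\<close>)
    from has_sum_cmult_right[OF this, of "w ^ m / of_nat m"]
    show "((\<lambda>n. case (m, n) of (m, n) \<Rightarrow> w ^ m * q ^ (n * m) / of_nat m) has_sum
             1 / (of_nat m * (1 - q ^ m)) * w ^ m) UNIV"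
      by (simp add: power_mult[symmetric] mult_ac)
  qed
  also have "?this \<longleftrightarrow> ((\<lambda>m. 1 / (of_nat m * (1 - q ^ m)) * w ^ m) has_sum
        (\<Sum>\<^sub>\<infinity>(m, n)\<in>{1..} \<times> UNIV. w ^ m * q ^ (n * m) / of_nat m)) UNIV"
    by (rule has_sum_cong_neutral) (auto simp: not_le)
  finally show ?thesis by (rule has_sum_imp_sums)
qed

lemma qpoch_has_field_derivative:
  assumes w: "norm w < 1" "w \<noteq> 0"
  shows "((\<lambda>w. qpoch w q) has_field_derivative
           - (\<Sum>\<^sub>\<infinity>(m, n)\<in>{1..} \<times> UNIV. w ^ m * q ^ (n * m)) / w * qpoch w q) (at w)"
proof -
  let ?a = "\<lambda>m. 1 / (of_nat m * (1 - q ^ m))"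
  obtain r where r: "norm w < r" "r < 1" using w(1) dense by blast
  have r0: "r > 0" using r norm_ge_zero[of w] by linarith
  have nr: "norm (of_real r :: complex) < 1" using r r0 by simp
  have D: "((\<lambda>x. \<Sum>k. ?a k * x ^ k) has_field_derivative (\<Sum>k. diffs ?a k * w ^ k)) (at w)"
    by (rule termdiffs_strong[where K = "of_real r"])
       (use qpoch_exp_power_series[OF nr] r r0 in \<open>auto simp: sums_iff\<close>)
  have ser: "(\<lambda>k. diffs ?a k * w ^ k) sums ((\<Sum>\<^sub>\<infinity>(m, n)\<in>{1..} \<times> UNIV. w ^ m * q ^ (n * m)) / w)"
  proof -
    have d: "diffs ?a k = 1 / (1 - q ^ Suc k)" for k
      by (simp add: diffs_def del: of_nat_Suc)
    have sm: "summable (\<lambda>k. norm (1 / (1 - q ^ Suc k) * w ^ Suc k))"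
    proof (rule summable_comparison_test')
      show "summable (\<lambda>k. 1 / (1 - norm q) * norm w ^ k)"
        using w by (intro summable_mult summable_geometric) auto
      show "norm (norm (1 / (1 - q ^ Suc k) * w ^ Suc k)) \<le> 1 / (1 - norm q) * norm w ^ k" for k
      proof -
        have "norm (q ^ Suc k) \<le> norm q"
          unfolding norm_power using q power_decreasing[of 1 "Suc k" "norm q"] by simp
        then have "1 - norm q \<le> norm (1 - q ^ Suc k)"
          using norm_triangle_ineq2[of 1 "q ^ Suc k"] by simp
        then have "norm (1 / (1 - q ^ Suc k)) \<le> 1 / (1 - norm q)"
          using q by (simp add: norm_divide frac_le)
        moreover have "norm (w ^ Suc k) \<le> norm w ^ k"
          unfolding norm_power using w by (intro power_decreasing) auto
        ultimately have "norm (1 / (1 - q ^ Suc k)) * norm (w ^ Suc k) \<le> 1 / (1 - norm q) * norm w ^ k"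
          using q by (intro mult_mono) auto
        then show ?thesis
          unfolding real_norm_def abs_norm_cancel by (simp only: norm_mult)
      qed
    qed
    have hs: "((\<lambda>k. 1 / (1 - q ^ Suc k) * w ^ Suc k) has_sum (\<Sum>k. 1 / (1 - q ^ Suc k) * w ^ Suc k)) UNIV"
      by (rule norm_summable_imp_has_sum[OF sm]) (rule summable_sums[OF summable_norm_cancel[OF sm]])
    have hs1: "((\<lambda>m. 1 / (1 - q ^ m) * w ^ m) has_sum (\<Sum>k. 1 / (1 - q ^ Suc k) * w ^ Suc k)) {1..}"
      by (rule iffD1[OF has_sum_reindex_bij_witness[of _ "\<lambda>m. m - 1" Suc] hs]) auto
    have inner: "((\<lambda>n. w ^ m * q ^ (n * m)) has_sum (1 / (1 - q ^ m) * w ^ m)) UNIV"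
      and inner_norm: "((\<lambda>n. norm (w ^ m * q ^ (n * m))) has_sum (norm w ^ m * (1 / (1 - norm q ^ m)))) UNIV"
      if "m \<ge> 1" for m
    proof -
      have qm: "norm (q ^ m) < 1" using q that by (simp add: norm_power power_less_one_iff)
      have "((\<lambda>n. (q ^ m) ^ n) has_sum (1 / (1 - q ^ m))) UNIV"
        by (rule norm_summable_imp_has_sum)
           (use qm geometric_sums[OF qm] in \<open>auto simp: norm_power intro: summable_geometric\<close>)
      from has_sum_cmult_right[OF this, of "w ^ m"]
      show "((\<lambda>n. w ^ m * q ^ (n * m)) has_sum (1 / (1 - q ^ m) * w ^ m)) UNIV"
        by (simp add: power_mult[symmetric] mult_ac)
      have qm': "norm (norm q ^ m) < 1" using qm by (simp add: norm_power)
      have "((\<lambda>n. (norm q ^ m) ^ n) has_sum (1 / (1 - norm q ^ m))) UNIV"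
        by (rule norm_summable_imp_has_sum)
           (use qm' geometric_sums[OF qm'] in \<open>auto simp: norm_power intro: summable_geometric\<close>)
      from has_sum_cmult_right[OF this, of "norm w ^ m"]
      show "((\<lambda>n. norm (w ^ m * q ^ (n * m))) has_sum (norm w ^ m * (1 / (1 - norm q ^ m)))) UNIV"
        by (simp add: power_mult[symmetric] mult_ac norm_mult norm_power)
    qed
    have "(\<lambda>m. norm w ^ m * (1 / (1 - norm q ^ m))) summable_on {1..}"
    proof (rule summable_on_comparison_test)
      show "(\<lambda>m. norm w ^ m * (1 / (1 - norm q))) summable_on {1..}"
        using has_sum_geometric_from_1[of "norm w"] w
        by (intro summable_on_cmult_left) (auto simp: summable_on_def)
      fix m :: nat assume "m \<in> {1..}"
      then have "norm q ^ m \<le> norm q"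
        using q power_decreasing[of 1 m "norm q"] by simp
      then show "norm w ^ m * (1 / (1 - norm q ^ m)) \<le> norm w ^ m * (1 / (1 - norm q))"
        using q by (intro mult_left_mono frac_le) auto
      show "0 \<le> norm w ^ m * (1 / (1 - norm q ^ m))"
        using q power_le_one[of "norm q" m] by simp
    qed
    then have "(\<lambda>(m, n). w ^ m * q ^ (n * m)) abs_summable_on {1..} \<times> UNIV"
      by (rule summable_on_SigmaI[rotated]) (use inner_norm in auto)
    from has_sum_SigmaD[OF has_sum_infsum[OF abs_summable_summable[OF this]]]
    have "((\<lambda>m. 1 / (1 - q ^ m) * w ^ m) has_sum (\<Sum>\<^sub>\<infinity>(m, n)\<in>{1..} \<times> UNIV. w ^ m * q ^ (n * m))) {1..}"
      using inner by auto
    then have eq: "(\<Sum>k. 1 / (1 - q ^ Suc k) * w ^ Suc k) = (\<Sum>\<^sub>\<infinity>(m, n)\<in>{1..} \<times> UNIV. w ^ m * q ^ (n * m))"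
      by (rule has_sum_unique[OF hs1])
    have "(\<lambda>k. 1 / (1 - q ^ Suc k) * w ^ Suc k) sums (\<Sum>\<^sub>\<infinity>(m, n)\<in>{1..} \<times> UNIV. w ^ m * q ^ (n * m))"
      using has_sum_imp_sums[OF hs] unfolding eq .
    from sums_divide[OF this, of w] show ?thesis unfolding d using w by simp
  qed
  have E: "((\<lambda>x. exp (- (\<Sum>k. ?a k * x ^ k))) has_field_derivative
      - (\<Sum>\<^sub>\<infinity>(m, n)\<in>{1..} \<times> UNIV. w ^ m * q ^ (n * m)) / w * qpoch w q) (at w)"
  proof -
    have "qpoch w q = exp (- (\<Sum>k. ?a k * w ^ k))"
      using qpoch_exp(2)[OF w(1)] qpoch_exp_power_series[OF w(1)] by (simp add: sums_iff)
    then show ?thesis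
      using DERIV_chain2[OF DERIV_exp DERIV_minus[OF D]] sums_unique[OF ser]
      by (simp add: mult.commute)
  qed
  show ?thesis
  proof (rule has_field_derivative_transform_within_open[OF E, of "ball 0 1"])
    fix x :: complex assume "x \<in> ball 0 1"
    then show "exp (- (\<Sum>k. ?a k * x ^ k)) = qpoch x q"
      using qpoch_exp(2)[of x] qpoch_exp_power_series[of x] by (simp add: sums_iff)
  qed (use w in auto)
qed

end

subsection \<open>Residue classes\<close>

definition residue_ind :: "nat \<Rightarrow> int \<Rightarrow> nat \<Rightarrow> 'a::zero_neq_one" where
  "residue_ind N l n = (if [int n = l] (mod int N) then 1 else 0)"

lemma norm_residue_ind_le: "norm (residue_ind N l n :: 'a::real_normed_div_algebra) \<le> 1"
  by (simp add: residue_ind_def)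

lemma residue_ind_cong: "[k = l] (mod int N) \<Longrightarrow> residue_ind N k = residue_ind N l"
  by (auto simp: residue_ind_def fun_eq_iff cong_def)

text \<open>The range \<open>1 \<le> l \<le> N\<close> makes \<open>l\<close> the least positive member of its class.\<close>

lemma residue_class_bij:
  assumes "1 \<le> l" "l \<le> N"
  shows "bij_betw (\<lambda>j. l + N * j) UNIV {n. n \<ge> 1 \<and> [int n = int l] (mod int N)}"
proof (rule bij_betwI[where g = "\<lambda>n. (n - l) div N"])
  show "(\<lambda>j. l + N * j) \<in> UNIV \<rightarrow> {n. n \<ge> 1 \<and> [int n = int l] (mod int N)}"
  proof (intro funcsetI)
    fix j
    have "[l + N * j = l] (mod N)" by (simp add: unique_euclidean_semiring_class.cong_def)
    then show "l + N * j \<in> {n. n \<ge> 1 \<and> [int n = int l] (mod int N)}"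
      using assms by (simp add: cong_int_iff del: of_nat_add of_nat_mult)
  qed
  fix n assume n: "n \<in> {n. n \<ge> 1 \<and> [int n = int l] (mod int N)}"
  then have "[n = l] (mod N)" by (auto simp: cong_int_iff)
  then have eq: "n mod N = l mod N" by (simp only: unique_euclidean_semiring_class.cong_def)
  have "n \<ge> l"
  proof (rule ccontr)
    assume "\<not> n \<ge> l"
    then have "n < N" "n < l" using assms by auto
    with eq n assms show False by (cases "l = N") auto
  qed
  moreover from eq this have "N dvd n - l" by (simp add: mod_eq_dvd_iff_nat)
  ultimately show "l + N * ((n - l) div N) = n" by simp
qed (use assms in auto)

lemma residue_class_geometric:
  assumes l: "1 \<le> l" "l \<le> N" and x: "0 \<le> x" "x < (1::real)"
  shows "((\<lambda>n. residue_ind N (int l) n * x ^ n) has_sum (x ^ l / (1 - x ^ N))) {1..}"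
proof -
  have xN: "norm (x ^ N) < 1" using assms by (simp add: power_less_one_iff)
  have "summable (\<lambda>j. norm ((x ^ N) ^ j))"
    unfolding norm_power[of "x ^ N"] by (rule summable_geometric) (use xN in simp)
  then have "((\<lambda>j. (x ^ N) ^ j) has_sum (1 / (1 - x ^ N))) UNIV"
    by (rule norm_summable_imp_has_sum) (rule geometric_sums[OF xN])
  from has_sum_cmult_right[OF this, of "x ^ l"]
  have "((\<lambda>j. x ^ (l + N * j)) has_sum (x ^ l / (1 - x ^ N))) UNIV"
    by (simp add: power_add power_mult)
  also have "?this \<longleftrightarrow> ((\<lambda>n. x ^ n) has_sum (x ^ l / (1 - x ^ N))) {n. n \<ge> 1 \<and> [int n = int l] (mod int N)}"
    by (rule has_sum_reindex_bij_betw[OF residue_class_bij[OF l]])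
  also have "\<dots> \<longleftrightarrow> ?thesis"
    by (rule has_sum_cong_neutral) (auto simp: residue_ind_def split: if_splits)
  finally show ?thesis .
qed

lemma infsum_residue_reindex:
  fixes s :: complex
  assumes "1 \<le> l" "l \<le> N"
  shows "(\<Sum>\<^sub>\<infinity>(m, n)\<in>{1..} \<times> UNIV. \<phi> m * ((s ^ l) ^ m * (s ^ N) ^ (n * m))) =
         lambert (\<lambda>m n. \<phi> m * residue_ind N (int l) n) s"
proof -
  let ?R = "{n. n \<ge> 1 \<and> [int n = int l] (mod int N)}"
  have "bij_betw (map_prod id (\<lambda>j. l + N * j)) ({1::nat..} \<times> UNIV) ({1..} \<times> ?R)"
    by (rule bij_betw_map_prod[OF bij_betw_id residue_class_bij[OF assms]])
  from infsum_reindex_bij_betw[OF this, of "\<lambda>(m, n). \<phi> m * s ^ (m * n)"]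
  have "(\<Sum>\<^sub>\<infinity>(m, n)\<in>{1..} \<times> UNIV. \<phi> m * ((s ^ l) ^ m * (s ^ N) ^ (n * m))) =
      (\<Sum>\<^sub>\<infinity>(m, n)\<in>{1..} \<times> ?R. \<phi> m * s ^ (m * n))"
    by (simp add: case_prod_unfold algebra_simps power_add flip: power_mult)
  also have "\<dots> = lambert (\<lambda>m n. \<phi> m * residue_ind N (int l) n) s"
    unfolding lambert_def
    by (rule infsum_cong_neutral) (auto simp: residue_ind_def split: if_splits)
  finally show ?thesis .
qed

text \<open>The Pochhammer symbol at a division point, with modulus \<open>s^N\<close>, is the product of
  \<open>1 - z s^n\<close> over the positive \<open>n \<equiv> l\<close>, so its logarithm is a Lambert series in \<open>s\<close>.\<close>

lemma qpoch_residue_exp: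
  assumes "norm s < 1" "norm z = 1" "1 \<le> l" "l \<le> N"
  shows "qpoch (z * s ^ l) (s ^ N) =
         exp (- lambert (\<lambda>m n. z ^ m / of_nat m * residue_ind N (int l) n) s)"
proof -
  have q: "norm (s ^ N) < 1" and w: "norm (z * s ^ l) < 1"
    using assms by (auto simp: norm_mult norm_power power_less_one_iff)
  show ?thesis
    unfolding qpoch_exp(2)[OF q w] infsum_residue_reindex[OF assms(3,4), symmetric]
    by (simp add: power_mult_distrib mult_ac)
qed

lemma residue_product_exp:
  fixes q :: complex
  assumes "norm q < 1"
  shows "(\<Prod>n. if n \<ge> 1 \<and> [int n = a] (mod int N) then 1 - q ^ n else 1) =
         exp (- lambert (\<lambda>m n. 1 / of_nat m * residue_ind N a n) q)"
proof -
  define x where "x = (\<lambda>n. if n \<ge> 1 \<and> [int n = a] (mod int N) then q ^ n else 0)"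
  have "(\<Prod>n. if n \<ge> 1 \<and> [int n = a] (mod int N) then 1 - q ^ n else 1) = (\<Prod>n. 1 - x n)"
    by (rule prodinf_cong) (simp add: x_def)
  also have "\<dots> = exp (- (\<Sum>\<^sub>\<infinity>(m, n)\<in>{1..} \<times> UNIV. x n ^ m / of_nat m))"
  proof (rule prodinf_one_minus_eq_exp(2))
    show "summable (\<lambda>n. norm (x n))"
    proof (rule summable_comparison_test')
      show "summable (\<lambda>n. norm q ^ n)" using assms by (simp add: summable_geometric)
      show "norm (norm (x n)) \<le> norm q ^ n" for n by (simp add: x_def norm_power)
    qed
    show "norm (x n) < 1" for n using assms by (auto simp: x_def norm_power power_less_one_iff)
  qed
  also have "(\<Sum>\<^sub>\<infinity>(m, n)\<in>{1..} \<times> UNIV. x n ^ m / of_nat m) =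
      lambert (\<lambda>m n. 1 / of_nat m * residue_ind N a n) q"
    unfolding lambert_def
    by (rule infsum_cong_neutral)
       (auto simp: x_def residue_ind_def power_mult[symmetric] mult_ac not_le split: if_splits)
  finally show ?thesis .
qed

section \<open>The theta function and its transformation\<close>

lemma qpar_of_int [simp]: "qpar (of_int n) = 1"
  using exp_integer_2pi[of "of_int n"] by (simp add: qpar_def mult_ac)

lemma qpar_0 [simp]: "qpar 0 = 1" and qpar_1 [simp]: "qpar 1 = 1"
  using qpar_of_int[of 0] qpar_of_int[of 1] by simp_all

lemma qpar_diff: "qpar (x - y) = qpar x / qpar y"
  by (simp add: qpar_def exp_diff right_diff_distrib)

lemma qpar_minus: "qpar (- x) = 1 / qpar x"
  by (simp add: qpar_def exp_minus field_simps)

lemma qpar_half: "qpar (1 / 2) = -1"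
  by (simp add: qpar_def)

lemma norm_qpar: "norm (qpar z) = exp (- (2 * pi * Im z))"
  by (simp add: qpar_def norm_exp_eq_Re)

lemma qpar_eq_1_iff: "qpar z = 1 \<longleftrightarrow> z \<in> \<int>"
proof
  assume "qpar z = 1"
  then obtain n :: int where "- (2 * pi * Im z) = 0" "2 * pi * Re z = of_int (2 * n) * pi"
    unfolding qpar_def exp_eq_1 by (auto simp: mult_ac)
  then have "z = of_int n" by (simp add: complex_eq_iff)
  then show "z \<in> \<int>" by simp
qed (auto elim!: Ints_cases)

lemma holomorphic_qpar [holomorphic_intros]:
  "f holomorphic_on A \<Longrightarrow> (\<lambda>z. qpar (f z)) holomorphic_on A"
  unfolding qpar_def by (intro holomorphic_intros)

lemma continuous_on_qpar [continuous_intros]: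
  "continuous_on A f \<Longrightarrow> continuous_on A (\<lambda>z. qpar (f z))"
  unfolding qpar_def by (intro continuous_intros)

text \<open>Jacobi's triple product without its factor \<open>\<Prod>(1 - q^n)\<close>. As a function of \<open>z\<close> it has simple zeros,
  exactly at the points of \<open>\<int> + \<int> \<tau>\<close>.\<close>

definition theta :: "complex \<Rightarrow> complex \<Rightarrow> complex" where
  "theta z \<tau> = qpoch (qpar z) (qpar \<tau>) * qpoch (qpar (\<tau> - z)) (qpar \<tau>)"

text \<open>The modulus of the Siegel function. With \<open>y = Im z / Im \<tau>\<close>, the Bernoulli polynomial
  \<open>y\<^sup>2 - y + 1 / 6\<close> in the exponent makes it invariant under both periods \<open>1\<close> and \<open>\<tau>\<close>.\<close>

definition theta_norm :: "complex \<Rightarrow> complex \<Rightarrow> real" where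
  "theta_norm z \<tau> = exp (- pi * ((Im z / Im \<tau>)\<^sup>2 - Im z / Im \<tau> + 1 / 6) * Im \<tau>) * norm (theta z \<tau>)"

lemma theta_plus_1: "theta (z + 1) \<tau> = theta z \<tau>"
  by (simp add: theta_def qpar_add qpar_diff)

lemma holomorphic_qpoch_compose:
  assumes "norm q < 1" "f holomorphic_on A"
  shows "(\<lambda>z. qpoch (f z) q) holomorphic_on A"
  using holomorphic_on_compose_gen[OF assms(2) qpoch_holomorphic[OF assms(1)]] by (simp add: o_def)

context
  fixes \<tau> :: complex
  assumes \<tau>: "Im \<tau> > 0"
begin

lemma norm_nome: "norm (qpar \<tau>) < 1"
  by (rule norm_qpar_less_1[OF \<tau>])

lemma theta_plus_tau: "theta (z + \<tau>) \<tau> = - qpar (- z) * theta z \<tau>"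
proof -
  have 1: "qpoch (qpar z) (qpar \<tau>) = (1 - qpar z) * qpoch (qpar (z + \<tau>)) (qpar \<tau>)"
    by (subst qpoch_shift[OF norm_nome]) (simp add: qpar_add mult.commute)
  have 2: "qpoch (qpar (- z)) (qpar \<tau>) = (1 - qpar (- z)) * qpoch (qpar (\<tau> - z)) (qpar \<tau>)"
    by (subst qpoch_shift[OF norm_nome]) (simp add: qpar_diff qpar_minus)
  have "theta (z + \<tau>) \<tau> = qpoch (qpar (z + \<tau>)) (qpar \<tau>) * qpoch (qpar (- z)) (qpar \<tau>)"
    by (simp add: theta_def)
  moreover have "1 - qpar (- z) = - qpar (- z) * (1 - qpar z)"
    by (simp add: qpar_minus field_simps)
  ultimately show ?thesis
    unfolding 2 by (simp add: theta_def 1)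
qed

lemma theta_holomorphic:
  assumes "f holomorphic_on A"
  shows "(\<lambda>z. theta (f z) \<tau>) holomorphic_on A"
  unfolding theta_def
  by (intro holomorphic_intros holomorphic_qpoch_compose norm_nome assms)

text \<open>The factor \<open>1 - qpar z\<close> carries the zero at the origin, and the cofactor has no zero in the strip
  \<open>|Im z| < Im \<tau>\<close>.\<close>

lemma theta_factor:
  "theta z \<tau> = (1 - qpar z) * (qpoch (qpar (z + \<tau>)) (qpar \<tau>) * qpoch (qpar (\<tau> - z)) (qpar \<tau>))"
  unfolding theta_def by (subst qpoch_shift[OF norm_nome]) (simp add: qpar_add mult_ac)

lemma theta_cofactor_nonzero:
  assumes "\<bar>Im z\<bar> < Im \<tau>"
  shows "qpoch (qpar (z + \<tau>)) (qpar \<tau>) * qpoch (qpar (\<tau> - z)) (qpar \<tau>) \<noteq> 0"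
  unfolding mult_eq_0_iff de_Morgan_disj using assms
  by (intro conjI qpoch_nonzero norm_nome) (auto simp: norm_qpar)

lemma theta_duplication:
  "theta (2 * z) \<tau> = theta z \<tau> * theta (z + 1 / 2) \<tau> * theta (z + \<tau> / 2) \<tau> * theta (z + 1 / 2 + \<tau> / 2) \<tau>"
proof -
  define p where "p = qpar (\<tau> / 2)"
  have p: "norm p < 1" unfolding p_def using \<tau> by (intro norm_qpar_less_1) simp
  have p0: "p \<noteq> 0" by (simp add: p_def)
  have q: "qpar \<tau> = p\<^sup>2" unfolding p_def qpar_power by simp
  have dup: "qpoch (v\<^sup>2) (p\<^sup>2) = (qpoch v (p\<^sup>2) * qpoch (v * p) (p\<^sup>2)) * (qpoch (- v) (p\<^sup>2) * qpoch (- (v * p)) (p\<^sup>2))" for v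
    unfolding qpoch_square[OF p] qpoch_even_odd[OF p, of v] qpoch_even_odd[OF p, of "- v"] by simp
  define w where "w = qpar z"
  have w0: "w \<noteq> 0" by (simp add: w_def)
  have 1: "qpar (2 * z) = w\<^sup>2" unfolding w_def qpar_power by simp
  have 2: "qpar (\<tau> - 2 * z) = (p / w)\<^sup>2" unfolding qpar_diff 1 q by (simp add: power_divide)
  have 3: "qpar (z + 1 / 2) = - w" "qpar (z + \<tau> / 2) = w * p" "qpar (z + 1 / 2 + \<tau> / 2) = - (w * p)"
    by (simp_all add: qpar_add qpar_half w_def p_def)
  have 4: "qpar (\<tau> - z) = p / w * p" "qpar (\<tau> - (z + 1 / 2)) = - (p / w * p)"
    "qpar (\<tau> - (z + \<tau> / 2)) = p / w" "qpar (\<tau> - (z + 1 / 2 + \<tau> / 2)) = - (p / w)"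
    unfolding qpar_diff[of \<tau>] 3 q w_def[symmetric] using w0 p0 by (simp_all add: power2_eq_square)
  show ?thesis
    unfolding theta_def 1 2 3 4 q w_def[symmetric] dup[of w] dup[of "p / w"] by (simp only: mult_ac)
qed

lemma theta_norm_plus_1: "theta_norm (z + 1) \<tau> = theta_norm z \<tau>"
  by (simp add: theta_norm_def theta_plus_1)

lemma theta_norm_plus_tau: "theta_norm (z + \<tau>) \<tau> = theta_norm z \<tau>"
proof -
  define y where "y = Im z / Im \<tau>"
  have y1: "Im (z + \<tau>) / Im \<tau> = y + 1" using \<tau> by (simp add: y_def field_simps)
  have y: "Im z = y * Im \<tau>" using \<tau> by (simp add: y_def)
  have "theta_norm (z + \<tau>) \<tau> =
      exp (- pi * ((y + 1)\<^sup>2 - (y + 1) + 1 / 6) * Im \<tau>) * (exp (2 * pi * y * Im \<tau>) * norm (theta z \<tau>))"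
    unfolding theta_norm_def y1 theta_plus_tau by (simp add: norm_mult norm_qpar y)
  also have "\<dots> = exp (- pi * (y\<^sup>2 - y + 1 / 6) * Im \<tau>) * norm (theta z \<tau>)"
    unfolding mult.assoc[symmetric] exp_add[symmetric] by (simp add: algebra_simps power2_eq_square)
  finally show ?thesis by (simp add: theta_norm_def y_def)
qed

text \<open>No constant appears: the exponents satisfy the multiplication formula
  \<open>B(2 y) = 2 B(y) + 2 B(y + 1 / 2)\<close> of the Bernoulli polynomial \<open>B(y) = y\<^sup>2 - y + 1 / 6\<close>.\<close>

lemma theta_norm_duplication:
  "theta_norm (2 * z) \<tau> = theta_norm z \<tau> * theta_norm (z + 1 / 2) \<tau> * theta_norm (z + \<tau> / 2) \<tau>
      * theta_norm (z + 1 / 2 + \<tau> / 2) \<tau>"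
proof -
  define y where "y = Im z / Im \<tau>"
  have y: "Im (2 * z) / Im \<tau> = 2 * y" "Im z / Im \<tau> = y" "Im (z + 1 / 2) / Im \<tau> = y"
    "Im (z + \<tau> / 2) / Im \<tau> = y + 1 / 2" "Im (z + 1 / 2 + \<tau> / 2) / Im \<tau> = y + 1 / 2"
    using \<tau> by (auto simp: y_def field_simps)
  define E where "E = (\<lambda>u. exp (- pi * (u\<^sup>2 - u + 1 / 6) * Im \<tau>))"
  have E: "E (2 * y) = E y * E y * E (y + 1 / 2) * E (y + 1 / 2)"
    unfolding E_def exp_add[symmetric] by (simp add: algebra_simps power2_eq_square)
  have norm_E: "theta_norm u \<tau> = E (Im u / Im \<tau>) * norm (theta u \<tau>)" for u
    by (simp add: theta_norm_def E_def)
  show ?thesis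
    unfolding norm_E y theta_duplication norm_mult E by (simp only: mult_ac)
qed

end

lemma periodic_of_int:
  fixes f :: "complex \<Rightarrow> 'a"
  assumes "\<And>z. f (z + p) = f z"
  shows "f (z + of_int n * p) = f z"
proof (induction n rule: int_induct[where k = 0])
  case (step1 i)
  have "f (z + of_int (i + 1) * p) = f ((z + of_int i * p) + p)" by (simp add: algebra_simps)
  then show ?case using assms step1 by simp
next
  case (step2 i)
  have "f (z + of_int i * p) = f ((z + of_int (i - 1) * p) + p)" by (simp add: algebra_simps)
  then show ?case using assms step2 by simp
qed simp

text \<open>Liouville's theorem, in the form that the quotient of two entire functions is constant once
  it is bounded.\<close>

lemma entire_dominated_imp_multiple:
  fixes f g :: "complex \<Rightarrow> complex"
  assumes f: "f holomorphic_on UNIV" and g: "g holomorphic_on UNIV"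
    and M: "\<And>z. norm (f z) \<le> M * norm (g z)"
  obtains C where "\<And>z. f z = C * g z"
proof -
  define M' where "M' = max M 0"
  define h0 where "h0 = (\<lambda>z. f z / g z)"
  define h where "h = remove_sings h0"
  \<comment> \<open>Division by zero yields \<open>0\<close>, so the bound also holds at the zeros of \<open>g\<close>.\<close>
  have h0_le: "norm (h0 z) \<le> M'" for z
  proof (cases "g z = 0")
    case False
    then have "norm (h0 z) \<le> M" using M[of z] by (simp add: h0_def norm_divide field_simps)
    then show ?thesis by (simp add: M'_def)
  qed (simp add: h0_def M'_def)
  have mero: "h0 meromorphic_on UNIV"
    unfolding h0_def using f g
    by (intro meromorphic_intros analytic_on_imp_meromorphic_on) (auto simp: analytic_on_open)
  have lim: "h0 \<midarrow>z\<rightarrow> h z" and ana: "h analytic_on {z}" for z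
  proof -
    have iso: "isolated_singularity_at h0 z" and ne: "not_essential h0 z"
      using mero meromorphic_on_isolated_singularity meromorphic_on_not_essential
        meromorphic_on_subset by blast+
    have "\<not> is_pole h0 z"
    proof
      assume "is_pole h0 z"
      then have "eventually (\<lambda>z. norm (h0 z) \<ge> M' + 1) (at z)"
        unfolding is_pole_def filterlim_at_infinity_conv_norm_at_top filterlim_at_top by blast
      then have "eventually (\<lambda>_. False) (at z)"
      proof eventually_elim
        case (elim w)
        then show ?case using h0_le[of w] by simp
      qed
      then show False by simp
    qed
    then obtain c where c: "h0 \<midarrow>z\<rightarrow> c" using ne unfolding not_essential_def by blast
    then show "h0 \<midarrow>z\<rightarrow> h z" unfolding h_def using remove_sings_eqI by metis
    show "h analytic_on {z}" unfolding h_def by (rule remove_sings_analytic_at[OF iso c])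
  qed
  have "h holomorphic_on UNIV"
    using ana analytic_imp_holomorphic analytic_on_analytic_at by blast
  moreover have "norm (h z) \<le> M'" for z
    by (rule Lim_norm_ubound[OF _ lim]) (auto intro: always_eventually h0_le)
  then have "bounded (range h)" unfolding bounded_iff by blast
  ultimately obtain C where C: "h z = C" for z
    using Liouville_theorem[of h] unfolding constant_on_def by blast
  show ?thesis
  proof (rule that)
    fix z
    show "f z = C * g z"
    proof (cases "g z = 0")
      case True
      then show ?thesis using M[of z] by simp
    next
      case False
      have "h0 analytic_on {z}"
        unfolding h0_def using f g False
        by (intro analytic_intros) (auto intro: holomorphic_on_imp_analytic_at)
      then have "h z = h0 z" unfolding h_def by (rule remove_sings_at_analytic)
      then show ?thesis using C False by (simp add: h0_def)
    qed
  qed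
qed

text \<open>The Gaussian factor that gives \<open>theta z \<tau>\<close> the quasi-periods of \<open>theta (z / \<tau>) (- 1 / \<tau>)\<close>. Its modulus
  is the quotient of the two exponential factors in \<open>theta_norm\<close>.\<close>

definition theta_modulus_factor :: "complex \<Rightarrow> complex \<Rightarrow> complex" where
  "theta_modulus_factor z \<tau> =
     exp (of_real pi * \<i> * (z\<^sup>2 / \<tau> - z + z / \<tau> + \<tau> / 6 + 1 / (6 * \<tau>)))"

context
  fixes \<tau> \<tau>' :: complex
  assumes \<tau>: "Im \<tau> > 0" and \<tau>': "\<tau>' = - 1 / \<tau>"
begin

lemma tau_nonzero: "\<tau> \<noteq> 0"
  using \<tau> by auto

lemma Im_tau': "Im \<tau>' = Im \<tau> / (cmod \<tau>)\<^sup>2"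
  by (simp add: \<tau>' Im_divide cmod_def)

lemma Im_tau'_pos: "Im \<tau>' > 0"
  unfolding Im_tau' using \<tau> tau_nonzero by simp

lemma over_tau: "(of_real x + of_real y * \<tau>) / \<tau> = of_real y - of_real x * \<tau>'"
  using tau_nonzero by (simp add: \<tau>' field_simps)

lemma lattice_coordinates:
  obtains x y :: real where "z = of_real x + of_real y * \<tau>"
proof -
  define y where "y = Im z / Im \<tau>"
  define x where "x = Re z - y * Re \<tau>"
  have "z = of_real x + of_real y * \<tau>" using \<tau> by (simp add: complex_eq_iff x_def y_def)
  then show ?thesis by (rule that)
qed

text \<open>Both entire functions differ from their invariant norms by the same factor \<open>W\<close>, so a bound on the
  quotient of one pair is a bound on the quotient of the other. The norms are doubly periodic, the
  entire functions are not.\<close>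

lemma theta_norm_transform_scale:
  obtains W :: real where "W > 0" "norm (theta_modulus_factor z \<tau> * theta z \<tau>) = W * theta_norm z \<tau>"
    "norm (theta (z / \<tau>) \<tau>') = W * theta_norm (z / \<tau>) \<tau>'"
proof -
  obtain x y :: real where z: "z = of_real x + of_real y * \<tau>" by (rule lattice_coordinates)
  have y: "Im z / Im \<tau> = y" using \<tau> by (simp add: z)
  have zt: "z / \<tau> = of_real y - of_real x * \<tau>'" unfolding z by (rule over_tau)
  have x: "Im (z / \<tau>) / Im \<tau>' = - x" unfolding zt using Im_tau'_pos by simp
  define W where "W = exp (pi * (x\<^sup>2 + x + 1 / 6) * Im \<tau>')"
  have inv: "1 / \<tau> = - \<tau>'" by (simp add: \<tau>')
  have "z\<^sup>2 / \<tau> = z * (z / \<tau>)" by (simp add: power2_eq_square)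
  also have "\<dots> = of_real y * z - of_real x * z * \<tau>'" unfolding zt by (simp add: algebra_simps)
  also have "z * \<tau>' = - (z / \<tau>)" by (simp add: \<tau>')
  then have "of_real x * z * \<tau>' = - of_real x * (z / \<tau>)" by (simp add: mult.assoc)
  finally have z2: "z\<^sup>2 / \<tau> = of_real y * z + of_real x * (of_real y - of_real x * \<tau>')"
    by (simp add: zt)
  have "Im (z\<^sup>2 / \<tau> - z + z / \<tau> + \<tau> / 6 + 1 / (6 * \<tau>)) =
      (y\<^sup>2 - y + 1 / 6) * Im \<tau> - (x\<^sup>2 + x + 1 / 6) * Im \<tau>'"
  proof -
    have "1 / (6 * \<tau>) = 1 / \<tau> / 6" by simp
    then have "1 / (6 * \<tau>) = - \<tau>' / 6" by (simp only: inv)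
    then show ?thesis
      unfolding z2 unfolding zt by (simp add: z algebra_simps power2_eq_square)
  qed
  then have "norm (theta_modulus_factor z \<tau>) = exp (- pi * ((y\<^sup>2 - y + 1 / 6) * Im \<tau> - (x\<^sup>2 + x + 1 / 6) * Im \<tau>'))"
    unfolding theta_modulus_factor_def norm_exp_eq_Re by (simp add: mult.assoc) (simp add: algebra_simps)
  also have "\<dots> = W * exp (- pi * (y\<^sup>2 - y + 1 / 6) * Im \<tau>)"
    unfolding W_def exp_add[symmetric] by (simp add: algebra_simps)
  finally have 1: "norm (theta_modulus_factor z \<tau> * theta z \<tau>) = W * theta_norm z \<tau>"
    unfolding theta_norm_def y by (simp add: norm_mult)
  have "W * exp (- pi * ((- x)\<^sup>2 - - x + 1 / 6) * Im \<tau>') = 1"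
    unfolding W_def exp_add[symmetric] by (simp add: algebra_simps)
  then have 2: "norm (theta (z / \<tau>) \<tau>') = W * theta_norm (z / \<tau>) \<tau>'"
    unfolding theta_norm_def x mult.assoc[symmetric] by simp
  show ?thesis by (rule that[OF _ 1 2]) (simp add: W_def)
qed

lemma theta_norm_transformed_periodic:
  "theta_norm ((z + of_int m + of_int n * \<tau>) / \<tau>) \<tau>' = theta_norm (z / \<tau>) \<tau>'"
proof -
  have "(z + of_int m + of_int n * \<tau>) / \<tau> = (z / \<tau> + of_int n * 1) + of_int (- m) * \<tau>'"
    using tau_nonzero by (simp add: \<tau>' field_simps)
  also have "theta_norm \<dots> \<tau>' = theta_norm (z / \<tau> + of_int n * 1) \<tau>'"
    by (rule periodic_of_int) (rule theta_norm_plus_tau[OF Im_tau'_pos])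
  also have "\<dots> = theta_norm (z / \<tau>) \<tau>'"
    by (rule periodic_of_int) (rule theta_norm_plus_1[OF Im_tau'_pos])
  finally show ?thesis .
qed

lemma theta_norm_periodic: "theta_norm (z + of_int m + of_int n * \<tau>) \<tau> = theta_norm z \<tau>"
proof -
  have "theta_norm (z + of_int m + of_int n * \<tau>) \<tau> = theta_norm (z + of_int m * 1) \<tau>"
    unfolding mult_1_right by (rule periodic_of_int) (rule theta_norm_plus_tau[OF \<tau>])
  also have "\<dots> = theta_norm z \<tau>"
    by (rule periodic_of_int) (rule theta_norm_plus_1[OF \<tau>])
  finally show ?thesis .
qed

text \<open>The removable singularity at \<open>0\<close> is filled in, so that the common zero of both sides of the theta
  transformation can be divided out.\<close>

lemma one_minus_qpar_quotient_continuous: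
  "continuous_on UNIV (\<lambda>z. if z = 0 then - (2 * of_real pi * \<i> * k) else (1 - qpar (k * z)) / z)"
proof -
  let ?d = "\<lambda>z. if z = 0 then - (2 * of_real pi * \<i> * k) else (1 - qpar (k * z)) / z"
  have "((\<lambda>z. 1 - qpar (k * z)) has_field_derivative - (2 * of_real pi * \<i> * k)) (at 0)"
    unfolding qpar_def by (auto intro!: derivative_eq_intros)
  then have "(\<lambda>z. (1 - qpar (k * z)) / z) \<midarrow>0\<rightarrow> - (2 * of_real pi * \<i> * k)"
    unfolding DERIV_def by simp
  moreover have "?d \<midarrow>0\<rightarrow> c \<longleftrightarrow> (\<lambda>z. (1 - qpar (k * z)) / z) \<midarrow>0\<rightarrow> c" for c
    by (rule LIM_equal) simp
  ultimately have 0: "isCont ?d 0" by (simp add: isCont_def)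
  have "isCont ?d z" if "z \<noteq> 0" for z
  proof -
    have "continuous_on (- {0}) (\<lambda>z. (1 - qpar (k * z)) / z)" by (auto intro!: continuous_intros)
    then have "continuous_on (- {0}) ?d" by (rule continuous_on_eq) auto
    then show ?thesis using that by (simp add: continuous_on_eq_continuous_at open_Compl)
  qed
  with 0 show ?thesis
    by (intro continuous_at_imp_continuous_on ballI) (metis (no_types, lifting))
qed

text \<open>On a fundamental parallelogram both theta functions vanish only at \<open>0\<close>, to first order, so
  their quotient is bounded there; by double periodicity of the two norms it is bounded
  everywhere.\<close>

lemma theta_transform_bounded:
  obtains M where
    "\<And>z. norm (theta_modulus_factor z \<tau> * theta z \<tau>) \<le> M * norm (theta (z / \<tau>) \<tau>')"
proof -
  define d where "d = (\<lambda>k z. if z = 0 then - (2 * of_real pi * \<i> * k) else (1 - qpar (k * z)) / z)"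
  have d_cont: "continuous_on A (d k)" for A k
    unfolding d_def using one_minus_qpar_quotient_continuous continuous_on_subset by blast
  have d: "1 - qpar (k * z) = z * d k z" for k z
    by (simp add: d_def)
  define co where "co = (\<lambda>z t. qpoch (qpar (z + t)) (qpar t) * qpoch (qpar (t - z)) (qpar t))"
  \<comment> \<open>Both sides are written as \<open>z\<close> times a continuous function, where \<open>\<psi>\<close> does not vanish on the closed
    parallelogram \<open>K\<close> centred at \<open>0\<close>.\<close>
  define \<phi> where "\<phi> = (\<lambda>z. theta_modulus_factor z \<tau> * (d 1 z * co z \<tau>))"
  define \<psi> where "\<psi> = (\<lambda>z. d (1 / \<tau>) z * co (z / \<tau>) \<tau>')"
  define K where "K = (\<lambda>(x, y). of_real x + of_real y * \<tau>) ` ({-1/2..1/2::real} \<times> {-1/2..1/2::real})"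
  have K_compact: "compact K"
    unfolding K_def
    by (intro compact_continuous_image compact_Times)
       (auto intro!: continuous_intros simp: case_prod_unfold)
  have f: "theta_modulus_factor z \<tau> * theta z \<tau> = z * \<phi> z" for z
    unfolding theta_factor[OF \<tau>] \<phi>_def co_def using d[of 1 z] by simp
  have g: "theta (z / \<tau>) \<tau>' = z * \<psi> z" for z
    unfolding theta_factor[OF Im_tau'_pos] \<psi>_def co_def using d[of "1 / \<tau>" z] by simp
  have co_cont: "continuous_on A (\<lambda>z. co (h z) t)" if "Im t > 0" "h holomorphic_on A" for A t h
    unfolding co_def
    by (intro holomorphic_on_imp_continuous_on holomorphic_intros holomorphic_qpoch_compose
        norm_qpar_less_1 that)
  have \<phi>_cont: "continuous_on K \<phi>"
    unfolding \<phi>_def theta_modulus_factor_def using tau_nonzero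
    by (intro continuous_intros d_cont co_cont \<tau>) auto
  have \<psi>_cont: "continuous_on K \<psi>"
    unfolding \<psi>_def using tau_nonzero
    by (intro continuous_intros d_cont co_cont Im_tau'_pos) (auto intro!: holomorphic_intros)
  have \<psi>_nz: "\<psi> z \<noteq> 0" if "z \<in> K" for z
  proof -
    obtain x y :: real where xy: "\<bar>x\<bar> \<le> 1/2" "\<bar>y\<bar> \<le> 1/2" "z = of_real x + of_real y * \<tau>"
    proof -
      obtain x y :: real where "x \<in> {-1/2..1/2}" "y \<in> {-1/2..1/2}" "z = of_real x + of_real y * \<tau>"
        using \<open>z \<in> K\<close> unfolding K_def by auto
      then show ?thesis by (intro that[of x y]) (auto simp: abs_le_iff)
    qed
    have zt: "z / \<tau> = of_real y - of_real x * \<tau>'" unfolding xy by (rule over_tau)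
    have "\<bar>x * Im \<tau>'\<bar> \<le> 1 / 2 * Im \<tau>'"
      unfolding abs_mult using Im_tau'_pos xy by (intro mult_mono) auto
    then have "\<bar>Im (z / \<tau>)\<bar> < Im \<tau>'"
      unfolding zt using Im_tau'_pos by simp
    from theta_cofactor_nonzero[OF Im_tau'_pos this] have 1: "co (z / \<tau>) \<tau>' \<noteq> 0"
      by (simp add: co_def)
    have 2: "d (1 / \<tau>) z \<noteq> 0"
    proof (cases "z = 0")
      case True
      then show ?thesis using tau_nonzero by (simp add: d_def)
    next
      case False
      have "z / \<tau> \<notin> \<int>"
      proof
        assume "z / \<tau> \<in> \<int>"
        then obtain n :: int where n: "z / \<tau> = of_int n" by (auto elim: Ints_cases)
        then have "Im (z / \<tau>) = 0" by simp
        then have "x = 0" unfolding zt using Im_tau'_pos by simp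
        then have "of_real y = complex_of_real (of_int n)" using n zt by simp
        then have "y = of_int n" unfolding of_real_eq_iff .
        then have "n = 0" using xy(2) by auto
        with n False tau_nonzero show False by simp
      qed
      then show ?thesis using False qpar_eq_1_iff[of "z / \<tau>"] by (simp add: d_def)
    qed
    show ?thesis using 1 2 by (simp add: \<psi>_def)
  qed
  have "compact ((\<lambda>z. \<phi> z / \<psi> z) ` K)"
    using \<psi>_nz by (intro compact_continuous_image continuous_intros \<phi>_cont \<psi>_cont K_compact) auto
  then have "bounded ((\<lambda>z. \<phi> z / \<psi> z) ` K)" by (rule compact_imp_bounded)
  then obtain M where "\<forall>u\<in>(\<lambda>z. \<phi> z / \<psi> z) ` K. norm u \<le> M"
    unfolding bounded_iff by (rule exE)
  then have M: "norm (\<phi> z / \<psi> z) \<le> M" if "z \<in> K" for z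
    using that by (simp only: ball_simps)
  have on_K: "norm (theta_modulus_factor z \<tau> * theta z \<tau>) \<le> M * norm (theta (z / \<tau>) \<tau>')" if "z \<in> K" for z
  proof -
    have "norm (\<phi> z) \<le> M * norm (\<psi> z)"
      using M[OF that] \<psi>_nz[OF that] by (simp add: norm_divide field_simps)
    then have "norm z * norm (\<phi> z) \<le> norm z * (M * norm (\<psi> z))" by (rule mult_left_mono) simp
    then show ?thesis unfolding f g norm_mult by (simp only: mult_ac)
  qed
  have norms: "theta_norm z \<tau> \<le> M * theta_norm (z / \<tau>) \<tau>'" if "z \<in> K" for z
  proof -
    obtain W where W: "W > 0" "norm (theta_modulus_factor z \<tau> * theta z \<tau>) = W * theta_norm z \<tau>"
      "norm (theta (z / \<tau>) \<tau>') = W * theta_norm (z / \<tau>) \<tau>'"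
      by (rule theta_norm_transform_scale)
    then show ?thesis using on_K[OF that] by (simp add: mult.left_commute)
  qed
  show ?thesis
  proof (rule that)
    fix z
    obtain x y :: real where z: "z = of_real x + of_real y * \<tau>" by (rule lattice_coordinates)
    define z0 where "z0 = of_real (x - of_int (round x)) + of_real (y - of_int (round y)) * \<tau>"
    have "\<bar>x - of_int (round x)\<bar> \<le> 1 / 2" "\<bar>y - of_int (round y)\<bar> \<le> 1 / 2"
      using of_int_round_abs_le[of x] of_int_round_abs_le[of y] by (simp_all add: abs_minus_commute)
    then have "(x - of_int (round x), y - of_int (round y)) \<in> {-1/2..1/2} \<times> {-1/2..1/2}"
      unfolding mem_Times_iff atLeastAtMost_iff fst_conv snd_conv by linarith
    then have "z0 \<in> K" unfolding K_def by (rule rev_image_eqI) (simp add: z0_def)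
    have zz: "z = z0 + of_int (round x) + of_int (round y) * \<tau>"
      by (simp add: z z0_def algebra_simps)
    have "theta_norm z \<tau> \<le> M * theta_norm (z / \<tau>) \<tau>'"
      unfolding zz theta_norm_periodic theta_norm_transformed_periodic by (rule norms[OF \<open>z0 \<in> K\<close>])
    moreover obtain W where W: "W > 0" "norm (theta_modulus_factor z \<tau> * theta z \<tau>) = W * theta_norm z \<tau>"
      "norm (theta (z / \<tau>) \<tau>') = W * theta_norm (z / \<tau>) \<tau>'"
      by (rule theta_norm_transform_scale)
    ultimately show "norm (theta_modulus_factor z \<tau> * theta z \<tau>) \<le> M * norm (theta (z / \<tau>) \<tau>')"
      by (simp add: mult.left_commute)
  qed
qed

lemma theta_transform_up_to_constant:
  obtains C where "\<And>z. theta_modulus_factor z \<tau> * theta z \<tau> = C * theta (z / \<tau>) \<tau>'"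
proof -
  obtain M where M: "\<And>z. norm (theta_modulus_factor z \<tau> * theta z \<tau>) \<le> M * norm (theta (z / \<tau>) \<tau>')"
    by (rule theta_transform_bounded) blast
  show ?thesis
  proof (rule entire_dominated_imp_multiple[OF _ _ M])
    show "(\<lambda>z. theta_modulus_factor z \<tau> * theta z \<tau>) holomorphic_on UNIV"
      unfolding theta_modulus_factor_def using tau_nonzero
      by (intro holomorphic_intros theta_holomorphic \<tau>) auto
    show "(\<lambda>z. theta (z / \<tau>) \<tau>') holomorphic_on UNIV"
      using tau_nonzero by (intro holomorphic_intros theta_holomorphic Im_tau'_pos) auto
  qed (use that in blast)
qed

text \<open>The modulus of the constant is \<open>1\<close>: both norms satisfy the same duplication formula, which
  multiplies four values of the function, so the modulus \<open>R\<close> satisfies \<open>R = R\<^sup>4\<close>.\<close>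

theorem theta_norm_transform: "theta_norm z \<tau> = theta_norm (z / \<tau>) \<tau>'"
proof -
  obtain C where C: "\<And>z. theta_modulus_factor z \<tau> * theta z \<tau> = C * theta (z / \<tau>) \<tau>'"
    by (rule theta_transform_up_to_constant) blast
  define R where "R = norm C"
  have R: "theta_norm z \<tau> = R * theta_norm (z / \<tau>) \<tau>'" for z
  proof -
    obtain W where W: "W > 0" "norm (theta_modulus_factor z \<tau> * theta z \<tau>) = W * theta_norm z \<tau>"
      "norm (theta (z / \<tau>) \<tau>') = W * theta_norm (z / \<tau>) \<tau>'"
      by (rule theta_norm_transform_scale)
    have "W * theta_norm z \<tau> = W * (R * theta_norm (z / \<tau>) \<tau>')"
      unfolding W(2)[symmetric] C norm_mult W(3) R_def by simp
    then show ?thesis using W(1) by simp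
  qed
  \<comment> \<open>As \<open>2 z1 = \<tau> / 2\<close> is not a lattice point, the theta functions do not vanish there.\<close>
  define z1 where "z1 = \<tau> / 4"
  have nz: "theta_norm (2 * z1) \<tau> \<noteq> 0"
  proof -
    have "Im (2 * z1) = Im \<tau> / 2" by (simp add: z1_def)
    moreover have "Im u = 0" if "u \<in> \<int>" for u using that by (auto elim!: Ints_cases)
    ultimately have "2 * z1 \<notin> \<int>" using \<tau> by force
    then have "1 - qpar (2 * z1) \<noteq> 0" using qpar_eq_1_iff by auto
    moreover have "\<bar>Im (2 * z1)\<bar> < Im \<tau>" using \<tau> by (simp add: z1_def)
    ultimately show ?thesis
      using theta_cofactor_nonzero[OF \<tau>, of "2 * z1"]
      by (simp add: theta_norm_def theta_factor[OF \<tau>])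
  qed
  let ?N = "\<lambda>z. theta_norm (z / \<tau>) \<tau>'"
  have dup: "?N (2 * z1) = ?N z1 * ?N (z1 + 1 / 2) * ?N (z1 + \<tau> / 2) * ?N (z1 + 1 / 2 + \<tau> / 2)"
  proof -
    have 0: "2 * z1 / \<tau> = 2 * (z1 / \<tau>)" by simp
    have "(z1 + \<tau> / 2) / \<tau> = z1 / \<tau> + 1 / 2" using tau_nonzero by (simp add: field_simps)
    \<comment> \<open>Division by \<open>\<tau>\<close> turns the half period \<open>1 / 2\<close> into \<open>- \<tau>' / 2\<close>, which agrees with \<open>\<tau>' / 2\<close>
      modulo the period \<open>\<tau>'\<close>.\<close>
    moreover have "?N (z1 + 1 / 2) = theta_norm (z1 / \<tau> + \<tau>' / 2) \<tau>'"
    proof -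
      have "(z1 + 1 / 2) / \<tau> + \<tau>' = z1 / \<tau> + \<tau>' / 2"
        using tau_nonzero by (simp add: \<tau>' field_simps)
      then show ?thesis using theta_norm_plus_tau[OF Im_tau'_pos, of "(z1 + 1 / 2) / \<tau>"] by simp
    qed
    moreover have "?N (z1 + 1 / 2 + \<tau> / 2) = theta_norm (z1 / \<tau> + 1 / 2 + \<tau>' / 2) \<tau>'"
    proof -
      have "(z1 + 1 / 2 + \<tau> / 2) / \<tau> + \<tau>' = z1 / \<tau> + 1 / 2 + \<tau>' / 2"
        using tau_nonzero by (simp add: \<tau>' field_simps)
      then show ?thesis
        using theta_norm_plus_tau[OF Im_tau'_pos, of "(z1 + 1 / 2 + \<tau> / 2) / \<tau>"] by simp
    qed
    ultimately show ?thesis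
      unfolding 0 theta_norm_duplication[OF Im_tau'_pos, of "z1 / \<tau>"] by (simp only: mult_ac)
  qed
  have "R * ?N (2 * z1) = (R * ?N z1) * (R * ?N (z1 + 1 / 2)) * (R * ?N (z1 + \<tau> / 2)) * (R * ?N (z1 + 1 / 2 + \<tau> / 2))"
    unfolding R[symmetric] by (rule theta_norm_duplication[OF \<tau>])
  also have "\<dots> = R ^ 4 * ?N (2 * z1)"
    unfolding dup by (simp only: power4_eq_xxxx mult_ac)
  finally have R4: "R * ?N (2 * z1) = R ^ 4 * ?N (2 * z1)" .
  have nz': "R \<noteq> 0" "?N (2 * z1) \<noteq> 0" using nz R[of "2 * z1"] by simp_all
  have "R * 1 = R * R ^ 3" using R4 nz'(2) by (simp add: power4_eq_xxxx power3_eq_cube mult_ac)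
  then have "R ^ 3 = 1 ^ 3" using nz'(1) by (metis mult_left_cancel power_one)
  then have "R = 1" using power_eq_imp_eq_base[of R 3 1] by (simp add: R_def)
  then show ?thesis using R by simp
qed

end

subsection \<open>The logarithmic derivative of the theta function\<close>

text \<open>The logarithmic derivative in \<open>z\<close>, divided by \<open>2 \<pi> \<i>\<close>.\<close>

definition theta_logderiv :: "complex \<Rightarrow> complex \<Rightarrow> complex" where
  "theta_logderiv z \<tau> =
     (\<Sum>\<^sub>\<infinity>(m, n)\<in>{1..} \<times> UNIV. qpar (\<tau> - z) ^ m * qpar \<tau> ^ (n * m)) -
     (\<Sum>\<^sub>\<infinity>(m, n)\<in>{1..} \<times> UNIV. qpar z ^ m * qpar \<tau> ^ (n * m))"

lemma theta_nonzero:
  assumes "0 < Im z" "Im z < Im \<tau>"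
  shows "theta z \<tau> \<noteq> 0"
  unfolding theta_def mult_eq_0_iff de_Morgan_disj using assms
  by (intro conjI qpoch_nonzero norm_qpar_less_1) auto

lemma theta_has_field_derivative:
  assumes "0 < Im z" "Im z < Im \<tau>"
  shows "((\<lambda>z. theta z \<tau>) has_field_derivative
           2 * of_real pi * \<i> * theta_logderiv z \<tau> * theta z \<tau>) (at z)"
proof -
  let ?q = "qpar \<tau>"
  let ?S = "\<lambda>w. \<Sum>\<^sub>\<infinity>(m, n)\<in>{1..} \<times> UNIV. w ^ m * ?q ^ (n * m)"
  have q: "norm ?q < 1" "norm (qpar z) < 1" "norm (qpar (\<tau> - z)) < 1"
    using assms by (auto intro!: norm_qpar_less_1)
  have 1: "(qpar has_field_derivative 2 * of_real pi * \<i> * qpar z) (at z)"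
    and 2: "((\<lambda>z. qpar (\<tau> - z)) has_field_derivative - (2 * of_real pi * \<i> * qpar (\<tau> - z))) (at z)"
    unfolding qpar_def by (auto intro!: derivative_eq_intros)
  have d1: "((\<lambda>z. qpoch (qpar z) ?q) has_field_derivative
        - 2 * of_real pi * \<i> * ?S (qpar z) * qpoch (qpar z) ?q) (at z)"
    using DERIV_chain2[OF qpoch_has_field_derivative[OF q(1,2) qpar_nonzero] 1] by (simp add: mult_ac)
  have d2: "((\<lambda>z. qpoch (qpar (\<tau> - z)) ?q) has_field_derivative
        2 * of_real pi * \<i> * ?S (qpar (\<tau> - z)) * qpoch (qpar (\<tau> - z)) ?q) (at z)"
    using DERIV_chain2[OF qpoch_has_field_derivative[OF q(1,3) qpar_nonzero] 2] by (simp add: mult_ac)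
  show ?thesis
    using DERIV_mult[OF d1 d2] unfolding theta_def theta_logderiv_def by (simp add: algebra_simps)
qed

text \<open>The unknown constant of proportionality disappears under logarithmic differentiation.\<close>

theorem theta_logderiv_transform:
  assumes "0 < Im z" "Im z < Im \<tau>" "\<tau>' = - 1 / \<tau>" "0 < Im (z / \<tau>)" "Im (z / \<tau>) < Im \<tau>'"
  shows "z / \<tau> - 1 / 2 + 1 / (2 * \<tau>) + theta_logderiv z \<tau> = 1 / \<tau> * theta_logderiv (z / \<tau>) \<tau>'"
proof -
  have \<tau>: "Im \<tau> > 0" using assms by linarith
  have t0: "\<tau> \<noteq> 0" using \<tau> by auto
  obtain C where C: "\<And>z. theta_modulus_factor z \<tau> * theta z \<tau> = C * theta (z / \<tau>) \<tau>'"
    by (rule theta_transform_up_to_constant[OF \<tau> assms(3)]) blast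
  let ?E = "theta_modulus_factor z \<tau>" and ?p = "of_real pi * \<i> :: complex"
  have E: "((\<lambda>z. theta_modulus_factor z \<tau>) has_field_derivative
      ?p * (2 * z / \<tau> - 1 + 1 / \<tau>) * ?E) (at z)"
    unfolding theta_modulus_factor_def using t0 by (auto intro!: derivative_eq_intros)
  have L: "((\<lambda>z. theta_modulus_factor z \<tau> * theta z \<tau>) has_field_derivative
      (?p * (2 * z / \<tau> - 1 + 1 / \<tau>) + 2 * ?p * theta_logderiv z \<tau>) * (?E * theta z \<tau>)) (at z)"
    using DERIV_mult[OF E theta_has_field_derivative[OF assms(1,2)]] by (simp add: algebra_simps)
  have "((\<lambda>z. z / \<tau>) has_field_derivative 1 / \<tau>) (at z)"
    using t0 by (auto intro!: derivative_eq_intros)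
  from DERIV_cmult[OF DERIV_chain2[OF theta_has_field_derivative[OF assms(4,5)] this], of C]
  have R: "((\<lambda>z. C * theta (z / \<tau>) \<tau>') has_field_derivative
      2 * ?p * theta_logderiv (z / \<tau>) \<tau>' * (1 / \<tau>) * (C * theta (z / \<tau>) \<tau>')) (at z)"
    by (simp add: mult_ac)
  have "(?p * (2 * z / \<tau> - 1 + 1 / \<tau>) + 2 * ?p * theta_logderiv z \<tau>) * (?E * theta z \<tau>) =
      2 * ?p * theta_logderiv (z / \<tau>) \<tau>' * (1 / \<tau>) * (?E * theta z \<tau>)"
    using DERIV_unique[OF L[unfolded C] R] unfolding C .
  moreover have "?E * theta z \<tau> \<noteq> 0"
    using theta_nonzero[OF assms(1,2)] by (simp add: theta_modulus_factor_def)
  ultimately have "?p * (2 * z / \<tau> - 1 + 1 / \<tau>) + 2 * ?p * theta_logderiv z \<tau> =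
      2 * ?p * theta_logderiv (z / \<tau>) \<tau>' * (1 / \<tau>)"
    using mult_right_cancel by blast
  then have "2 * ?p * (z / \<tau> - 1 / 2 + 1 / (2 * \<tau>) + theta_logderiv z \<tau>) =
      2 * ?p * (1 / \<tau> * theta_logderiv (z / \<tau>) \<tau>')"
    by (simp add: algebra_simps)
  moreover have "2 * ?p \<noteq> 0" by simp
  ultimately show ?thesis using mult_left_cancel by blast
qed

subsection \<open>Division values\<close>

text \<open>The root of unity \<open>\<zeta>\<^sub>N^j\<close>.\<close>

definition root1 :: "nat \<Rightarrow> int \<Rightarrow> complex" where
  "root1 N j = qpar (of_int j / of_nat N)"

lemma norm_root1 [simp]: "norm (root1 N j) = 1"
  by (simp add: root1_def norm_qpar)

lemma norm_root1_power [simp]: "norm (root1 N j ^ m) = 1"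
  by (simp add: norm_power)

lemma root1_0 [simp]: "root1 N 0 = 1"
  by (simp add: root1_def)

lemma root1_power: "root1 N j ^ m = root1 N (j * int m)"
  by (simp add: root1_def qpar_power mult_ac)

text \<open>The coefficients, in powers of \<open>qpar s\<close>, of \<open>- log (theta z (N s))\<close> at the division point
  \<open>z = l s + j / N\<close>.\<close>

definition log_coeff :: "nat \<Rightarrow> int \<Rightarrow> int \<Rightarrow> nat \<Rightarrow> nat \<Rightarrow> complex" where
  "log_coeff N j l m n =
     root1 N j ^ m / of_nat m * residue_ind N l n + root1 N (- j) ^ m / of_nat m * residue_ind N (- l) n"

text \<open>The same for \<open>theta_logderiv\<close>, where differentiation in \<open>z\<close> has removed the denominator \<open>m\<close>.\<close>

definition logderiv_coeff :: "nat \<Rightarrow> int \<Rightarrow> int \<Rightarrow> nat \<Rightarrow> nat \<Rightarrow> complex" where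
  "logderiv_coeff N j l m n =
     root1 N (- j) ^ m * residue_ind N (- l) n - root1 N j ^ m * residue_ind N l n"

lemma poly_growth_root_residue: "poly_growth (\<lambda>m n. root1 N j ^ m * residue_ind N l n)"
  by (rule poly_growth_bounded[of _ 1]) (simp add: norm_mult norm_residue_ind_le)

lemma poly_growth_root_div_residue: "poly_growth (\<lambda>m n. root1 N j ^ m / of_nat m * residue_ind N l n)"
proof (rule poly_growth_bounded[of _ 1])
  fix m n :: nat assume "m \<ge> 1"
  then have "1 / real m * norm (residue_ind N l n :: complex) \<le> 1 * 1"
    by (intro mult_mono norm_residue_ind_le) auto
  then show "norm (root1 N j ^ m / of_nat m * residue_ind N l n) \<le> 1"
    by (simp add: norm_mult norm_divide)
qed

lemma poly_growth_log_coeff: "poly_growth (log_coeff N j l)"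
  unfolding log_coeff_def by (intro poly_growth_add poly_growth_root_div_residue)

lemma poly_growth_diff:
  "poly_growth c \<Longrightarrow> poly_growth d \<Longrightarrow> poly_growth (\<lambda>m n. c m n - d m n)"
  using poly_growth_add[of c "\<lambda>m n. - d m n"] poly_growth_uminus[of d] by simp

lemma poly_growth_logderiv_coeff: "poly_growth (logderiv_coeff N j l)"
  unfolding logderiv_coeff_def by (intro poly_growth_diff poly_growth_root_residue)

lemma division_point_qpar:
  fixes l N :: nat and j :: int and s :: complex
  assumes "l \<le> N"
  defines "z \<equiv> of_nat l * s + of_int j / of_nat N"
  shows "qpar z = root1 N j * qpar s ^ l"
    and "qpar (of_nat N * s - z) = root1 N (- j) * qpar s ^ (N - l)"
    and "qpar (of_nat N * s) = qpar s ^ N"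
proof -
  show "qpar z = root1 N j * qpar s ^ l"
    unfolding z_def qpar_add by (simp add: root1_def qpar_power)
  have "of_nat N * s - z = of_int (- j) / of_nat N + of_nat (N - l) * s"
    using assms by (simp add: z_def algebra_simps of_nat_diff)
  then show "qpar (of_nat N * s - z) = root1 N (- j) * qpar s ^ (N - l)"
    unfolding root1_def qpar_power qpar_add[symmetric] by simp
  show "qpar (of_nat N * s) = qpar s ^ N" by (simp add: qpar_power)
qed

lemma residue_ind_complement:
  assumes "l \<le> N"
  shows "residue_ind N (int (N - l)) = residue_ind N (- int l)"
  by (rule residue_ind_cong) (use assms in \<open>simp add: of_nat_diff cong_def\<close>)

lemma theta_division_point:
  fixes l N :: nat and j :: int
  assumes "1 \<le> l" "l < N" "Im s > 0"
  shows "theta (of_nat l * s + of_int j / of_nat N) (of_nat N * s) =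
         exp (- lambert (log_coeff N j (int l)) (qpar s))"
proof -
  note s = norm_qpar_less_1[OF assms(3)]
  have "theta (of_nat l * s + of_int j / of_nat N) (of_nat N * s) =
      exp (- lambert (\<lambda>m n. root1 N j ^ m / of_nat m * residue_ind N (int l) n) (qpar s)) *
      exp (- lambert (\<lambda>m n. root1 N (- j) ^ m / of_nat m * residue_ind N (int (N - l)) n) (qpar s))"
    unfolding theta_def division_point_qpar[OF less_imp_le[OF assms(2)]]
    by (intro arg_cong2[of _ _ _ _ "(*)"] qpoch_residue_exp s) (use assms in auto)
  also have "\<dots> = exp (- lambert (log_coeff N j (int l)) (qpar s))"
    unfolding log_coeff_def lambert_add[OF poly_growth_root_div_residue poly_growth_root_div_residue s]
      residue_ind_complement[OF less_imp_le[OF assms(2)]] exp_add[symmetric] by simp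
  finally show ?thesis .
qed

lemma theta_logderiv_division_point:
  fixes l N :: nat and j :: int
  assumes "1 \<le> l" "l < N" "Im s > 0"
  shows "theta_logderiv (of_nat l * s + of_int j / of_nat N) (of_nat N * s) =
         lambert (logderiv_coeff N j (int l)) (qpar s)"
proof -
  note s = norm_qpar_less_1[OF assms(3)]
  have 1: "(\<Sum>\<^sub>\<infinity>(m, n)\<in>{1..} \<times> UNIV. (root1 N j * qpar s ^ l) ^ m * (qpar s ^ N) ^ (n * m)) =
      lambert (\<lambda>m n. root1 N j ^ m * residue_ind N (int l) n) (qpar s)"
    if "1 \<le> l" "l \<le> N" for l j
    unfolding infsum_residue_reindex[OF that, symmetric] power_mult_distrib mult.assoc ..
  show ?thesis
    unfolding theta_logderiv_def division_point_qpar[OF less_imp_le[OF assms(2)]] logderiv_coeff_def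
      lambert_diff[OF poly_growth_root_residue poly_growth_root_residue s]
      1[OF assms(1) less_imp_le[OF assms(2)]] residue_ind_complement[OF less_imp_le[OF assms(2)], symmetric]
    by (subst 1) (use assms in auto)
qed

text \<open>Let \<open>z = l s - k / N\<close> and \<open>\<tau> = N s\<close>. Then \<open>z / \<tau> = k s' + l / N\<close> and \<open>- 1 / \<tau> = N s'\<close>, so inversion
  leads from division points to division points and exchanges the residue class, given by \<open>l\<close>, with
  the root of unity, given by \<open>k\<close>.\<close>

locale dual_points =
  fixes N :: nat and s s' :: complex and k l :: nat
  assumes s: "Im s > 0" and s': "s' = - 1 / (of_nat N ^ 2 * s)"
    and k: "1 \<le> k" "k < N" and l: "1 \<le> l" "l < N"
begin

definition "pt = of_nat l * s + of_int (- int k) / of_nat N"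

lemma N_pos: "N > 0" and s_nz: "s \<noteq> 0"
  using k s by auto

lemma Im_s': "Im s' = Im s / (N ^ 2 * (cmod s)\<^sup>2)"
proof -
  define c where "c = - 1 / real N ^ 2"
  have "s' = of_real c * (1 / s)" using N_pos by (simp add: s' c_def)
  also have "Im (of_real c * w) = c * Im w" for w by simp
  also have "Im (1 / s) = - Im s / (cmod s)\<^sup>2" by (simp add: Im_divide cmod_def)
  finally show ?thesis by (simp add: c_def)
qed

lemma Im_s'_pos: "Im s' > 0"
  unfolding Im_s' using s s_nz N_pos by simp

lemma dual_period: "of_nat N * s' = - 1 / (of_nat N * s)"
  using N_pos s_nz by (simp add: s' field_simps power2_eq_square)

lemma dual_pt: "pt / (of_nat N * s) = of_nat k * s' + of_int (int l) / of_nat N"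
  using N_pos s_nz by (simp add: pt_def s' field_simps power2_eq_square)

theorem log_transform:
  "pi * ((l / N)\<^sup>2 - l / N + 1 / 6) * (N * Im s) + Re (lambert (log_coeff N (- int k) (int l)) (qpar s)) =
   pi * ((k / N)\<^sup>2 - k / N + 1 / 6) * (N * Im s') + Re (lambert (log_coeff N (int l) (int k)) (qpar s'))"
proof -
  have "theta_norm pt (of_nat N * s) = theta_norm (pt / (of_nat N * s)) (of_nat N * s')"
    by (rule theta_norm_transform) (use s N_pos in \<open>auto simp: dual_period\<close>)
  moreover have "Im pt / Im (of_nat N * s) = l / N"
    using N_pos s by (simp add: pt_def)
  moreover have "Im (pt / (of_nat N * s)) / Im (of_nat N * s') = k / N"
    unfolding dual_pt using N_pos Im_s'_pos by simp
  moreover have "theta pt (of_nat N * s) = exp (- lambert (log_coeff N (- int k) (int l)) (qpar s))"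
    unfolding pt_def by (rule theta_division_point[OF l s])
  moreover have "theta (pt / (of_nat N * s)) (of_nat N * s') =
      exp (- lambert (log_coeff N (int l) (int k)) (qpar s'))"
    unfolding dual_pt by (rule theta_division_point[OF k Im_s'_pos])
  ultimately have "exp (- pi * ((l / N)\<^sup>2 - l / N + 1 / 6) * Im (of_nat N * s)
        + Re (- lambert (log_coeff N (- int k) (int l)) (qpar s))) =
      exp (- pi * ((k / N)\<^sup>2 - k / N + 1 / 6) * Im (of_nat N * s')
        + Re (- lambert (log_coeff N (int l) (int k)) (qpar s')))"
    unfolding theta_norm_def exp_add by (simp only: norm_exp_eq_Re)
  then show ?thesis by simp
qed

theorem logderiv_transform:
  "of_nat l / of_nat N - of_nat k / (of_nat N ^ 2 * s) - 1 / 2 + 1 / (2 * (of_nat N * s)) +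
     lambert (logderiv_coeff N (- int k) (int l)) (qpar s) =
   1 / (of_nat N * s) * lambert (logderiv_coeff N (int l) (int k)) (qpar s')"
proof -
  have "pt / (of_nat N * s) - 1 / 2 + 1 / (2 * (of_nat N * s)) + theta_logderiv pt (of_nat N * s) =
      1 / (of_nat N * s) * theta_logderiv (pt / (of_nat N * s)) (of_nat N * s')"
  proof (rule theta_logderiv_transform)
    show "0 < Im pt" "Im pt < Im (of_nat N * s)" using l s by (auto simp: pt_def)
    show "of_nat N * s' = - 1 / (of_nat N * s)" by (rule dual_period)
    show "0 < Im (pt / (of_nat N * s))" "Im (pt / (of_nat N * s)) < Im (of_nat N * s')"
      unfolding dual_pt using k Im_s'_pos by auto
  qed
  moreover have "pt / (of_nat N * s) = of_nat l / of_nat N - of_nat k / (of_nat N ^ 2 * s)"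
    using N_pos s_nz by (simp add: pt_def field_simps power2_eq_square)
  ultimately show ?thesis
    using theta_logderiv_division_point[OF l s, of "- int k"]
      theta_logderiv_division_point[OF k Im_s'_pos, of "int l"]
    unfolding dual_pt pt_def[symmetric] by (simp only: dual_pt[symmetric])
qed

end

section \<open>Modular units on the vertical line\<close>

definition ccos :: "nat \<Rightarrow> int \<Rightarrow> nat \<Rightarrow> real" where
  "ccos N k m = cos (2 * pi * of_int k * real m / real N)"

definition csin :: "nat \<Rightarrow> int \<Rightarrow> nat \<Rightarrow> real" where
  "csin N k m = sin (2 * pi * of_int k * real m / real N)"

text \<open>The even and the odd combination of the indicator functions of the classes \<open>l\<close> and \<open>- l\<close>, which are
  up to constants the finite Fourier transforms of the cosine and the sine.\<close>

definition sym_ind :: "nat \<Rightarrow> int \<Rightarrow> nat \<Rightarrow> real" where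
  "sym_ind N l n = residue_ind N l n + residue_ind N (- l) n"

definition alt_ind :: "nat \<Rightarrow> int \<Rightarrow> nat \<Rightarrow> real" where
  "alt_ind N l n = residue_ind N l n - residue_ind N (- l) n"

lemma root1_add: "root1 N (j + k) = root1 N j * root1 N k"
  by (simp add: root1_def qpar_add[symmetric] add_divide_distrib)

lemma root1_eq_1_iff:
  assumes "N > 0"
  shows "root1 N j = 1 \<longleftrightarrow> int N dvd j"
proof
  assume "root1 N j = 1"
  then have "of_int j / of_nat N \<in> (\<int> :: complex set)"
    by (simp add: root1_def qpar_eq_1_iff)
  then obtain i where "of_int j / of_nat N = (of_int i :: complex)" by (auto elim: Ints_cases)
  then have "(of_int j :: complex) = of_int (i * int N)" using assms by (simp add: field_simps)
  then have "j = i * int N" unfolding of_int_eq_iff .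
  then show "int N dvd j" by simp
next
  assume "int N dvd j"
  then obtain i where "j = int N * i" by (auto elim: dvdE)
  then have "of_int j / of_nat N = (of_int i :: complex)" using assms by simp
  then show "root1 N j = 1" by (simp add: root1_def)
qed

lemma root1_cong:
  assumes "N > 0" "[j = k] (mod int N)"
  shows "root1 N j = root1 N k"
proof -
  have "int N dvd j - k" using assms(2) by (simp add: cong_iff_dvd_diff)
  then have "root1 N (j - k) = 1" using root1_eq_1_iff[OF assms(1)] by blast
  then show ?thesis using root1_add[of N "j - k" k] by simp
qed

lemma cnj_root1: "cnj (root1 N j) = root1 N (- j)"
  by (simp add: root1_def qpar_def exp_cnj)

lemma Re_root1_power: "Re (root1 N k ^ m) = ccos N k m"
  and Im_root1_power: "Im (root1 N k ^ m) = csin N k m"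
proof -
  have "root1 N k ^ m = cis (2 * pi * of_int k * real m / real N)"
    unfolding root1_def qpar_power by (simp add: qpar_def cis_conv_exp mult_ac)
  then show "Re (root1 N k ^ m) = ccos N k m" "Im (root1 N k ^ m) = csin N k m"
    by (simp_all add: ccos_def csin_def)
qed

lemma ccos_uminus: "ccos N (- k) m = ccos N k m" and csin_uminus: "csin N (- k) m = - csin N k m"
  by (simp_all add: ccos_def csin_def)

lemma csin_0 [simp]: "csin N k 0 = 0"
  by (simp add: csin_def)

lemma root1_power_eq: "root1 N k ^ m = Complex (ccos N k m) (csin N k m)"
  by (simp add: complex_eq_iff Re_root1_power Im_root1_power)

lemma ccos_cong: "N > 0 \<Longrightarrow> [j = k] (mod int N) \<Longrightarrow> ccos N j = ccos N k"
  and csin_cong: "N > 0 \<Longrightarrow> [j = k] (mod int N) \<Longrightarrow> csin N j = csin N k"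
  using root1_cong[of N j k] by (simp_all add: fun_eq_iff flip: Re_root1_power Im_root1_power)

lemma abs_ccos_le: "\<bar>ccos N k m\<bar> \<le> 1" and abs_csin_le: "\<bar>csin N k m\<bar> \<le> 1"
  by (simp_all add: ccos_def csin_def)

lemma residue_ind_real: "residue_ind N l n = complex_of_real (residue_ind N l n)"
  by (simp add: residue_ind_def)

lemma Re_residue_ind [simp]: "Re (residue_ind N l n) = residue_ind N l n"
  and Im_residue_ind [simp]: "Im (residue_ind N l n) = 0"
  by (simp_all add: residue_ind_real)

lemma sym_ind_cong: "[j = k] (mod int N) \<Longrightarrow> sym_ind N j = sym_ind N k"
  and alt_ind_cong: "[j = k] (mod int N) \<Longrightarrow> alt_ind N j = alt_ind N k"
  using residue_ind_cong[of j k N, where 'a = real] residue_ind_cong[of "- j" "- k" N, where 'a = real]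
  by (simp_all add: fun_eq_iff sym_ind_def alt_ind_def cong_minus_minus_iff)

lemma sym_ind_uminus: "sym_ind N (- l) = sym_ind N l"
  and alt_ind_uminus: "alt_ind N (- l) n = - alt_ind N l n"
  by (simp_all add: fun_eq_iff sym_ind_def alt_ind_def)

lemma abs_sym_ind_le: "\<bar>sym_ind N l n\<bar> \<le> 2" and abs_alt_ind_le: "\<bar>alt_ind N l n\<bar> \<le> 2"
  by (simp_all add: sym_ind_def alt_ind_def residue_ind_def)

lemma Re_log_coeff: "Re (log_coeff N j l m n) = ccos N j m / real m * sym_ind N l n"
  by (simp add: log_coeff_def root1_power_eq ccos_uminus sym_ind_def distrib_left Re_divide_of_nat)

lemma Im_mn_log_coeff:
  assumes "m \<ge> 1"
  shows "Im (of_nat (m * n) * log_coeff N j l m n) = csin N j m * (real n * alt_ind N l n)"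
proof -
  have "of_nat (m * n) * log_coeff N j l m n =
      of_nat n * (root1 N j ^ m * residue_ind N l n + root1 N (- j) ^ m * residue_ind N (- l) n)"
    using assms by (simp add: log_coeff_def field_simps)
  also have "Im \<dots> = csin N j m * (real n * alt_ind N l n)"
    unfolding root1_power_eq by (simp add: csin_uminus alt_ind_def algebra_simps)
  finally show ?thesis .
qed

subsection \<open>Lambert series of the logarithm\<close>

lemma qpar_shift: "qpar (of_int c / of_nat N + s) = root1 N c * qpar s"
  by (simp add: qpar_add root1_def)

text \<open>On the class \<open>n \<equiv> l\<close> the translation of \<open>\<tau>\<close> by \<open>c / N\<close> multiplies \<open>q^(m n)\<close> by a root of unity that
  depends on \<open>m\<close> only. Hence the translation keeps the residue class and changes the character of \<open>m\<close>.\<close>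

lemma root1_power_residue:
  assumes "N > 0" "[int n = l] (mod int N)"
  shows "root1 N c ^ (m * n) = root1 N (l * c) ^ m"
proof -
  have "[c * int (m * n) = l * c * int m] (mod int N)"
    using cong_mult[OF cong_refl[of "c * int m"] assms(2)] by (simp add: mult_ac)
  then show ?thesis unfolding root1_power by (rule root1_cong[OF assms(1)])
qed

lemma log_coeff_shift:
  assumes "N > 0"
  shows "log_coeff N 0 a m n * (root1 N c * q) ^ (m * n) = log_coeff N (a * c) a m n * q ^ (m * n)"
proof -
  have "root1 N j ^ m / of_nat m * residue_ind N l n * (root1 N c * q) ^ (m * n) =
      root1 N (l * c) ^ m / of_nat m * residue_ind N l n * q ^ (m * n)" if "j = 0" for l j
    using root1_power_residue[OF assms, of n l c m] that
    by (simp add: residue_ind_def power_mult_distrib)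
  note shift = this[OF refl]
  show ?thesis
    unfolding log_coeff_def distrib_right minus_zero shift[of a] shift[of "- a"] by simp
qed

lemma modular_unit_exp:
  assumes "Im \<tau> > 0"
  shows "modular_unit N a \<tau> =
         exp (of_real (pi * real N * B2 (of_int a / real N)) * \<i> * \<tau> - lambert (log_coeff N 0 a) (qpar \<tau>))"
proof -
  note q = norm_qpar_less_1[OF assms]
  have "lambert (log_coeff N 0 a) (qpar \<tau>) =
      lambert (\<lambda>m n. 1 / of_nat m * residue_ind N a n) (qpar \<tau>) +
      lambert (\<lambda>m n. 1 / of_nat m * residue_ind N (- a) n) (qpar \<tau>)"
    using lambert_add[OF poly_growth_root_div_residue[of N 0 a] poly_growth_root_div_residue[of N 0 "- a"] q]
    by (simp add: log_coeff_def[abs_def])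
  then show ?thesis
    unfolding modular_unit_def residue_product_exp[OF q]
    by (simp add: exp_add[symmetric] diff_diff_eq mult_ac)
qed

lemma modular_unit_shift:
  assumes "Im s > 0" "N > 0"
  shows "modular_unit N a (of_int c / of_nat N + s) =
         exp (of_real (pi * real N * B2 (of_int a / real N)) * \<i> * (of_int c / of_nat N + s)
              - lambert (log_coeff N (a * c) a) (qpar s))"
proof -
  have "Im (of_int c / of_nat N + s) > 0" using assms by simp
  from modular_unit_exp[OF this] show ?thesis
    unfolding qpar_shift by (simp only: lambert_cong[OF log_coeff_shift[OF assms(2)]])
qed

lemma modular_unit_logderiv:
  fixes c :: int
  assumes "Im s > 0" "N > 0"
  defines "\<tau> \<equiv> of_int c / of_nat N + s"
  shows "deriv (modular_unit N a) \<tau> / modular_unit N a \<tau> =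
         of_real (pi * real N * B2 (of_int a / real N)) * \<i> -
         2 * of_real pi * \<i> * lambert (\<lambda>m n. of_nat (m * n) * log_coeff N (a * c) a m n) (qpar s)"
proof -
  have \<tau>: "Im \<tau> > 0" using assms by (simp add: \<tau>_def)
  let ?K = "of_real (pi * real N * B2 (of_int a / real N)) :: complex"
  let ?L = "lambert (\<lambda>m n. of_nat (m * n) * log_coeff N 0 a m n) (qpar \<tau>)"
  have "((\<lambda>\<tau>. exp (?K * \<i> * \<tau> - lambert (log_coeff N 0 a) (qpar \<tau>))) has_field_derivative
      (?K * \<i> - 2 * of_real pi * \<i> * ?L) * modular_unit N a \<tau>) (at \<tau>)"
    unfolding modular_unit_exp[OF \<tau>]
    by (auto intro!: derivative_eq_intros lambert_qpar_has_field_derivative[OF poly_growth_log_coeff \<tau>])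
  then have "(modular_unit N a has_field_derivative (?K * \<i> - 2 * of_real pi * \<i> * ?L) * modular_unit N a \<tau>) (at \<tau>)"
    by (rule has_field_derivative_transform_within_open[OF _ open_halfspace_Im_gt[of 0]])
       (use \<tau> modular_unit_exp in auto)
  from DERIV_imp_deriv[OF this]
  have "deriv (modular_unit N a) \<tau> / modular_unit N a \<tau> = ?K * \<i> - 2 * of_real pi * \<i> * ?L"
    by (simp add: modular_unit_exp[OF \<tau>])
  also have "?L = lambert (\<lambda>m n. of_nat (m * n) * log_coeff N (a * c) a m n) (qpar s)"
    unfolding \<tau>_def qpar_shift
    by (rule lambert_cong) (simp only: mult.assoc log_coeff_shift[OF assms(2)])
  finally show ?thesis .
qed

lemma nome_less_1: "t > 0 \<Longrightarrow> \<bar>nome t\<bar> < 1"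
  by simp

lemma ln_norm_modular_unit:
  assumes "t > 0" "N > 0"
  shows "ln (cmod (modular_unit N a (Complex (of_int c / real N) t))) =
         - pi * real N * B2 (of_int a / real N) * t
         - lambert (\<lambda>m n. ccos N (a * c) m / real m * sym_ind N a n) (nome t)"
proof -
  have eq: "Complex (of_int c / real N) t = of_int c / of_nat N + Complex 0 t"
    by (simp add: complex_eq_iff)
  have "Im (Complex 0 t) > 0" using assms by simp
  from modular_unit_shift[OF this assms(2)]
  show ?thesis
    unfolding eq by (simp add: qpar_imag Re_lambert[OF poly_growth_log_coeff] assms Re_log_coeff)
qed

lemma darg_modular_unit:
  assumes "t > 0" "N > 0"
  shows "darg (modular_unit N a) (Complex (of_int c / real N) t) \<i> =
         2 * pi * lambert (\<lambda>m n. csin N (a * c) m * (real n * alt_ind N a n)) (nome t)"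
proof -
  have eq: "Complex (of_int c / real N) t = of_int c / of_nat N + Complex 0 t"
    by (simp add: complex_eq_iff)
  have im: "Im (Complex 0 t) > 0" using assms by simp
  let ?L = "lambert (\<lambda>m n. of_nat (m * n) * log_coeff N (a * c) a m n) (of_real (nome t) :: complex)"
  have "darg (modular_unit N a) (Complex (of_int c / real N) t) \<i> =
      Re (deriv (modular_unit N a) (Complex (of_int c / real N) t) / modular_unit N a (Complex (of_int c / real N) t))"
  proof -
    have "Im (u * \<i> / v) = Re (u / v)" for u v
    proof -
      have "u * \<i> / v = \<i> * (u / v)" by simp
      then show ?thesis by (simp only: Im_i_times)
    qed
    then show ?thesis by (simp only: darg_def)
  qed
  also have "\<dots> = 2 * pi * Im ?L"
    unfolding eq modular_unit_logderiv[OF im assms(2)] qpar_imag by simp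
  also have "Im ?L = lambert (\<lambda>m n. Im (of_nat (m * n) * log_coeff N (a * c) a m n)) (nome t)"
    by (rule Re_lambert) (use assms in \<open>auto intro: poly_growth_mult poly_growth_mn poly_growth_log_coeff simp del: of_nat_mult\<close>)
  also have "\<dots> = lambert (\<lambda>m n. csin N (a * c) m * (real n * alt_ind N a n)) (nome t)"
    by (rule lambert_cong) (simp only: Im_mn_log_coeff)
  finally show ?thesis .
qed

subsection \<open>Behaviour under inversion\<close>

lemma B2_mod: "B2 (of_int a / real N) = ((a mod int N) / N)\<^sup>2 - (a mod int N) / N + 1 / 6" if "N > 0"
proof -
  have "frac (of_int a / real N) = of_int (a mod int N) / real N"
  proof -
    have "\<lfloor>of_int a / real N\<rfloor> = a div int N"
      using floor_divide_of_int_eq[of a "int N", where 'a = real] by simp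
    moreover have "of_int a = real N * of_int (a div int N) + of_int (a mod int N)"
      by (metis div_mult_mod_eq mult.commute of_int_add of_int_mult of_int_of_nat_eq)
    ultimately show ?thesis using that by (simp add: frac_def field_simps)
  qed
  then show ?thesis by (simp add: B2_def)
qed

lemma B2_uminus: "B2 (- x) = B2 x"
  by (cases "x \<in> \<int>") (auto simp: B2_def frac_neg power2_eq_square algebra_simps frac_eq_0_iff[THEN iffD2])

text \<open>Representatives for \<open>dual_points\<close>, which needs \<open>1 \<le> k, l < N\<close>. The class of \<open>d\<close> is represented with
  the opposite sign because \<open>- k\<close> occurs in the division point \<open>l s - k / N\<close>.\<close>

locale nonzero_residues =
  fixes N :: nat and a d :: int
  assumes N_pos': "N > 0" and a: "\<not> int N dvd a" and d: "\<not> int N dvd d"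
begin

definition "lA = nat (a mod int N)"
definition "kD = nat ((- d) mod int N)"

lemma lA: "int lA = a mod int N" and kD: "int kD = (- d) mod int N"
  using N_pos' by (simp_all add: lA_def kD_def)

lemma range: "1 \<le> lA" "lA < N" "1 \<le> kD" "kD < N"
proof -
  have "a mod int N \<noteq> 0" "(- d) mod int N \<noteq> 0" using a d by (simp_all add: mod_eq_0_iff_dvd)
  moreover have "0 \<le> a mod int N" "a mod int N < int N" "0 \<le> (- d) mod int N" "(- d) mod int N < int N"
    using N_pos' by simp_all
  ultimately show "1 \<le> lA" "lA < N" "1 \<le> kD" "kD < N" using lA kD by linarith+
qed

lemma cong_lA: "[int lA = a] (mod int N)" and cong_kD: "[- int kD = d] (mod int N)"
proof -
  show "[int lA = a] (mod int N)" by (simp add: lA)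
  have "[int kD = - d] (mod int N)" by (simp add: kD)
  then show "[- int kD = d] (mod int N)" using cong_minus_minus_iff[of "int kD" "- d" "int N"] by simp
qed

lemma cong_kD': "[int kD = - d] (mod int N)"
  by (simp add: kD)

lemma B2_l: "B2 (of_int a / real N) = (lA / N)\<^sup>2 - lA / N + 1 / 6"
  unfolding B2_mod[OF N_pos'] lA[symmetric] by simp

lemma B2_k: "B2 (of_int d / real N) = (kD / N)\<^sup>2 - kD / N + 1 / 6"
  using B2_mod[OF N_pos', of "- d"] B2_uminus[of "of_int d / real N"] unfolding kD[symmetric] by simp

lemma trig: "ccos N (- int kD) = ccos N d" "csin N (- int kD) = csin N d"
  "ccos N (int lA) = ccos N a" "csin N (int lA) = csin N a"
  by (intro ccos_cong csin_cong N_pos' cong_lA cong_kD)+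

lemma inds: "sym_ind N (int lA) = sym_ind N a" "alt_ind N (int lA) = alt_ind N a"
  "sym_ind N (int kD) = sym_ind N d" "alt_ind N (int kD) n = - alt_ind N d n"
  using sym_ind_cong[OF cong_lA] alt_ind_cong[OF cong_lA] sym_ind_cong[OF cong_kD'] alt_ind_cong[OF cong_kD']
  by (simp_all add: sym_ind_uminus alt_ind_uminus)

lemma dual: "Im s > 0 \<Longrightarrow> dual_points N s (- 1 / (of_nat N ^ 2 * s)) kD lA"
  using range by (simp add: dual_points_def)

lemma dual_imag:
  fixes t :: real
  shows "t > 0 \<Longrightarrow> - 1 / (of_nat N ^ 2 * Complex 0 t) = Complex 0 (1 / ((real N)\<^sup>2 * t))"
  using N_pos' by (simp add: Complex_eq field_simps)

lemma log_inversion: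
  fixes t :: real
  assumes "t > 0"
  shows "pi * N * B2 (of_int a / N) * t + lambert (\<lambda>m n. ccos N d m / real m * sym_ind N a n) (nome t) =
         pi * B2 (of_int d / N) / (N * t) +
         lambert (\<lambda>m n. ccos N a m / real m * sym_ind N d n) (nome (1 / ((real N)\<^sup>2 * t)))"
proof -
  have t': "1 / ((real N)\<^sup>2 * t) > 0" using assms N_pos' by simp
  interpret dual_points N "Complex 0 t" "Complex 0 (1 / ((real N)\<^sup>2 * t))" kD lA
    using dual[of "Complex 0 t"] dual_imag[OF assms] assms by simp
  have *: "N * (1 / ((real N)\<^sup>2 * t)) = 1 / (N * t)" using N_pos' by (simp add: power2_eq_square)
  show ?thesis
    using log_transform nome_less_1[OF assms] nome_less_1[OF t']
    unfolding qpar_imag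
    by (simp only: Re_lambert[OF poly_growth_log_coeff] Re_log_coeff trig inds B2_l B2_k complex.sel *)
       (simp add: mult_ac)
qed

text \<open>The identity of \<open>log_inversion\<close> is the vanishing of \<open>Re F\<close> for a function \<open>F\<close> that is holomorphic on the
  upper half-plane. On the imaginary axis, the derivative of \<open>F\<close> in the horizontal direction has real
  part \<open>0\<close>, and this is the identity between the imaginary parts of the differentiated series.\<close>

lemma darg_inversion:
  fixes t :: real
  assumes "t > 0"
  shows "lambert (\<lambda>m n. csin N d m * (real n * alt_ind N a n)) (nome t) =
         1 / ((real N)\<^sup>2 * t\<^sup>2) *
         lambert (\<lambda>m n. csin N a m * (real n * alt_ind N d n)) (nome (1 / ((real N)\<^sup>2 * t)))"
proof -
  define J :: "complex \<Rightarrow> complex" where "J = (\<lambda>s. - 1 / (of_nat N ^ 2 * s))"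
  let ?c1 = "log_coeff N (- int kD) (int lA)" and ?c2 = "log_coeff N (int lA) (int kD)"
  let ?bl = "of_real (pi * N * B2 (of_int a / N)) :: complex" and ?bk = "of_real (pi * N * B2 (of_int d / N)) :: complex"
  define F where "F = (\<lambda>s. - \<i> * ?bl * s + lambert ?c1 (qpar s) - (- \<i> * ?bk * J s + lambert ?c2 (qpar (J s))))"
  have F0: "Re (F s) = 0" if "Im s > 0" for s
  proof -
    interpret dual_points N s "J s" kD lA using dual[OF that] by (simp add: J_def)
    show ?thesis
      using log_transform by (simp add: F_def B2_l B2_k mult_ac)
  qed
  let ?s = "Complex 0 t"
  have s: "Im ?s > 0" using assms by simp
  have Js: "J ?s = Complex 0 (1 / ((real N)\<^sup>2 * t))" unfolding J_def by (rule dual_imag[OF assms])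
  have t': "1 / ((real N)\<^sup>2 * t) > 0" using assms N_pos' by simp
  have J': "(J has_field_derivative of_real (- 1 / ((real N)\<^sup>2 * t\<^sup>2))) (at ?s)"
  proof -
    have "(J has_field_derivative 1 / (of_nat N ^ 2 * ?s ^ 2)) (at ?s)"
      unfolding J_def using N_pos' assms
      by (auto intro!: derivative_eq_intros simp: complex_eq_iff field_simps power2_eq_square)
    also have "1 / (of_nat N ^ 2 * ?s ^ 2) = of_real (- 1 / ((real N)\<^sup>2 * t\<^sup>2))"
      by (simp add: Complex_eq power_mult_distrib)
    finally show ?thesis .
  qed
  define L1 where "L1 = lambert (\<lambda>m n. of_nat (m * n) * ?c1 m n) (qpar ?s)"
  define L2 where "L2 = lambert (\<lambda>m n. of_nat (m * n) * ?c2 m n) (qpar (J ?s))"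
  have d1: "((\<lambda>s. lambert ?c1 (qpar s)) has_field_derivative 2 * of_real pi * \<i> * L1) (at ?s)"
    unfolding L1_def by (rule lambert_qpar_has_field_derivative[OF poly_growth_log_coeff s])
  have d2: "((\<lambda>s. lambert ?c2 (qpar (J s))) has_field_derivative
      2 * of_real pi * \<i> * L2 * of_real (- 1 / ((real N)\<^sup>2 * t\<^sup>2))) (at ?s)"
    unfolding L2_def
    by (rule DERIV_chain2[OF lambert_qpar_has_field_derivative[OF poly_growth_log_coeff] J'])
       (use t' in \<open>simp add: Js\<close>)
  define D where "D = - \<i> * ?bl + 2 * of_real pi * \<i> * L1
      - (- \<i> * ?bk * of_real (- 1 / ((real N)\<^sup>2 * t\<^sup>2)) + 2 * of_real pi * \<i> * L2 * of_real (- 1 / ((real N)\<^sup>2 * t\<^sup>2)))"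
  have F': "(F has_field_derivative D) (at ?s)"
    unfolding F_def D_def
    by (intro DERIV_diff DERIV_add d1 d2 DERIV_cmult J') (auto intro!: derivative_eq_intros)
  have "Re D = 0"
  proof -
    have "((\<lambda>x. F (?s + of_real x)) has_vector_derivative D) (at 0)"
    proof -
      have "((\<lambda>x. ?s + complex_of_real x) has_vector_derivative 1) (at 0)"
        by (auto intro!: derivative_eq_intros has_vector_derivative_of_real)
      from field_vector_diff_chain_at[OF this] F' show ?thesis by (simp add: o_def)
    qed
    from bounded_linear.has_vector_derivative[OF bounded_linear_Re this] have "((\<lambda>x. Re (F (?s + of_real x))) has_vector_derivative Re D) (at 0)"
      by simp
    moreover have "(\<lambda>x. Re (F (?s + of_real x))) = (\<lambda>x. 0)"
      using F0 assms by auto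
    ultimately have "((\<lambda>x::real. 0 :: real) has_vector_derivative Re D) (at 0)" by simp
    from vector_derivative_unique_at[OF this has_vector_derivative_const] show ?thesis .
  qed
  moreover have "Re D = - 2 * pi * (Im L1 + 1 / ((real N)\<^sup>2 * t\<^sup>2) * Im L2)"
  proof -
    have "Re (2 * of_real pi * \<i> * L2 * of_real x) = - 2 * pi * x * Im L2" for x by simp
    moreover have "Re (- \<i> * ?bk * of_real x) = 0" for x by simp
    ultimately show ?thesis unfolding D_def by (simp only: minus_complex.sel plus_complex.sel) (simp add: algebra_simps)
  qed
  ultimately have "Im L1 = - (1 / ((real N)\<^sup>2 * t\<^sup>2)) * Im L2"
    by (simp only: mult_eq_0_iff) (simp add: field_simps eq_neg_iff_add_eq_0)
  moreover have "Im L1 = lambert (\<lambda>m n. csin N d m * (real n * alt_ind N a n)) (nome t)"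
  proof -
    have "Im L1 = lambert (\<lambda>m n. Im (of_nat (m * n) * ?c1 m n)) (nome t)"
      unfolding L1_def qpar_imag
      by (rule Re_lambert) (use assms in \<open>auto intro: poly_growth_mult poly_growth_mn poly_growth_log_coeff simp del: of_nat_mult\<close>)
    also have "\<dots> = lambert (\<lambda>m n. csin N d m * (real n * alt_ind N a n)) (nome t)"
      by (rule lambert_cong) (simp only: Im_mn_log_coeff trig inds)
    finally show ?thesis .
  qed
  moreover have "Im L2 = - lambert (\<lambda>m n. csin N a m * (real n * alt_ind N d n)) (nome (1 / ((real N)\<^sup>2 * t)))"
  proof -
    have "Im L2 = lambert (\<lambda>m n. Im (of_nat (m * n) * ?c2 m n)) (nome (1 / ((real N)\<^sup>2 * t)))"
      unfolding L2_def Js qpar_imag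
      by (rule Re_lambert) (use t' in \<open>auto intro: poly_growth_mult poly_growth_mn poly_growth_log_coeff simp del: of_nat_mult\<close>)
    also have "\<dots> = lambert (\<lambda>m n. - (csin N a m * (real n * alt_ind N d n))) (nome (1 / ((real N)\<^sup>2 * t)))"
      by (rule lambert_cong) (simp only: Im_mn_log_coeff trig inds mult_minus_right)
    finally show ?thesis by (simp add: lambert_uminus)
  qed
  ultimately show ?thesis by simp
qed

end

section \<open>The weight one inversion\<close>

subsection \<open>Finite trigonometric sums\<close>

text \<open>The map \<open>z \<mapsto> 1 / (1 - z)\<close> takes the unit circle to the line of real part \<open>1 / 2\<close>.\<close>

lemma inverse_one_minus_root1:
  assumes "N > 0" "\<not> int N dvd b"
  shows "1 / (1 - root1 N b) = Complex (1 / 2) (cot (pi * of_int b / real N) / 2)"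
proof -
  define h where "h = pi * of_int b / real N"
  have r: "root1 N b = Complex (cos (2 * h)) (sin (2 * h))"
    using root1_power_eq[of N b 1] by (simp add: ccos_def csin_def h_def mult_ac)
  have "root1 N b \<noteq> 1" using root1_eq_1_iff assms by blast
  then have s: "sin h \<noteq> 0" by (auto simp: r complex_eq_iff cos_double_sin sin_double)
  have c2: "cos (2 * h) = 1 - 2 * (sin h * sin h)" and s2: "sin (2 * h) = 2 * (sin h * cos h)"
    by (simp_all add: cos_double_sin sin_double power2_eq_square)
  have cc: "cos h * cos h = 1 - sin h * sin h"
    using sin_cos_squared_add[of h] by (simp add: power2_eq_square algebra_simps)
  have "(1 - root1 N b) * Complex (1 / 2) (cot h / 2) = 1"
    unfolding r c2 s2 cot_def using s cc by (simp add: complex_eq_iff)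
  then show ?thesis using \<open>root1 N b \<noteq> 1\<close> by (simp add: h_def field_simps)
qed

lemma cot_eq_root1:
  assumes "N > 0" "\<not> int N dvd b"
  shows "(1 + root1 N b) / (1 - root1 N b) = \<i> * of_real (cot (pi * of_int b / real N))"
proof -
  have "root1 N b \<noteq> 1" using root1_eq_1_iff assms by blast
  then have "(1 + root1 N b) / (1 - root1 N b) = 2 * (1 / (1 - root1 N b)) - 1" by (simp add: field_simps)
  also have "\<dots> = \<i> * of_real (cot (pi * of_int b / real N))"
    unfolding inverse_one_minus_root1[OF assms] by (simp add: complex_eq_iff)
  finally show ?thesis .
qed

lemma root1_power_N: "N > 0 \<Longrightarrow> root1 N j ^ N = 1"
  by (simp add: root1_power root1_eq_1_iff)

lemma sum_root1_power:
  assumes "N > 0"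
  shows "(\<Sum>k<N. root1 N j ^ k) = (if int N dvd j then of_nat N else 0)"
proof (cases "int N dvd j")
  case True
  then have "root1 N j = 1" using root1_eq_1_iff[OF assms] by simp
  then show ?thesis using True by simp
next
  case False
  then have "root1 N j \<noteq> 1" using root1_eq_1_iff[OF assms] by simp
  then show ?thesis using False by (simp add: geometric_sum root1_power_N assms)
qed

lemma sum_times_power:
  fixes r :: "'a::comm_ring_1"
  shows "(r - 1) * (\<Sum>k<n. of_nat k * r ^ k) = of_nat n * r ^ n - (\<Sum>k<n. r ^ Suc k)"
  by (induction n) (simp_all add: algebra_simps)

lemma csin_sum_drop_0: "(\<Sum>k\<in>{1..<N}. of_real (csin N b k) * X k) = (\<Sum>k<N. of_real (csin N b k) * X k)"
  for X :: "nat \<Rightarrow> complex"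
  by (rule sum.mono_neutral_left) (auto simp: not_le)

lemma sum_csin:
  assumes "N > 0" "\<not> int N dvd b"
  shows "(\<Sum>k\<in>{1..<N}. of_real (csin N b k)) = (0 :: complex)"
proof -
  have "(\<Sum>k<N. csin N b k) = Im (\<Sum>k<N. root1 N b ^ k)" by (simp add: Im_root1_power)
  also have "\<dots> = 0" using sum_root1_power[OF assms(1)] assms(2) by simp
  finally have "of_real (\<Sum>k<N. csin N b k) = (0 :: complex)" by simp
  then show ?thesis using csin_sum_drop_0[of N b "\<lambda>_. 1"] by simp
qed

lemma sum_times_csin:
  assumes "N > 0" "\<not> int N dvd b"
  shows "(\<Sum>k\<in>{1..<N}. of_real (csin N b k) * of_nat k) = complex_of_real (- (N / 2) * cot (pi * b / N))"
proof -
  let ?r = "root1 N b"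
  have r1: "?r \<noteq> 1" using root1_eq_1_iff assms by blast
  have "(\<Sum>k<N. ?r ^ Suc k) = ?r * (\<Sum>k<N. ?r ^ k)" by (simp add: sum_distrib_left)
  then have "(?r - 1) * (\<Sum>k<N. of_nat k * ?r ^ k) = of_nat N"
    unfolding sum_times_power root1_power_N[OF assms(1)] using sum_root1_power[OF assms(1), of b] assms(2) by simp
  then have "(\<Sum>k<N. of_nat k * ?r ^ k) = - of_nat N * (1 / (1 - ?r))"
    using r1 by (simp add: field_simps)
  then have "Im (\<Sum>k<N. of_nat k * ?r ^ k) = - (N / 2) * cot (pi * b / N)"
    unfolding inverse_one_minus_root1[OF assms] by simp
  then have "(\<Sum>k<N. real k * csin N b k) = - (N / 2) * cot (pi * b / N)"
    by (simp add: Im_root1_power)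
  moreover have "(\<Sum>k\<in>{1..<N}. of_real (csin N b k) * of_nat k) = complex_of_real (\<Sum>k<N. real k * csin N b k)"
    unfolding csin_sum_drop_0 by (simp add: mult.commute)
  ultimately show ?thesis by simp
qed

text \<open>The finite Fourier transform of the sine: it turns the character \<open>k \<mapsto> \<zeta>^(k m)\<close> into the odd
  indicator function of the classes \<open>\<plusminus> b\<close>.\<close>

lemma sum_csin_root1:
  assumes "N > 0"
  shows "(\<Sum>k\<in>{1..<N}. of_real (csin N b k) * root1 N (int k) ^ m) = \<i> * of_real (N / 2 * alt_ind N b m)"
proof -
  have c: "of_real (csin N b k) * root1 N (int k) ^ m =
      (root1 N (int m + b) ^ k - root1 N (int m - b) ^ k) / (2 * \<i>)" for k
  proof -
    have "of_real (csin N b k) = (root1 N b ^ k - root1 N (- b) ^ k) / (2 * \<i>)"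
      by (simp add: root1_power_eq complex_eq_iff ccos_uminus csin_uminus)
    moreover have "root1 N (int k) ^ m = root1 N (int m) ^ k"
      by (simp add: root1_power mult.commute)
    ultimately have "of_real (csin N b k) * root1 N (int k) ^ m =
        (root1 N (int m) ^ k * root1 N b ^ k - root1 N (int m) ^ k * root1 N (- b) ^ k) / (2 * \<i>)"
      by (simp add: right_diff_distrib mult.commute)
    then show ?thesis
      using root1_add[of N "int m" b] root1_add[of N "int m" "- b"] by (simp add: power_mult_distrib)
  qed
  have "(int N dvd int m + b) = [int m = - b] (mod int N)" "(int N dvd int m - b) = [int m = b] (mod int N)"
    by (simp_all add: cong_iff_dvd_diff)
  then have "(\<Sum>k<N. root1 N (int m + b) ^ k) = of_nat N * residue_ind N (- b) m"
    "(\<Sum>k<N. root1 N (int m - b) ^ k) = of_nat N * residue_ind N b m"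
    using sum_root1_power[OF assms] by (simp_all add: residue_ind_def)
  then have "(\<Sum>k<N. of_real (csin N b k) * root1 N (int k) ^ m) =
      of_nat N * (residue_ind N (- b) m - residue_ind N b m) / (2 * \<i>)"
    unfolding c by (simp add: sum_divide_distrib[symmetric] sum_subtractf algebra_simps)
  also have "\<dots> = \<i> * of_real (N / 2 * alt_ind N b m)"
    by (simp add: alt_ind_def residue_ind_real[of N] complex_eq_iff) (simp add: algebra_simps)
  finally show ?thesis unfolding csin_sum_drop_0 .
qed

lemma sum_csin_residue_ind:
  assumes "N > 0"
  shows "(\<Sum>k\<in>{1..<N}. of_real (csin N b k) * residue_ind N (int k) n) = complex_of_real (csin N b n)"
    and "(\<Sum>k\<in>{1..<N}. of_real (csin N b k) * residue_ind N (- int k) n) = - complex_of_real (csin N b n)"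
proof -
  have *: "(\<Sum>k<N. of_real (csin N b k) * residue_ind N (int k) n) = complex_of_real (csin N b n)" for n b
  proof -
    have "(\<Sum>k<N. of_real (csin N b k) * residue_ind N (int k) n) =
        (\<Sum>k<N. if k = n mod N then complex_of_real (csin N b k) else 0)"
    proof (intro sum.cong refl)
      fix k assume "k \<in> {..<N}"
      then have "[int n = int k] (mod int N) \<longleftrightarrow> k = n mod N"
        unfolding cong_int_iff by (auto simp: unique_euclidean_semiring_class.cong_def)
      then show "of_real (csin N b k) * residue_ind N (int k) n =
          (if k = n mod N then complex_of_real (csin N b k) else 0)"
        by (simp add: residue_ind_def)
    qed
    also have "\<dots> = of_real (csin N b (n mod N))" using assms by simp
    also have "csin N b (n mod N) = csin N b n"
    proof -
      have "[b * int (n mod N) = b * int n] (mod int N)"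
        by (intro cong_mult cong_refl) (simp add: zmod_int)
      then have "root1 N b ^ (n mod N) = root1 N b ^ n"
        unfolding root1_power by (rule root1_cong[OF assms])
      then show ?thesis by (simp flip: Im_root1_power)
    qed
    finally show ?thesis .
  qed
  show "(\<Sum>k\<in>{1..<N}. of_real (csin N b k) * residue_ind N (int k) n) = complex_of_real (csin N b n)"
    unfolding csin_sum_drop_0 by (rule *)
  define n' where "n' = nat ((- int n) mod int N)"
  have n': "int n' = (- int n) mod int N" unfolding n'_def using assms by simp
  have "[int n' = - int n] (mod int N)" by (simp add: n')
  then have cn: "[- int n' = int n] (mod int N)"
    using cong_minus_minus_iff[of "int n'" "- int n" "int N"] by simp
  have "[int n = - int k] (mod int N) \<longleftrightarrow> [int n' = int k] (mod int N)" for k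
  proof -
    have "[int n = - int k] (mod int N) \<longleftrightarrow> [- int n' = - int k] (mod int N)"
      using cn by (meson cong_sym cong_trans)
    then show ?thesis by (simp add: cong_minus_minus_iff)
  qed
  then have "residue_ind N (- int k) n = (residue_ind N (int k) n' :: complex)" for k
    by (simp add: residue_ind_def)
  then have "(\<Sum>k<N. of_real (csin N b k) * residue_ind N (- int k) n) = complex_of_real (csin N b n')"
    using *[of b n'] by simp
  also have "csin N b n' = - csin N b n"
  proof -
    have "[b * int n' = (- b) * int n] (mod int N)"
      using cong_mult[OF cong_refl[of "- b"] cn] by simp
    then have "root1 N b ^ n' = root1 N (- b) ^ n"
      unfolding root1_power by (rule root1_cong[OF assms])
    then show ?thesis by (metis Im_root1_power csin_uminus)
  qed
  finally show "(\<Sum>k\<in>{1..<N}. of_real (csin N b k) * residue_ind N (- int k) n) = - complex_of_real (csin N b n)"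
    unfolding csin_sum_drop_0 by simp
qed

subsection \<open>Inversion of Eisenstein series of weight one\<close>

lemma poly_growth_real_products:
  "poly_growth (\<lambda>m n. sym_ind N a m * alt_ind N b n)"
  "poly_growth (\<lambda>m n. ccos N a m * csin N b n)"
proof -
  have "\<bar>sym_ind N a m * alt_ind N b n\<bar> \<le> 2 * 2" for m n
    unfolding abs_mult by (intro mult_mono abs_sym_ind_le abs_alt_ind_le) auto
  then show "poly_growth (\<lambda>m n. sym_ind N a m * alt_ind N b n)"
    by (intro poly_growth_bounded[of _ 4]) simp
  have "\<bar>ccos N a m * csin N b n\<bar> \<le> 1 * 1" for m n
    unfolding abs_mult by (intro mult_mono abs_ccos_le abs_csin_le) auto
  then show "poly_growth (\<lambda>m n. ccos N a m * csin N b n)"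
    by (intro poly_growth_bounded[of _ 1]) simp
qed

text \<open>The sum of \<open>logderiv_transform\<close> over \<open>0 < k < N\<close> with the weights \<open>sin (2 \<pi> b k / N)\<close>. This finite
  Fourier transform converts the roots of unity on one side into residue classes and the residue
  classes on the other side into roots of unity. It annihilates the part of the elementary term that
  is independent of \<open>k\<close>, and the part linear in \<open>k\<close> becomes the cotangent.\<close>

theorem weight_one_inversion:
  fixes u :: real
  assumes N: "N > 0" and a: "\<not> int N dvd a" and b: "\<not> int N dvd b" and u: "u > 0"
  shows "lambert (\<lambda>m n. sym_ind N a m * alt_ind N b n) (nome (1 / ((real N)\<^sup>2 * u))) =
         u * (cot (pi * b / N) + 4 * lambert (\<lambda>m n. ccos N a m * csin N b n) (nome u))"
proof -
  interpret nonzero_residues N a a using N a by unfold_locales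
  let ?l = "lA"
  define t where "t = 1 / ((real N)\<^sup>2 * u)"
  have t: "t > 0" using N u by (simp add: t_def)
  define s where "s = Complex 0 t"
  define s' where "s' = Complex 0 u"
  have ims: "Im s > 0" "Im s' > 0" using t u by (simp_all add: s_def s'_def)
  have "- 1 / (of_nat N ^ 2 * s) = Complex 0 (1 / ((real N)\<^sup>2 * t))"
    unfolding s_def by (rule dual_imag[OF t])
  also have "1 / ((real N)\<^sup>2 * t) = u" using N u by (simp add: t_def)
  finally have ss': "s' = - 1 / (of_nat N ^ 2 * s)" by (simp add: s'_def)
  have invN: "1 / (of_nat N * s) = - \<i> * of_real (N * u)"
    using N u by (simp add: s_def t_def Complex_eq field_simps power2_eq_square)
  have invN2: "of_nat k / (of_nat N ^ 2 * s) = - \<i> * of_real u * of_nat k" for k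
    using N u by (simp add: s_def t_def Complex_eq field_simps power2_eq_square)
  define w where "w = (\<lambda>k. complex_of_real (csin N b k))"
  let ?A = "\<lambda>k. lambert (logderiv_coeff N (- int k) (int ?l)) (qpar s)"
  let ?B = "\<lambda>k. lambert (logderiv_coeff N (int ?l) (int k)) (qpar s')"
  define \<kappa> where "\<kappa> = of_nat ?l / of_nat N - 1 / 2 + 1 / (2 * (of_nat N * s))"
  have eq: "w k * \<kappa> + \<i> * of_real u * (w k * of_nat k) + w k * ?A k = - \<i> * of_real (N * u) * (w k * ?B k)"
    if k: "k \<in> {1..<N}" for k
  proof -
    interpret dual_points N s s' k ?l
      using ims ss' range k by unfold_locales auto
    have "\<kappa> + \<i> * of_real u * of_nat k + ?A k = - \<i> * of_real (N * u) * ?B k"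
      using logderiv_transform unfolding invN invN2 \<kappa>_def by (simp add: algebra_simps)
    then have "w k * (\<kappa> + \<i> * of_real u * of_nat k + ?A k) = w k * (- \<i> * of_real (N * u) * ?B k)" by simp
    then show ?thesis by (simp add: algebra_simps)
  qed
  have sumA: "(\<Sum>k\<in>{1..<N}. w k * ?A k) =
      \<i> * of_real (N / 2 * lambert (\<lambda>m n. sym_ind N a m * alt_ind N b n) (nome t))"
  proof -
    have "(\<Sum>k\<in>{1..<N}. w k * ?A k) =
        lambert (\<lambda>m n. \<Sum>k\<in>{1..<N}. w k * logderiv_coeff N (- int k) (int ?l) m n) (qpar s)"
      unfolding lambert_cmult[symmetric]
      by (rule lambert_sum[symmetric])
         (auto intro: poly_growth_mult poly_growth_const poly_growth_logderiv_coeff norm_qpar_less_1 ims)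
    also have "(\<lambda>m n. \<Sum>k\<in>{1..<N}. w k * logderiv_coeff N (- int k) (int ?l) m n) =
        (\<lambda>m n. \<i> * of_real (N / 2) * complex_of_real (alt_ind N b m * sym_ind N a n))" (is "?L = ?R")
    proof (intro ext)
      fix m n
      have neg: "(\<Sum>k\<in>{1..<N}. w k * root1 N (- int k) ^ m) = - (\<i> * of_real (N / 2 * alt_ind N b m))"
      proof -
        have "(\<Sum>k\<in>{1..<N}. w k * root1 N (- int k) ^ m) = cnj (\<Sum>k\<in>{1..<N}. w k * root1 N (int k) ^ m)"
          by (simp add: w_def cnj_root1)
        also have "\<dots> = - (\<i> * of_real (N / 2 * alt_ind N b m))"
          unfolding w_def sum_csin_root1[OF N] by simp
        finally show ?thesis .
      qed
      have "?L m n = residue_ind N (- int ?l) n * (\<Sum>k\<in>{1..<N}. w k * root1 N (int k) ^ m) -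
          residue_ind N (int ?l) n * (\<Sum>k\<in>{1..<N}. w k * root1 N (- int k) ^ m)"
        unfolding logderiv_coeff_def sum_distrib_left sum_subtractf[symmetric] minus_minus
        by (intro sum.cong refl) (simp add: algebra_simps)
      also have "\<dots> = \<i> * of_real (N / 2 * alt_ind N b m) *
          complex_of_real (sym_ind N (int ?l) n)"
        unfolding neg unfolding w_def sum_csin_root1[OF N] sym_ind_def
        by (simp add: residue_ind_real[of N] algebra_simps)
      finally show "?L m n = ?R m n" unfolding inds by simp
    qed
    also have "lambert \<dots> (qpar s) =
        \<i> * of_real (N / 2) * of_real (lambert (\<lambda>m n. alt_ind N b m * sym_ind N a n) (nome t))"
    proof -
      have "poly_growth (\<lambda>m n. alt_ind N b m * sym_ind N a n)"
      proof (rule poly_growth_bounded)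
        show "norm (alt_ind N b m * sym_ind N a n) \<le> 2 * 2" for m n
          unfolding abs_mult real_norm_def by (intro mult_mono abs_sym_ind_le abs_alt_ind_le) auto
      qed
      then show ?thesis
        unfolding lambert_cmult s_def qpar_imag using t by (subst lambert_of_real) auto
    qed
    also have "lambert (\<lambda>m n. alt_ind N b m * sym_ind N a n) (nome t) =
        lambert (\<lambda>m n. sym_ind N a m * alt_ind N b n) (nome t)"
      using lambert_swap[of "\<lambda>m n. sym_ind N a m * alt_ind N b n"] by (simp add: mult.commute)
    finally show ?thesis by simp
  qed
  have sumB: "(\<Sum>k\<in>{1..<N}. w k * ?B k) =
      - 2 * of_real (lambert (\<lambda>m n. ccos N a m * csin N b n) (nome u))"
  proof -
    have "(\<Sum>k\<in>{1..<N}. w k * ?B k) =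
        lambert (\<lambda>m n. \<Sum>k\<in>{1..<N}. w k * logderiv_coeff N (int ?l) (int k) m n) (qpar s')"
      unfolding lambert_cmult[symmetric]
      by (rule lambert_sum[symmetric])
         (auto intro: poly_growth_mult poly_growth_const poly_growth_logderiv_coeff norm_qpar_less_1 ims)
    also have "(\<lambda>m n. \<Sum>k\<in>{1..<N}. w k * logderiv_coeff N (int ?l) (int k) m n) =
        (\<lambda>m n. - 2 * complex_of_real (ccos N a m * csin N b n))" (is "?L = ?R")
    proof (intro ext)
      fix m n
      have "?L m n = root1 N (- int ?l) ^ m * (\<Sum>k\<in>{1..<N}. w k * residue_ind N (- int k) n) -
          root1 N (int ?l) ^ m * (\<Sum>k\<in>{1..<N}. w k * residue_ind N (int k) n)"
        unfolding logderiv_coeff_def sum_distrib_left sum_subtractf[symmetric]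
        by (intro sum.cong refl) (simp add: algebra_simps)
      also have "\<dots> = - of_real (csin N b n) * (root1 N (- int ?l) ^ m + root1 N (int ?l) ^ m)"
        unfolding w_def sum_csin_residue_ind[OF N] by (simp add: algebra_simps)
      also have "root1 N (- int ?l) ^ m + root1 N (int ?l) ^ m = 2 * of_real (ccos N a m)"
        by (simp add: root1_power_eq complex_eq_iff ccos_uminus csin_uminus trig)
      finally show "?L m n = ?R m n" by simp
    qed
    also have "lambert \<dots> (qpar s') = - 2 * of_real (lambert (\<lambda>m n. ccos N a m * csin N b n) (nome u))"
      unfolding lambert_cmult s'_def qpar_imag using u
      by (subst lambert_of_real) (auto intro: poly_growth_real_products)
    finally show ?thesis .
  qed
  have "(\<Sum>k\<in>{1..<N}. w k * \<kappa> + \<i> * of_real u * (w k * of_nat k) + w k * ?A k) =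
      (\<Sum>k\<in>{1..<N}. - \<i> * of_real (N * u) * (w k * ?B k))"
    by (rule sum.cong[OF refl eq])
  then have "(\<Sum>k\<in>{1..<N}. w k) * \<kappa> + \<i> * of_real u * (\<Sum>k\<in>{1..<N}. w k * of_nat k) + (\<Sum>k\<in>{1..<N}. w k * ?A k) =
      - \<i> * of_real (N * u) * (\<Sum>k\<in>{1..<N}. w k * ?B k)"
    by (simp only: sum.distrib sum_distrib_left sum_distrib_right)
  then have "\<i> * of_real u * complex_of_real (- (N / 2) * cot (pi * b / N)) +
      \<i> * of_real (N / 2 * lambert (\<lambda>m n. sym_ind N a m * alt_ind N b n) (nome t)) =
      - \<i> * of_real (N * u) * (- 2 * of_real (lambert (\<lambda>m n. ccos N a m * csin N b n) (nome u)))"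
    unfolding sumA sumB unfolding w_def sum_csin[OF N b] sum_times_csin[OF N b] by simp
  from arg_cong[OF this, of Im]
  have "- u * (N / 2) * cot (pi * b / N) + N / 2 * lambert (\<lambda>m n. sym_ind N a m * alt_ind N b n) (nome t) =
      2 * N * u * lambert (\<lambda>m n. ccos N a m * csin N b n) (nome u)" by simp
  then have "N / 2 * lambert (\<lambda>m n. sym_ind N a m * alt_ind N b n) (nome t) =
      N / 2 * (u * (cot (pi * b / N) + 4 * lambert (\<lambda>m n. ccos N a m * csin N b n) (nome u)))"
    by (simp add: algebra_simps)
  then have "lambert (\<lambda>m n. sym_ind N a m * alt_ind N b n) (nome t) =
      u * (cot (pi * b / N) + 4 * lambert (\<lambda>m n. ccos N a m * csin N b n) (nome u))"
    using N by simp
  then show ?thesis by (simp add: t_def)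
qed

section \<open>Special values\<close>

text \<open>The logarithmic derivative of the reflection formula \<open>\<Gamma>(x) \<Gamma>(1 - x) sin (\<pi> x) = \<pi>\<close>.\<close>

lemma cot_partial_fractions:
  fixes x :: real
  assumes x: "0 < x" "x < 1"
  shows "(\<lambda>j. 1 / (x + real j) - 1 / (1 - x + real j)) sums (pi * cot (pi * x))"
proof -
  have sx: "sin (pi * x) \<noteq> 0" using sin_gt_zero[of "pi * x"] x by simp
  have nz: "x \<notin> \<int>\<^sub>\<le>\<^sub>0" "1 - x \<notin> \<int>\<^sub>\<le>\<^sub>0" using x by (auto elim!: nonpos_Ints_cases)
  have G: "Gamma y * Gamma (1 - y) * sin (pi * y) = pi" if "0 < y" "y < 1" for y :: real
  proof -
    have "complex_of_real (Gamma y * Gamma (1 - y)) = of_real (pi / sin (pi * y))"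
      using Gamma_reflection_complex[of "of_real y"]
      by (simp add: Gamma_complex_of_real[symmetric] sin_of_real[symmetric])
    then have "Gamma y * Gamma (1 - y) = pi / sin (pi * y)" unfolding of_real_eq_iff .
    moreover have "sin (pi * y) \<noteq> 0" using sin_gt_zero[of "pi * y"] that by simp
    ultimately show ?thesis by simp
  qed
  have "((\<lambda>y. Gamma y * Gamma (1 - y) * sin (pi * y)) has_real_derivative
      Gamma x * Gamma (1 - x) * (sin (pi * x) * (Digamma x - Digamma (1 - x)) + pi * cos (pi * x))) (at x)"
    using nz by (auto intro!: derivative_eq_intros simp: algebra_simps)
  moreover have "((\<lambda>y. Gamma y * Gamma (1 - y) * sin (pi * y)) has_real_derivative 0) (at x)"
    by (rule has_field_derivative_transform_within_open[of "\<lambda>_. pi" _ _ "{0<..<1}"])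
       (use x G in auto)
  ultimately have "Gamma x * Gamma (1 - x) * (sin (pi * x) * (Digamma x - Digamma (1 - x)) + pi * cos (pi * x)) = 0"
    by (rule DERIV_unique)
  moreover have "Gamma x * Gamma (1 - x) \<noteq> 0" using G[OF x] by auto
  ultimately have "sin (pi * x) * (Digamma x - Digamma (1 - x)) + pi * cos (pi * x) = 0" by simp
  then have D: "Digamma (1 - x) - Digamma x = pi * cot (pi * x)"
    using sx by (simp add: cot_def field_simps)
  have sm: "summable (\<lambda>k. inverse (of_nat (Suc k)) - inverse (y + of_nat k))" if "y \<noteq> 0" for y :: real
    using summable_Digamma[OF that] .
  have "(\<lambda>k. (inverse (of_nat (Suc k)) - inverse ((1 - x) + of_nat k)) - (inverse (of_nat (Suc k)) - inverse (x + of_nat k)))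
      sums (Digamma (1 - x) - Digamma x)"
    unfolding Digamma_def using sums_diff[OF summable_sums[OF sm[of "1 - x"]] summable_sums[OF sm[of x]]] x
    by simp
  moreover have "(inverse (of_nat (Suc k)) - inverse ((1 - x) + of_nat k)) - (inverse (of_nat (Suc k)) - inverse (x + of_nat k))
      = 1 / (x + real k) - 1 / (1 - x + real k)" for k
    by (simp add: inverse_eq_divide)
  ultimately show ?thesis unfolding D by simp
qed

lemma poly_growth_ccos_sym: "poly_growth (\<lambda>m n. ccos N a m / real m * sym_ind N d n)"
proof (rule poly_growth_bounded)
  fix m n :: nat assume "m \<ge> 1"
  then have "\<bar>ccos N a m\<bar> / real m \<le> 1 / 1" by (intro frac_le abs_ccos_le) auto
  then have "\<bar>ccos N a m\<bar> / real m * \<bar>sym_ind N d n\<bar> \<le> 1 / 1 * 2"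
    by (intro mult_mono abs_sym_ind_le) auto
  then show "norm (ccos N a m / real m * sym_ind N d n) \<le> 1 / 1 * 2"
    by (simp add: abs_mult)
qed

lemma lambert_sym_sums:
  assumes l: "1 \<le> l" "l < N" and t: "t > 0"
  shows "(\<lambda>m. ccos N d m / real m * ((nome t ^ m) ^ l + (nome t ^ m) ^ (N - l)) / (1 - (nome t ^ m) ^ N)) sums
           lambert (\<lambda>m n. ccos N d m / real m * sym_ind N (int l) n) (nome t)"
proof -
  let ?f = "\<lambda>m. ccos N d m / real m * ((nome t ^ m) ^ l + (nome t ^ m) ^ (N - l)) / (1 - (nome t ^ m) ^ N)"
  have hs: "((\<lambda>(m, n). ccos N d m / real m * sym_ind N (int l) n * nome t ^ (m * n)) has_sum
        lambert (\<lambda>m n. ccos N d m / real m * sym_ind N (int l) n) (nome t)) pairs"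
    by (rule lambert_has_sum[OF poly_growth_ccos_sym]) (use t in simp)
  have "(?f has_sum lambert (\<lambda>m n. ccos N d m / real m * sym_ind N (int l) n) (nome t)) {1..}"
  proof (rule has_sum_SigmaD[OF hs])
    fix m :: nat assume m: "m \<in> {1..}"
    define x where "x = nome t ^ m"
    have x: "0 \<le> x" "x < 1" unfolding x_def using t m by (auto simp: power_less_one_iff)
    have nl: "1 \<le> N - l" "N - l \<le> N" using l by auto
    have "((\<lambda>n. residue_ind N (int l) n * x ^ n + residue_ind N (- int l) n * x ^ n) has_sum
        (x ^ l / (1 - x ^ N) + x ^ (N - l) / (1 - x ^ N))) {1..}"
      using has_sum_add[OF residue_class_geometric[OF l(1) less_imp_le[OF l(2)] x] residue_class_geometric[OF nl x]]
      unfolding residue_ind_complement[OF less_imp_le[OF l(2)]] .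
    from has_sum_cmult_right[OF this, of "ccos N d m / real m"]
    show "((\<lambda>n. case (m, n) of (m, n) \<Rightarrow> ccos N d m / real m * sym_ind N (int l) n * nome t ^ (m * n)) has_sum ?f m) {1..}"
      by (simp add: x_def sym_ind_def power_mult distrib_left distrib_right add_divide_distrib mult_ac)
  qed
  also have "?this \<longleftrightarrow> (?f has_sum lambert (\<lambda>m n. ccos N d m / real m * sym_ind N (int l) n) (nome t)) UNIV"
    by (rule has_sum_cong_neutral) (auto simp: not_le)
  finally show ?thesis by (rule has_sum_imp_sums)
qed

lemma two_exp_quotient_limit:
  fixes A B C :: real
  assumes "C > 0"
  shows "((\<lambda>t. t * (exp (- A * t) + exp (- B * t)) / (1 - exp (- C * t))) \<longlongrightarrow> 2 / C) (at_right 0)"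
  using assms by real_asymp (simp add: divide_inverse)

text \<open>Multiply \<open>log_inversion\<close> by \<open>t\<close> and let \<open>t\<close> tend to \<open>0\<close> from the right. The side with the argument \<open>1 / (N\<^sup>2 t)\<close>
  tends to its elementary term, a multiple of \<open>B2 (d / N)\<close>. On the other side, the limit may be taken
  term by term by Tannery's theorem, which leaves the cosine series.\<close>

theorem B2_fourier:
  assumes N: "N > 0" and d: "\<not> int N dvd d"
  shows "((\<lambda>m. ccos N d m / real m ^ 2) has_sum (pi\<^sup>2 * B2 (of_int d / real N))) {1..}"
proof -
  have N2: "N \<ge> 2" using N d by (cases "N = 1") auto
  \<comment> \<open>Only \<open>d\<close> occurs in the claim, so any nonzero residue class may be taken for \<open>n\<close> in \<open>log_inversion\<close>.
    The class of \<open>1\<close> is available since \<open>N \<ge> 2\<close>.\<close>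
  interpret nonzero_residues N 1 d using N d N2 by unfold_locales auto
  define Q where "Q = (\<lambda>m t. t * ((nome t ^ m) ^ 1 + (nome t ^ m) ^ (N - 1)) / (1 - (nome t ^ m) ^ N))"
  define f where "f = (\<lambda>m t. ccos N d m / real m * Q m t)"
  let ?L = "\<lambda>t. lambert (\<lambda>m n. ccos N d m / real m * sym_ind N 1 n) (nome t)"
  have sums: "(\<lambda>m. f m t) sums (t * ?L t)" if "t > 0" for t
    using sums_mult[OF lambert_sym_sums[of 1 N t d], of t] N2 that by (simp add: f_def Q_def mult_ac)
  have lim: "((\<lambda>t. f m t) \<longlongrightarrow> ccos N d m / real m * (1 / (pi * real m * real N))) (at_right 0)" for m
  proof (cases "m = 0")
    case False
    have pw: "(nome t ^ m) ^ k = exp (- (2 * pi * real m * real k) * t)" for k t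
      by (simp add: exp_of_nat_mult[symmetric] power_mult[symmetric] mult_ac)
    have "((\<lambda>t. Q m t) \<longlongrightarrow> 2 / (2 * pi * real m * real N)) (at_right 0)"
      unfolding Q_def pw by (rule two_exp_quotient_limit) (use False N in simp)
    then show ?thesis unfolding f_def by (intro tendsto_mult_left) (simp add: mult.assoc)
  qed (simp add: f_def)
  have bound: "norm (f m t) \<le> 1 / real m ^ 2" if t: "t > 0" for m t
  proof (cases "m = 0")
    case False
    define y where "y = 2 * pi * real m * t"
    define x where "x = nome t ^ m"
    have y: "y > 0" using t False by (simp add: y_def)
    have x: "x = exp (- y)" by (simp add: x_def y_def exp_of_nat_mult[symmetric] mult_ac)
    have x01: "0 < x" "x < 1" using y by (simp_all add: x)
    have "x ^ (N - 1) \<le> x ^ 1" "x ^ N \<le> x ^ 1"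
      by (rule power_decreasing; use N2 x01 in simp)+
    then have "(x ^ 1 + x ^ (N - 1)) / (1 - x ^ N) \<le> (2 * x) / (1 - x)"
      using x01 by (intro frac_le) auto
    also have "\<dots> = 2 / (exp y - 1)"
      using y unfolding x by (simp add: exp_minus field_simps)
    also have "y \<le> exp y - 1" using exp_ge_add_one_self[of y] by linarith
    then have "2 / (exp y - 1) \<le> 2 / y" using y by (intro divide_left_mono) auto
    finally have "t * ((x ^ 1 + x ^ (N - 1)) / (1 - x ^ N)) \<le> t * (2 / y)"
      using t by (intro mult_left_mono) auto
    also have "t * (2 / y) = 1 / (pi * real m)" using t False by (simp add: y_def)
    also have "\<dots> \<le> 1 / real m"
      using False pi_gt3 by (intro divide_left_mono) auto
    finally have Q1: "Q m t \<le> 1 / real m" by (simp add: Q_def x_def)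
    have "x ^ N < 1" using x01 N by (simp add: power_less_one_iff)
    then have Q0: "Q m t \<ge> 0" using t x01 by (simp add: Q_def flip: x_def)
    have "\<bar>ccos N d m\<bar> / real m * Q m t \<le> (1 / real m) * (1 / real m)"
      using Q0 Q1 by (intro mult_mono divide_right_mono abs_ccos_le) auto
    then show ?thesis using Q0 by (simp add: f_def abs_mult power2_eq_square)
  qed (simp add: f_def)
  have "summable (\<lambda>m. norm (ccos N d m / real m * (1 / (pi * real m * real N)))) \<and>
      ((\<lambda>t. \<Sum>m. f m t) \<longlongrightarrow> (\<Sum>m. ccos N d m / real m * (1 / (pi * real m * real N)))) (at_right 0)"
  proof (rule conjunct2[OF tannerys_theorem[where F = "at_right 0"]])
    show "eventually (\<lambda>(k, t). norm (f k t) \<le> 1 / real k ^ 2) (at_top \<times>\<^sub>F at_right 0)"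
      unfolding eventually_prod_filter
      by (intro exI[of _ "\<lambda>_. True"] exI[of _ "\<lambda>t. t > 0"])
         (use bound in \<open>auto simp: eventually_at_right_less\<close>)
  qed (use lim inverse_squares_summable(1) in auto)
  then have sm': "summable (\<lambda>m. norm (ccos N d m / real m * (1 / (pi * real m * real N))))"
    and T: "((\<lambda>t. \<Sum>m. f m t) \<longlongrightarrow> (\<Sum>m. ccos N d m / real m * (1 / (pi * real m * real N)))) (at_right 0)"
    by blast+
  have "((\<lambda>t. \<Sum>m. f m t) \<longlongrightarrow> pi * B2 (of_int d / N) / N + 0 - 0) (at_right 0)"
  proof -
    let ?R = "\<lambda>t. lambert (\<lambda>m n. ccos N 1 m / real m * sym_ind N d n) (nome (1 / ((real N)\<^sup>2 * t)))"
    have R0: "((\<lambda>t. t * ?R t) \<longlongrightarrow> 0) (at_right 0)"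
    proof -
      obtain p where p: "\<And>k. k \<ge> p \<Longrightarrow> \<exists>C\<ge>0. \<forall>t>0.
          \<bar>lambert (\<lambda>m n. ccos N 1 m / real m * sym_ind N d n) (nome t)\<bar> \<le> C / t ^ k"
        using lambert_decay[OF poly_growth_ccos_sym[of N 1 d]] by blast
      obtain C where C: "\<forall>t>0. \<bar>lambert (\<lambda>m n. ccos N 1 m / real m * sym_ind N d n) (nome t)\<bar> \<le> C / t ^ p"
        using p[OF order_refl] by blast
      have "((\<lambda>t. t * (C * ((real N)\<^sup>2 * t) ^ p)) \<longlongrightarrow> 0 * (C * ((real N)\<^sup>2 * 0) ^ p)) (at_right 0)"
        by (intro tendsto_intros)
      then have "((\<lambda>t. t * (C * ((real N)\<^sup>2 * t) ^ p)) \<longlongrightarrow> 0) (at_right 0)" by simp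
      then show ?thesis
      proof (rule Lim_null_comparison[rotated])
        show "eventually (\<lambda>t. norm (t * ?R t) \<le> t * (C * ((real N)\<^sup>2 * t) ^ p)) (at_right 0)"
          unfolding eventually_at_right_field
        proof (intro exI[of _ 1] conjI allI impI)
          fix t :: real assume t: "0 < t"
          then have "1 / ((real N)\<^sup>2 * t) > 0" using N by simp
          then have "\<bar>?R t\<bar> \<le> C / (1 / ((real N)\<^sup>2 * t)) ^ p" by (rule C[rule_format])
          also have "\<dots> = C * ((real N)\<^sup>2 * t) ^ p" by (simp add: power_divide)
          finally show "norm (t * ?R t) \<le> t * (C * ((real N)\<^sup>2 * t) ^ p)"
            using t by (simp add: abs_mult)
        qed simp
      qed
    qed
    have "((\<lambda>t. pi * B2 (of_int d / N) / N + t * ?R t - pi * N * B2 (of_int 1 / N) * t * t) \<longlongrightarrow>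
        pi * B2 (of_int d / N) / N + 0 - pi * N * B2 (of_int 1 / N) * 0 * 0) (at_right 0)"
      by (intro tendsto_intros R0)
    moreover have "eventually (\<lambda>t. pi * B2 (of_int d / N) / N + t * ?R t - pi * N * B2 (of_int 1 / N) * t * t = (\<Sum>m. f m t)) (at_right 0)"
      unfolding eventually_at_right_field
    proof (intro exI[of _ 1] conjI allI impI)
      fix t :: real assume t: "0 < t"
      have "t * (pi * N * B2 (of_int 1 / N) * t + ?L t) = t * (pi * B2 (of_int d / N) / (N * t) + ?R t)"
        using log_inversion[OF t] by simp
      then have "t * ?L t = pi * B2 (of_int d / N) / N + t * ?R t - pi * N * B2 (of_int 1 / N) * t * t"
        using t by (simp add: distrib_left mult_ac)
      then show "pi * B2 (of_int d / N) / N + t * ?R t - pi * N * B2 (of_int 1 / N) * t * t = (\<Sum>m. f m t)"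
        using sums_unique[OF sums[OF t]] by simp
    qed simp
    ultimately have "((\<lambda>t. \<Sum>m. f m t) \<longlongrightarrow>
        pi * B2 (of_int d / N) / N + 0 - pi * N * B2 (of_int 1 / N) * 0 * 0) (at_right 0)"
      by (rule Lim_transform_eventually)
    then show ?thesis by simp
  qed
  from tendsto_unique[OF trivial_limit_at_right_real this T]
  have "(\<Sum>m. ccos N d m / real m * (1 / (pi * real m * real N))) = pi * B2 (of_int d / N) / N" by simp
  then have "(\<lambda>m. ccos N d m / real m * (1 / (pi * real m * real N))) sums (pi * B2 (of_int d / N) / N)"
    using summable_norm_cancel[OF sm'] by (simp add: sums_iff)
  from has_sum_cmult_right[OF norm_summable_imp_has_sum[OF sm' this], of "pi * N"]
  have "((\<lambda>m. ccos N d m / real m ^ 2) has_sum (pi\<^sup>2 * B2 (of_int d / real N))) UNIV"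
    using N by (simp add: power2_eq_square mult_ac)
  also have "?this \<longleftrightarrow> ?thesis" by (rule has_sum_cong_neutral) (auto simp: not_le)
  finally show ?thesis .
qed

section \<open>Termwise integration\<close>

lemma has_sum_real_imp_abs_summable:
  fixes h :: "'k \<Rightarrow> real"
  assumes "(h has_sum s) K"
  shows "(\<lambda>k. norm (h k)) summable_on K"
proof -
  have "h summable_on K" using assms by (rule has_sum_imp_summable)
  then show ?thesis by (rule iffD1[OF summable_on_iff_abs_summable_on_real])
qed

lemma has_sum_times:
  fixes f g :: "_ \<Rightarrow> real"
  assumes f: "(f has_sum a) A" and g: "(g has_sum b) B"
  shows "((\<lambda>(x, y). f x * g y) has_sum (a * b)) (A \<times> B)"
proof -
  have f': "(\<lambda>x. \<bar>f x\<bar>) summable_on A" and g': "(\<lambda>x. \<bar>g x\<bar>) summable_on B"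
    using f g summable_on_iff_abs_summable_on_real[of f A] summable_on_iff_abs_summable_on_real[of g B]
    by (auto simp: summable_on_def)
  obtain G where G: "((\<lambda>x. \<bar>g x\<bar>) has_sum G) B" using g' summable_on_def by blast
  have "(\<lambda>(x, y). \<bar>f x\<bar> * \<bar>g y\<bar>) summable_on A \<times> B"
  proof (rule summable_on_SigmaI[where g = "\<lambda>x. \<bar>f x\<bar> * G"])
    show "((\<lambda>y. case (x, y) of (x, y) \<Rightarrow> \<bar>f x\<bar> * \<bar>g y\<bar>) has_sum \<bar>f x\<bar> * G) B" for x
      using has_sum_cmult_right[OF G] by simp
  qed (use summable_on_cmult_left[OF f', of G] in auto)
  then have "(\<lambda>(x, y). f x * g y) summable_on A \<times> B"
    by (subst summable_on_iff_abs_summable_on_real) (simp add: case_prod_unfold abs_mult)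
  then show ?thesis
  proof (rule has_sum_SigmaI[rotated 2])
    show "((\<lambda>y. case (x, y) of (x, y) \<Rightarrow> f x * g y) has_sum f x * b) B" for x
      using has_sum_cmult_right[OF g] by simp
    show "((\<lambda>x. f x * b) has_sum a * b) A" by (rule has_sum_cmult_left[OF f])
  qed
qed

lemma integrable_lebesgue_on_iff:
  fixes f :: "'a::euclidean_space \<Rightarrow> 'b::euclidean_space"
  assumes "S \<in> sets lebesgue"
  shows "integrable (lebesgue_on S) f \<longleftrightarrow> f absolutely_integrable_on S"
  unfolding set_integrable_def using assms by (subst integrable_restrict_space) auto

text \<open>The theorem on the integration of absolutely convergent series, for a countable index set without
  distinguished order, as is needed for the fourfold sum.\<close>

lemma has_sum_integral:
  fixes f :: "'k \<Rightarrow> 'a::euclidean_space \<Rightarrow> 'b::euclidean_space"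
  assumes S: "S \<in> sets lebesgue" and K: "countable K" "infinite K"
    and f: "\<And>k. k \<in> K \<Longrightarrow> f k absolutely_integrable_on S"
    and sm: "(\<lambda>k. integral S (\<lambda>t. norm (f k t))) summable_on K"
    and abs: "\<And>t. t \<in> S \<Longrightarrow> (\<lambda>k. norm (f k t)) summable_on K"
    and g: "\<And>t. t \<in> S \<Longrightarrow> ((\<lambda>k. f k t) has_sum g t) K"
  shows "g absolutely_integrable_on S" and "((\<lambda>k. integral S (f k)) has_sum integral S g) K"
proof -
  define e where "e = from_nat_into K"
  have e: "bij_betw e UNIV K" unfolding e_def by (rule bij_betw_from_nat_into[OF K])
  have eK: "e n \<in> K" for n using e by (auto simp: bij_betw_def)
  define h where "h = (\<lambda>n. f (e n))"
  let ?M = "lebesgue_on S"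
  have I: "integrable ?M (h n)" for n
    unfolding h_def integrable_lebesgue_on_iff[OF S] by (rule f[OF eK])
  have In: "integrable ?M (\<lambda>t. norm (h n t))" for n by (rule integrable_norm[OF I])
  have Leq: "integral\<^sup>L ?M (h n) = integral S (h n)" "integral\<^sup>L ?M (\<lambda>t. norm (h n t)) = integral S (\<lambda>t. norm (h n t))" for n
    by (rule lebesgue_integral_eq_integral[OF I S]) (rule lebesgue_integral_eq_integral[OF In S])
  have pt: "summable (\<lambda>n. norm (h n t))" if "t \<in> S" for t
  proof -
    have "(\<lambda>n. norm (f (e n) t)) summable_on UNIV"
      using abs[OF that] summable_on_reindex_bij_betw[OF e, of "\<lambda>k. norm (f k t)"] by simp
    then show ?thesis unfolding h_def by (rule summable_on_imp_summable)
  qed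
  have AE: "AE t in ?M. summable (\<lambda>n. norm (h n t))"
    by (rule AE_I2) (use pt S in \<open>auto simp: space_restrict_space\<close>)
  have sm1: "(\<lambda>n. integral S (\<lambda>t. norm (h n t))) summable_on UNIV"
    using sm summable_on_reindex_bij_betw[OF e, of "\<lambda>k. integral S (\<lambda>t. norm (f k t))"] by (simp add: h_def)
  have sm2: "summable (\<lambda>n. integral\<^sup>L ?M (\<lambda>t. norm (h n t)))"
    unfolding Leq by (rule summable_on_imp_summable[OF sm1])
  have gs: "(\<Sum>n. h n t) = g t" if "t \<in> S" for t
  proof -
    have "((\<lambda>n. f (e n) t) has_sum g t) UNIV"
      using g[OF that] has_sum_reindex_bij_betw[OF e, of "\<lambda>k. f k t"] by simp
    then show ?thesis unfolding h_def by (rule sums_unique[OF has_sum_imp_sums, symmetric])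
  qed
  have "integrable ?M (\<lambda>t. \<Sum>n. h n t)" by (rule integrable_suminf[OF I AE sm2])
  also have "?this \<longleftrightarrow> integrable ?M g"
    by (rule Bochner_Integration.integrable_cong) (use gs S in \<open>auto simp: space_restrict_space\<close>)
  finally have Ig: "integrable ?M g" .
  then show "g absolutely_integrable_on S" by (simp add: integrable_lebesgue_on_iff[OF S])
  have "(\<lambda>n. integral\<^sup>L ?M (h n)) sums (\<integral>t. (\<Sum>n. h n t) \<partial>?M)" by (rule sums_integral[OF I AE sm2])
  also have "(\<integral>t. (\<Sum>n. h n t) \<partial>?M) = integral\<^sup>L ?M g"
    by (rule Bochner_Integration.integral_cong) (use gs S in \<open>auto simp: space_restrict_space\<close>)
  also have "\<dots> = integral S g" by (rule lebesgue_integral_eq_integral[OF Ig S])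
  finally have sums: "(\<lambda>n. integral S (h n)) sums integral S g" unfolding Leq .
  have "summable (\<lambda>n. norm (integral S (h n)))"
  proof (rule summable_comparison_test'[OF summable_on_imp_summable[OF sm1]])
    fix n
    have "norm (integral\<^sup>L ?M (h n)) \<le> integral\<^sup>L ?M (\<lambda>t. norm (h n t))" by (rule integral_norm_bound)
    then show "norm (norm (integral S (h n))) \<le> integral S (\<lambda>t. norm (h n t))" unfolding Leq by simp
  qed
  from norm_summable_imp_has_sum[OF this sums]
  have "((\<lambda>n. integral S (f (e n))) has_sum integral S g) UNIV" by (simp add: h_def)
  then show "((\<lambda>k. integral S (f k)) has_sum integral S g) K"
    using has_sum_reindex_bij_betw[OF e, of "\<lambda>k. integral S (f k)"] by simp
qed

subsection \<open>Integrals over the half-line\<close>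

lemma halfline_lebesgue: "{0<..} \<in> sets (lebesgue :: real measure)"
  by simp

lemma scale_halfline:
  fixes f :: "real \<Rightarrow> 'a::euclidean_space"
  assumes "k > 0"
  shows "(\<lambda>x. k *\<^sub>R f (k * x)) absolutely_integrable_on {0<..} \<and> integral {0<..} (\<lambda>x. k *\<^sub>R f (k * x)) = b
         \<longleftrightarrow> f absolutely_integrable_on {0<..} \<and> integral {0<..} f = b"
proof -
  have "(*) k ` {0<..} = {0<..}"
  proof (intro equalityI subsetI)
    fix x :: real assume "x \<in> {0<..}"
    then have "x = k * (x / k)" "x / k \<in> {0<..}" using assms by auto
    then show "x \<in> (*) k ` {0<..}" by blast
  qed (use assms in auto)
  moreover have "inj_on ((*) k) {0<..}" using assms by (auto simp: inj_on_def)
  moreover have "((*) k has_field_derivative k) (at x within {0<..})" for x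
    by (auto intro!: derivative_eq_intros)
  ultimately show ?thesis
    using has_absolute_integral_change_of_variables_real[OF halfline_lebesgue, of "(*) k" "\<lambda>_. k" f b] assms
    by (simp only: abs_of_pos)
qed

lemma invert_halfline:
  fixes f :: "real \<Rightarrow> 'a::euclidean_space"
  assumes "k > 0"
  shows "(\<lambda>x. (k / x\<^sup>2) *\<^sub>R f (k / x)) absolutely_integrable_on {0<..} \<and>
           integral {0<..} (\<lambda>x. (k / x\<^sup>2) *\<^sub>R f (k / x)) = b
         \<longleftrightarrow> f absolutely_integrable_on {0<..} \<and> integral {0<..} f = b"
proof -
  have img: "(\<lambda>x. k / x) ` {0<..} = {0<..}"
  proof (intro equalityI subsetI)
    fix x :: real assume "x \<in> {0<..}"
    then have "x = k / (k / x)" "k / x \<in> {0<..}" using assms by auto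
    then show "x \<in> (\<lambda>x. k / x) ` {0<..}" by blast
  qed (use assms in auto)
  have "(\<lambda>x. \<bar>- (k / x\<^sup>2)\<bar> *\<^sub>R f (k / x)) absolutely_integrable_on {0<..} \<and>
      integral {0<..} (\<lambda>x. \<bar>- (k / x\<^sup>2)\<bar> *\<^sub>R f (k / x)) = b
      \<longleftrightarrow> f absolutely_integrable_on (\<lambda>x. k / x) ` {0<..} \<and> integral ((\<lambda>x. k / x) ` {0<..}) f = b"
    by (rule has_absolute_integral_change_of_variables_real[OF halfline_lebesgue])
       (use assms in \<open>auto intro!: derivative_eq_intros inj_onI simp: power2_eq_square field_simps\<close>)
  then show ?thesis using assms unfolding img by (simp add: abs_of_pos)
qed

lemma Gamma_integral_scaled:
  assumes z: "Re z > 0" and a: "a > 0"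
  shows "(\<lambda>t. of_real t powr (z - 1) * of_real (exp (- (a * t)))) absolutely_integrable_on {0<..}"
    and "integral {0<..} (\<lambda>t. of_real t powr (z - 1) * of_real (exp (- (a * t)))) = Gamma z / of_real a powr z"
proof -
  let ?f = "\<lambda>t. of_real t powr (z - 1) / of_real (exp t) :: complex"
  have "?f absolutely_integrable_on {0<..} \<and> integral {0<..} ?f = Gamma z"
    using absolutely_integrable_Gamma_integral'[OF z] integral_unique[OF Gamma_integral_complex'[OF z]] by simp
  then have *: "(\<lambda>x. a *\<^sub>R ?f (a * x)) absolutely_integrable_on {0<..}"
    "integral {0<..} (\<lambda>x. a *\<^sub>R ?f (a * x)) = Gamma z"
    using scale_halfline[OF a, of ?f "Gamma z"] by blast+
  have eq: "of_real t powr (z - 1) * of_real (exp (- (a * t))) = (1 / of_real a powr z) * (a *\<^sub>R ?f (a * t))"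
    if "t \<in> {0<..}" for t
  proof -
    have "(of_real (a * t) :: complex) powr (z - 1) = of_real a powr (z - 1) * of_real t powr (z - 1)"
      using that a by (simp add: powr_times_real)
    moreover have "(of_real a :: complex) powr z = of_real a * of_real a powr (z - 1)"
      using a by (simp add: powr_diff)
    ultimately show ?thesis using a by (simp add: exp_minus scaleR_conv_of_real field_simps)
  qed
  have "(\<lambda>t. (1 / of_real a powr z) * (a *\<^sub>R ?f (a * t))) absolutely_integrable_on {0<..}"
    by (rule set_integrable_mult_right) (rule *(1))
  then show "(\<lambda>t. of_real t powr (z - 1) * of_real (exp (- (a * t)))) absolutely_integrable_on {0<..}"
    by (rule absolutely_integrable_spike[OF _ negligible_empty]) (use eq in auto)
  have "integral {0<..} (\<lambda>t. of_real t powr (z - 1) * of_real (exp (- (a * t)))) =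
      integral {0<..} (\<lambda>t. (1 / of_real a powr z) * (a *\<^sub>R ?f (a * t)))"
    by (rule integral_cong[OF eq])
  also have "\<dots> = (1 / of_real a powr z) * Gamma z"
    unfolding integral_mult_right using *(2) by simp
  finally show "integral {0<..} (\<lambda>t. of_real t powr (z - 1) * of_real (exp (- (a * t)))) = Gamma z / of_real a powr z"
    by simp
qed

lemma exp_moment:
  fixes a :: real
  assumes a: "a > 0"
  shows "(\<lambda>t. t ^ k * exp (- (a * t))) absolutely_integrable_on {0<..}"
    and "integral {0<..} (\<lambda>t. t ^ k * exp (- (a * t))) = fact k / a ^ Suc k"
proof -
  let ?f = "\<lambda>t. of_real t powr (of_nat (Suc k) - 1) * of_real (exp (- (a * t))) :: complex"
  have eq: "t ^ k * exp (- (a * t)) = Re (?f t)" if "t \<in> {0<..}" for t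
    using that by (simp add: powr_nat of_real_power[symmetric] del: of_real_power)
  have z: "Re (of_nat (Suc k)) > 0" by simp
  note G = Gamma_integral_scaled[OF z a]
  have "(Re \<circ> ?f) absolutely_integrable_on {0<..}"
    by (rule absolutely_integrable_linear[OF G(1) bounded_linear_Re])
  then show "(\<lambda>t. t ^ k * exp (- (a * t))) absolutely_integrable_on {0<..}"
    by (rule absolutely_integrable_spike[OF _ negligible_empty]) (use eq in auto)
  have "integral {0<..} (\<lambda>t. t ^ k * exp (- (a * t))) = integral {0<..} (Re \<circ> ?f)"
    by (rule integral_cong) (use eq in auto)
  also have "\<dots> = Re (Gamma (of_nat (Suc k)) / of_real a powr (of_nat (Suc k)))"
    using integral_linear[OF set_lebesgue_integral_eq_integral(1)[OF G(1)] bounded_linear_Re] G(2) by simp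
  also have "(of_real a :: complex) powr (of_nat (Suc k)) = of_real (a ^ Suc k)"
    using a by (subst powr_nat) auto
  also have "Gamma (of_nat (Suc k)) = (of_real (fact k) :: complex)"
    using Gamma_fact[of k, where 'a = complex] by simp
  finally show "integral {0<..} (\<lambda>t. t ^ k * exp (- (a * t))) = fact k / a ^ Suc k"
    by (simp flip: of_real_divide)
qed

lemma abs_integrable_bound:
  fixes f :: "real \<Rightarrow> 'a::euclidean_space"
  assumes "continuous_on {0<..} f" "g absolutely_integrable_on {0<..}" "\<And>t. t > 0 \<Longrightarrow> norm (f t) \<le> g t"
  shows "f absolutely_integrable_on {0<..}" "integral {0<..} (\<lambda>t. norm (f t)) \<le> integral {0<..} g"
proof -
  have g: "g integrable_on {0<..}" using assms(2) by (rule set_lebesgue_integral_eq_integral(1))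
  show f: "f absolutely_integrable_on {0<..}"
    by (rule measurable_bounded_by_integrable_imp_absolutely_integrable[OF _ halfline_lebesgue g])
       (use assms in \<open>auto intro: continuous_imp_measurable_on_sets_lebesgue\<close>)
  show "integral {0<..} (\<lambda>t. norm (f t)) \<le> integral {0<..} g"
    by (rule integral_le[OF _ g]) (use f assms in \<open>auto simp: absolutely_integrable_on_def\<close>)
qed

subsection \<open>The Rogers--Zudilin substitution\<close>

text \<open>Half of the exponent \<open>2 \<pi> x u\<close> pays for the integrable factor \<open>exp (- u)\<close>. The other half and the
  second exponential contribute \<open>(x u)^(-2)\<close> and \<open>(y r / u)^(-2)\<close>, in whose product \<open>u\<close> cancels.\<close>

lemma two_sided_exp_bound:
  fixes x y u r :: real
  assumes "x \<ge> 1" "y \<ge> 1" "u > 0" "r > 0"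
  shows "exp (- (2 * pi * (x * u))) * exp (- (2 * pi * (y * (r / u)))) \<le> 1 / r\<^sup>2 * (1 / (x * y)\<^sup>2) * exp (- u)"
proof -
  have 1: "exp (- v) \<le> 2 / v\<^sup>2" if "v > 0" for v :: real
    using power_le_fact_exp[of v 2] that by (simp add: exp_minus field_simps)
  have "u \<le> pi * (x * u)"
  proof -
    have "1 * u \<le> (pi * x) * u" using assms pi_gt3 by (intro mult_right_mono mult_ge1_I[of pi x, simplified]) auto
    then show ?thesis by (simp add: mult.assoc)
  qed
  then have e1: "exp (- (pi * (x * u))) \<le> exp (- u)" by simp
  have e2: "exp (- (pi * (x * u))) \<le> 2 / (x * u)\<^sup>2"
  proof -
    have "x * u \<le> pi * (x * u)" using assms pi_gt3 by simp
    then have "exp (- (pi * (x * u))) \<le> exp (- (x * u))" by simp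
    also have "\<dots> \<le> 2 / (x * u)\<^sup>2" using assms by (intro 1) simp
    finally show ?thesis .
  qed
  have e3: "exp (- (2 * pi * (y * (r / u)))) \<le> 1 / 2 * (1 / (y * (r / u))\<^sup>2)"
  proof -
    have "exp (- (2 * pi * (y * (r / u)))) \<le> 2 / (2 * pi * (y * (r / u)))\<^sup>2"
      using assms by (intro 1) simp
    also have "\<dots> \<le> 2 / (4 * (y * (r / u))\<^sup>2)"
    proof (rule divide_left_mono)
      have "2\<^sup>2 \<le> (2 * pi)\<^sup>2" using pi_gt3 by (intro power_mono) auto
      then show "4 * (y * (r / u))\<^sup>2 \<le> (2 * pi * (y * (r / u)))\<^sup>2"
        unfolding power_mult_distrib[of "2 * pi"] by (intro mult_right_mono) auto
    qed (use assms in auto)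
    finally show ?thesis by simp
  qed
  have "exp (- (2 * pi * (x * u))) = exp (- (pi * (x * u))) * exp (- (pi * (x * u)))"
    unfolding exp_add[symmetric] by simp
  then have "exp (- (2 * pi * (x * u))) * exp (- (2 * pi * (y * (r / u)))) \<le>
      (exp (- u) * (2 / (x * u)\<^sup>2)) * (1 / 2 * (1 / (y * (r / u))\<^sup>2))"
    using e1 e2 e3 by (simp only:) (intro mult_mono; simp)
  also have "\<dots> = 1 / r\<^sup>2 * (1 / (x * y)\<^sup>2) * exp (- u)"
    using assms by (simp add: field_simps power2_eq_square)
  finally show ?thesis .
qed

lemma nome_power: "nome t ^ (m * n) = exp (- (2 * pi * (real m * real n * t)))"
  by (simp add: exp_of_nat_mult[symmetric] mult_ac)

lemma inverse_square_summable_pairs: "(\<lambda>k. 1 / (real (fst k) * real (snd k))\<^sup>2) summable_on pairs"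
  using inverse_power_summable_pairs[of 2] by (simp add: case_prod_unfold)

text \<open>The exchange of the two summation variables by the substitution
  \<open>t = (m\<^sub>1 / n\<^sub>2) u\<close> in each term.\<close>

theorem rogers_zudilin:
  fixes \<phi>1 \<psi>1 \<phi>2 \<psi>2 :: "nat \<Rightarrow> real"
  assumes bd: "\<And>n. \<bar>\<phi>1 n\<bar> \<le> B" "\<And>n. \<bar>\<psi>1 n\<bar> \<le> B" "\<And>n. \<bar>\<phi>2 n\<bar> \<le> B" "\<And>n. \<bar>\<psi>2 n\<bar> \<le> B"
    and r: "r > 0"
  defines "F \<equiv> \<lambda>t. lambert (\<lambda>m n. \<phi>1 m / real m * \<psi>1 n) (nome (r / t)) * lambert (\<lambda>m n. \<phi>2 m * (real n * \<psi>2 n)) (nome t)"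
    and "G \<equiv> \<lambda>u. lambert (\<lambda>m n. \<phi>1 m * \<phi>2 n) (nome u) * lambert (\<lambda>m n. \<psi>1 m * \<psi>2 n) (nome (r / u))"
  shows "F absolutely_integrable_on {0<..}" "G absolutely_integrable_on {0<..}"
    "integral {0<..} F = integral {0<..} G"
proof -
  have B: "B \<ge> 0" using bd(1)[of 0] by linarith
  define K where "K = pairs \<times> pairs"
  have K: "countable K" "infinite K"
    unfolding K_def by (auto simp: finite_cartesian_product_iff infinite_Ici)
  define f where "f = (\<lambda>((m1, n1), (m2, n2)) t.
      (\<phi>1 m1 / real m1 * \<psi>1 n1 * nome (r / t) ^ (m1 * n1)) * (\<phi>2 m2 * (real n2 * \<psi>2 n2) * nome t ^ (m2 * n2)))"
  define g where "g = (\<lambda>((m1, n1), (m2, n2)) u.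
      (\<phi>1 m1 * \<phi>2 m2 * nome u ^ (m1 * m2)) * (\<psi>1 n1 * \<psi>2 n2 * nome (r / u) ^ (n1 * n2)))"
  define w where "w = (\<lambda>((m1, n1), (m2, n2)). (1 / (real m1 * real n1)\<^sup>2) * (1 / (real m2 * real n2)\<^sup>2))"
  define C where "C = B ^ 4 / r\<^sup>2"
  have C: "C \<ge> 0" using B by (simp add: C_def)
  have "((\<lambda>k. 1 / (real (fst k) * real (snd k))\<^sup>2) has_sum (\<Sum>\<^sub>\<infinity>k\<in>pairs. 1 / (real (fst k) * real (snd k))\<^sup>2)) pairs"
    by (rule has_sum_infsum[OF inverse_square_summable_pairs])
  from has_sum_times[OF this this] have w: "w summable_on K"
    unfolding w_def K_def summable_on_def by (auto simp: case_prod_unfold)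
  have g_bound: "norm (g k u) \<le> C * w k * exp (- u)" if k: "k \<in> K" and u: "u > 0" for k u
  proof -
    obtain m1 n1 m2 n2 where k': "k = ((m1, n1), (m2, n2))" by (metis surj_pair)
    have ge: "m1 \<ge> 1" "n1 \<ge> 1" "m2 \<ge> 1" "n2 \<ge> 1" using k by (auto simp: K_def k')
    have ge': "real m1 * real m2 \<ge> 1" "real n1 * real n2 \<ge> 1"
      using ge by (metis of_nat_1 of_nat_mono of_nat_mult mult_le_mono nat_mult_1)+
    have b1: "\<bar>\<phi>1 m1\<bar> * \<bar>\<phi>2 m2\<bar> * (\<bar>\<psi>1 n1\<bar> * \<bar>\<psi>2 n2\<bar>) \<le> B * B * (B * B)"
      using B by (intro mult_mono bd) auto
    have b2: "nome u ^ (m1 * m2) * nome (r / u) ^ (n1 * n2) \<le>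
        1 / r\<^sup>2 * (1 / (real m1 * real m2 * (real n1 * real n2))\<^sup>2) * exp (- u)"
      unfolding nome_power by (rule two_sided_exp_bound[OF ge' u r])
    have "(\<bar>\<phi>1 m1\<bar> * \<bar>\<phi>2 m2\<bar> * (\<bar>\<psi>1 n1\<bar> * \<bar>\<psi>2 n2\<bar>)) * (nome u ^ (m1 * m2) * nome (r / u) ^ (n1 * n2))
        \<le> (B * B * (B * B)) * (1 / r\<^sup>2 * (1 / (real m1 * real m2 * (real n1 * real n2))\<^sup>2) * exp (- u))"
      by (rule mult_mono[OF b1 b2]) (use B in auto)
    moreover have "norm (g k u) = (\<bar>\<phi>1 m1\<bar> * \<bar>\<phi>2 m2\<bar> * (\<bar>\<psi>1 n1\<bar> * \<bar>\<psi>2 n2\<bar>)) * (nome u ^ (m1 * m2) * nome (r / u) ^ (n1 * n2))"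
      by (simp add: g_def k' abs_mult)
    moreover have "(B * B * (B * B)) * (1 / r\<^sup>2 * (1 / (real m1 * real m2 * (real n1 * real n2))\<^sup>2) * exp (- u)) = C * w k * exp (- u)"
      by (simp add: C_def w_def k' power4_eq_xxxx power_mult_distrib mult_ac)
    ultimately show ?thesis by linarith
  qed
  have e0: "(\<lambda>u::real. exp (- u)) absolutely_integrable_on {0<..}" "integral {0<..} (\<lambda>u::real. exp (- u)) = 1"
    using exp_moment[of 1 0] by simp_all
  have gI: "g k absolutely_integrable_on {0<..}"
    and g_norm: "integral {0<..} (\<lambda>u. norm (g k u)) \<le> C * w k" if k: "k \<in> K" for k
  proof -
    have cont: "continuous_on {0<..} (g k)"
      unfolding g_def by (cases k) (auto intro!: continuous_intros simp: case_prod_unfold)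
    have "(\<lambda>u. C * w k * exp (- u)) absolutely_integrable_on {0<..}"
      by (rule set_integrable_mult_right) (rule e0(1))
    from abs_integrable_bound[OF cont this g_bound[OF k]]
    show "g k absolutely_integrable_on {0<..}" "integral {0<..} (\<lambda>u. norm (g k u)) \<le> C * w k"
      using e0(2) by simp_all
  qed
  have fg: "(real (fst (fst k)) / real (snd (snd k))) *\<^sub>R f k (real (fst (fst k)) / real (snd (snd k)) * u) = g k u"
    if k: "k \<in> K" and u: "u > 0" for k u
  proof -
    obtain m1 n1 m2 n2 where k': "k = ((m1, n1), (m2, n2))" by (metis surj_pair)
    have ge: "m1 \<ge> 1" "n1 \<ge> 1" "m2 \<ge> 1" "n2 \<ge> 1" using k by (auto simp: K_def k')
    have "real m1 * real n1 * (r / (real m1 / real n2 * u)) = real n1 * real n2 * (r / u)"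
      "real m2 * real n2 * (real m1 / real n2 * u) = real m1 * real m2 * u"
      using ge u by (simp_all add: field_simps)
    then have "nome (r / (real m1 / real n2 * u)) ^ (m1 * n1) = nome (r / u) ^ (n1 * n2)"
      "nome (real m1 / real n2 * u) ^ (m2 * n2) = nome u ^ (m1 * m2)"
      unfolding nome_power by simp_all
    then show ?thesis
      using ge unfolding k' f_def g_def by (simp add: field_simps)
  qed
  have fI: "f k absolutely_integrable_on {0<..}"
    and f_int: "integral {0<..} (f k) = integral {0<..} (g k)"
    and f_norm: "integral {0<..} (\<lambda>t. norm (f k t)) = integral {0<..} (\<lambda>t. norm (g k t))" if k: "k \<in> K" for k
  proof -
    define \<alpha> where "\<alpha> = real (fst (fst k)) / real (snd (snd k))"
    have \<alpha>: "\<alpha> > 0" using k by (auto simp: \<alpha>_def K_def)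
    have eq: "\<alpha> *\<^sub>R f k (\<alpha> * u) = g k u" if "u > 0" for u
      unfolding \<alpha>_def by (rule fg[OF k that])
    have "(\<lambda>u. \<alpha> *\<^sub>R f k (\<alpha> * u)) absolutely_integrable_on {0<..}"
      by (rule absolutely_integrable_spike[OF gI[OF k] negligible_empty]) (use eq in auto)
    moreover have "integral {0<..} (\<lambda>u. \<alpha> *\<^sub>R f k (\<alpha> * u)) = integral {0<..} (g k)"
      by (rule integral_cong) (use eq in auto)
    ultimately show fI: "f k absolutely_integrable_on {0<..}" and "integral {0<..} (f k) = integral {0<..} (g k)"
      using scale_halfline[OF \<alpha>, of "f k" "integral {0<..} (g k)"] by blast+
    have "(\<lambda>t. norm (f k t)) absolutely_integrable_on {0<..}"
      using fI by (rule absolutely_integrable_norm[unfolded o_def])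
    with scale_halfline[OF \<alpha>, of "\<lambda>t. norm (f k t)" "integral {0<..} (\<lambda>t. norm (f k t))"]
    have "integral {0<..} (\<lambda>u. \<alpha> *\<^sub>R norm (f k (\<alpha> * u))) = integral {0<..} (\<lambda>t. norm (f k t))" by blast
    moreover have "integral {0<..} (\<lambda>u. \<alpha> *\<^sub>R norm (f k (\<alpha> * u))) = integral {0<..} (\<lambda>t. norm (g k t))"
    proof (rule integral_cong)
      fix u :: real assume "u \<in> {0<..}"
      then show "\<alpha> *\<^sub>R norm (f k (\<alpha> * u)) = norm (g k u)"
        using eq[of u, symmetric] \<alpha> by (simp add: abs_mult)
    qed
    ultimately show "integral {0<..} (\<lambda>t. norm (f k t)) = integral {0<..} (\<lambda>t. norm (g k t))" by simp
  qed
  have gsm: "(\<lambda>k. integral {0<..} (\<lambda>u. norm (g k u))) summable_on K"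
  proof (rule summable_on_comparison_test[OF summable_on_cmult_right[OF w, of C] g_norm])
    fix k assume "k \<in> K"
    then show "0 \<le> integral {0<..} (\<lambda>u. norm (g k u))"
      by (intro integral_nonneg) (use gI in \<open>auto simp: absolutely_integrable_on_def\<close>)
  qed
  then have fsm: "(\<lambda>k. integral {0<..} (\<lambda>u. norm (f k u))) summable_on K"
    by (rule iffD1[OF summable_on_cong, rotated]) (use f_norm in simp)
  have pg: "poly_growth (\<lambda>m n. \<phi>1 m / real m * \<psi>1 n)" "poly_growth (\<lambda>m n. \<phi>2 m * (real n * \<psi>2 n))"
    "poly_growth (\<lambda>m n. \<phi>1 m * \<phi>2 n)" "poly_growth (\<lambda>m n. \<psi>1 m * \<psi>2 n)"
  proof -
    have 1: "poly_growth (\<lambda>m n. c m)" "poly_growth (\<lambda>m n. c n)" if "\<And>n. \<bar>c n\<bar> \<le> B" for c :: "nat \<Rightarrow> real"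
      using that by (auto intro: poly_growth_bounded[of _ B])
    have 2: "poly_growth (\<lambda>m n. real n)"
    proof (rule poly_growthI[of _ 1 1])
      fix m n :: nat assume "m \<ge> 1"
      then have "1 * real n \<le> real m * real n" by (intro mult_right_mono) auto
      then show "norm (real n) \<le> 1 * real (m * n) ^ 1" by simp
    qed
    have 3: "poly_growth (\<lambda>m n. 1 / real m)" by (rule poly_growth_bounded[of _ 1]) simp
    show "poly_growth (\<lambda>m n. \<phi>1 m / real m * \<psi>1 n)"
      using poly_growth_mult[OF poly_growth_mult[OF 1(1)[OF bd(1)] 3] 1(2)[OF bd(2)]] by simp
    show "poly_growth (\<lambda>m n. \<phi>2 m * (real n * \<psi>2 n))"
      by (intro poly_growth_mult 1 2 bd)
    show "poly_growth (\<lambda>m n. \<phi>1 m * \<phi>2 n)" "poly_growth (\<lambda>m n. \<psi>1 m * \<psi>2 n)"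
      by (intro poly_growth_mult 1 bd)+
  qed
  have F: "((\<lambda>k. f k t) has_sum F t) K" if t: "t > 0" for t
  proof -
    have "\<bar>nome (r / t)\<bar> < 1" "\<bar>nome t\<bar> < 1" using t r by simp_all
    then show ?thesis
      using has_sum_times[OF lambert_has_sum[OF pg(1)] lambert_has_sum[OF pg(2)], of "nome (r / t)" "nome t"]
      unfolding F_def f_def K_def by (simp add: case_prod_unfold)
  qed
  have G: "((\<lambda>k. g k u) has_sum G u) K" if u: "u > 0" for u
  proof -
    have "\<bar>nome (r / u)\<bar> < 1" "\<bar>nome u\<bar> < 1" using u r by simp_all
    then have "((\<lambda>((m1, m2), (n1, n2)). (\<phi>1 m1 * \<phi>2 m2 * nome u ^ (m1 * m2)) * (\<psi>1 n1 * \<psi>2 n2 * nome (r / u) ^ (n1 * n2)))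
        has_sum G u) (pairs \<times> pairs)"
      using has_sum_times[OF lambert_has_sum[OF pg(3)] lambert_has_sum[OF pg(4)], of "nome u" "nome (r / u)"]
      unfolding G_def by (simp add: case_prod_unfold)
    also have "?this \<longleftrightarrow> ((\<lambda>k. g k u) has_sum G u) K"
      unfolding K_def g_def
      by (rule has_sum_reindex_bij_witness[of _ "\<lambda>((a, b), (c, d)). ((a, c), (b, d))" "\<lambda>((a, b), (c, d)). ((a, c), (b, d))"]) auto
    finally show ?thesis .
  qed
  have Fi: "F absolutely_integrable_on {0<..}" "((\<lambda>k. integral {0<..} (f k)) has_sum integral {0<..} F) K"
    by (rule has_sum_integral[OF halfline_lebesgue K fI fsm]; use F has_sum_real_imp_abs_summable[OF F] in auto)+
  have Gi: "G absolutely_integrable_on {0<..}" "((\<lambda>k. integral {0<..} (g k)) has_sum integral {0<..} G) K"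
    by (rule has_sum_integral[OF halfline_lebesgue K gI gsm]; use G has_sum_real_imp_abs_summable[OF G] in auto)+
  show "F absolutely_integrable_on {0<..}" "G absolutely_integrable_on {0<..}" by (rule Fi(1), rule Gi(1))
  have "((\<lambda>k. integral {0<..} (f k)) has_sum integral {0<..} G) K"
    using Gi(2) by (rule iffD1[OF has_sum_cong, rotated]) (simp add: f_int)
  then show "integral {0<..} F = integral {0<..} G" using Fi(2) has_sum_unique by blast
qed

subsection \<open>First moments of Lambert series\<close>

text \<open>As \<open>u exp (- 2 \<pi> m n u)\<close> has the integral \<open>1 / (2 \<pi> m n)\<^sup>2\<close>, the double series of the moments is a
  product of two series.\<close>

theorem lambert_first_moment:
  fixes \<phi> \<psi> :: "nat \<Rightarrow> real"
  assumes bd: "\<And>n. \<bar>\<phi> n\<bar> \<le> B" "\<And>n. \<bar>\<psi> n\<bar> \<le> B"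
    and a: "((\<lambda>m. \<phi> m / real m ^ 2) has_sum a) {1..}" and b: "((\<lambda>n. \<psi> n / real n ^ 2) has_sum b) {1..}"
  defines "F \<equiv> \<lambda>u. u * lambert (\<lambda>m n. \<phi> m * \<psi> n) (nome u)"
  shows "F absolutely_integrable_on {0<..}" "integral {0<..} F = a * b / (4 * pi\<^sup>2)"
proof -
  have B: "B \<ge> 0" using bd(1)[of 0] by linarith
  define f where "f = (\<lambda>(m, n) u. (\<phi> m * \<psi> n) * (u ^ 1 * exp (- (2 * pi * (real m * real n) * u))))"
  define w where "w = (\<lambda>(m, n). 1 / (2 * pi * (real m * real n)) ^ Suc 1)"
  have K: "countable pairs" "infinite pairs"
    by (auto simp: finite_cartesian_product_iff infinite_Ici)
  have mom: "(\<lambda>u. u ^ 1 * exp (- (2 * pi * (real m * real n) * u))) absolutely_integrable_on {0<..}"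
    "integral {0<..} (\<lambda>u. u ^ 1 * exp (- (2 * pi * (real m * real n) * u))) = w (m, n)"
    if "(m, n) \<in> pairs" for m n
    using exp_moment[of "2 * pi * (real m * real n)" 1] that by (auto simp: w_def)
  have fI: "f k absolutely_integrable_on {0<..}" and f_int: "integral {0<..} (f k) = \<phi> (fst k) * \<psi> (snd k) * w k"
    and f_norm: "integral {0<..} (\<lambda>u. norm (f k u)) = \<bar>\<phi> (fst k) * \<psi> (snd k)\<bar> * w k" if k: "k \<in> pairs" for k
  proof -
    obtain m n where mn: "k = (m, n)" "(m, n) \<in> pairs" using k by (cases k) auto
    show "f k absolutely_integrable_on {0<..}"
      unfolding mn f_def prod.case by (rule set_integrable_mult_right) (rule mom(1)[OF mn(2)])
    show "integral {0<..} (f k) = \<phi> (fst k) * \<psi> (snd k) * w k"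
      unfolding mn f_def prod.case integral_mult_right mom(2)[OF mn(2)] by simp
    have "integral {0<..} (\<lambda>u. norm (f k u)) =
        integral {0<..} (\<lambda>u. \<bar>\<phi> m * \<psi> n\<bar> * (u ^ 1 * exp (- (2 * pi * (real m * real n) * u))))"
      by (rule integral_cong) (simp add: f_def mn abs_mult)
    then show "integral {0<..} (\<lambda>u. norm (f k u)) = \<bar>\<phi> (fst k) * \<psi> (snd k)\<bar> * w k"
      unfolding integral_mult_right mom(2)[OF mn(2)] by (simp add: mn)
  qed
  have w_eq: "w k = 1 / (4 * pi\<^sup>2) * (1 / (real (fst k) * real (snd k))\<^sup>2)" for k
    by (cases k) (simp add: w_def power2_eq_square)
  have sm: "(\<lambda>k. integral {0<..} (\<lambda>u. norm (f k u))) summable_on pairs"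
  proof (rule summable_on_comparison_test)
    show "(\<lambda>k. B * B * (1 / (4 * pi\<^sup>2)) * (1 / (real (fst k) * real (snd k))\<^sup>2)) summable_on pairs"
      by (rule summable_on_cmult_right[OF inverse_square_summable_pairs])
    fix k assume k: "k \<in> pairs"
    have "\<bar>\<phi> (fst k) * \<psi> (snd k)\<bar> \<le> B * B"
      unfolding abs_mult using B by (intro mult_mono bd) auto
    then have "\<bar>\<phi> (fst k) * \<psi> (snd k)\<bar> * w k \<le> B * B * w k"
      by (rule mult_right_mono) (simp add: w_eq)
    then show "integral {0<..} (\<lambda>u. norm (f k u)) \<le> B * B * (1 / (4 * pi\<^sup>2)) * (1 / (real (fst k) * real (snd k))\<^sup>2)"
      unfolding f_norm[OF k] by (simp add: w_eq)
    show "0 \<le> integral {0<..} (\<lambda>u. norm (f k u))"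
      unfolding f_norm[OF k] by (simp add: w_eq)
  qed
  have pg: "poly_growth (\<lambda>m n. \<phi> m * \<psi> n)"
  proof (rule poly_growth_bounded)
    show "norm (\<phi> m * \<psi> n) \<le> B * B" for m n
      unfolding real_norm_def abs_mult using B by (intro mult_mono bd) auto
  qed
  have F: "((\<lambda>k. f k u) has_sum F u) pairs" if u: "u \<in> {0<..}" for u
  proof -
    have "\<bar>nome u\<bar> < 1" using u by simp
    then have "((\<lambda>x. u * (case x of (m, n) \<Rightarrow> \<phi> m * \<psi> n * nome u ^ (m * n))) has_sum F u) pairs"
      unfolding F_def by (intro has_sum_cmult_right lambert_has_sum pg) simp
    moreover have "u * (\<phi> m * \<psi> n * nome u ^ (m * n)) = f (m, n) u" for m n
      unfolding f_def prod.case nome_power by (simp add: mult_ac)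
    ultimately show ?thesis by (simp add: case_prod_unfold)
  qed
  have abs: "(\<lambda>k. norm (f k u)) summable_on pairs" if u: "u \<in> {0<..}" for u
    by (rule has_sum_real_imp_abs_summable[OF F[OF u]])
  show "F absolutely_integrable_on {0<..}"
    by (rule has_sum_integral(1)[OF halfline_lebesgue K fI sm abs F])
  have "((\<lambda>k. integral {0<..} (f k)) has_sum integral {0<..} F) pairs"
    by (rule has_sum_integral(2)[OF halfline_lebesgue K fI sm abs F])
  moreover have "((\<lambda>k. integral {0<..} (f k)) has_sum (1 / (4 * pi\<^sup>2) * (a * b))) pairs"
  proof -
    have "((\<lambda>x. 1 / (4 * pi\<^sup>2) * (case x of (m, n) \<Rightarrow> \<phi> m / real m ^ 2 * (\<psi> n / real n ^ 2))) has_sum (1 / (4 * pi\<^sup>2) * (a * b))) pairs"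
      by (intro has_sum_cmult_right has_sum_times a b)
    moreover have "1 / (4 * pi\<^sup>2) * (\<phi> m / real m ^ 2 * (\<psi> n / real n ^ 2)) = \<phi> m * \<psi> n * w (m, n)" for m n
      by (simp add: w_eq power_mult_distrib)
    ultimately have "((\<lambda>k. \<phi> (fst k) * \<psi> (snd k) * w k) has_sum (1 / (4 * pi\<^sup>2) * (a * b))) pairs"
      by (simp add: case_prod_unfold)
    then show ?thesis
      by (rule iffD1[OF has_sum_cong, rotated]) (simp only: f_int)
  qed
  ultimately have "integral {0<..} F = 1 / (4 * pi\<^sup>2) * (a * b)" by (rule has_sum_unique)
  then show "integral {0<..} F = a * b / (4 * pi\<^sup>2)" by simp
qed

lemma has_sum_real_diff:
  fixes f g :: "'k \<Rightarrow> real"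
  assumes "(f has_sum a) A" "(g has_sum b) A"
  shows "((\<lambda>x. f x - g x) has_sum (a - b)) A"
  using has_sum_add[OF assms(1) has_sum_cmult_right[OF assms(2), of "-1"]] by simp

text \<open>The point is the factor \<open>|a - b|\<close>: below, \<open>a\<close> and \<open>b\<close> run through two arithmetic progressions with
  bounded difference, and the bound is then one order better than for each term alone.\<close>

lemma weighted_exp_difference:
  fixes y :: real
  assumes "0 \<le> y" "0 \<le> \<nu>" "\<nu> \<le> a" "\<nu> \<le> b" "a \<le> M" "b \<le> M"
  shows "\<bar>a * exp (- (a * y)) - b * exp (- (b * y))\<bar> \<le> \<bar>a - b\<bar> * (1 + M * y) * exp (- (\<nu> * y))"
proof -
  have e1: "exp (- (a * y)) \<le> exp (- (\<nu> * y))" if "\<nu> \<le> a" for a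
    unfolding exp_le_cancel_iff neg_le_iff_le by (rule mult_right_mono[OF that assms(1)])
  have ord: "\<bar>exp (- (a * y)) - exp (- (b * y))\<bar> \<le> \<bar>a - b\<bar> * y * exp (- (\<nu> * y))"
    if "\<nu> \<le> a" "a \<le> b" for a b
  proof -
    have "exp (- (a * y)) - exp (- (b * y)) = exp (- (a * y)) * (1 - exp (- ((b - a) * y)))"
      unfolding right_diff_distrib exp_add[symmetric] by (simp add: algebra_simps)
    moreover have "0 \<le> (b - a) * y" using that assms by simp
    then have "0 \<le> 1 - exp (- ((b - a) * y))" by simp
    moreover have "1 - exp (- ((b - a) * y)) \<le> (b - a) * y"
      using exp_ge_add_one_self[of "- ((b - a) * y)"] by linarith
    moreover have "exp (- (a * y)) * (1 - exp (- ((b - a) * y))) \<le> exp (- (\<nu> * y)) * ((b - a) * y)"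
      by (intro mult_mono e1 calculation that) auto
    ultimately show ?thesis using that by (simp add: abs_mult mult_ac)
  qed
  have diff: "\<bar>exp (- (a * y)) - exp (- (b * y))\<bar> \<le> \<bar>a - b\<bar> * y * exp (- (\<nu> * y))"
  proof (cases "a \<le> b")
    case True
    then show ?thesis using ord[of a b] assms by simp
  next
    case False
    then show ?thesis using ord[of b a] assms by (simp add: abs_minus_commute)
  qed
  have b0: "0 \<le> b" "0 \<le> M" using assms by linarith+
  have "a * exp (- (a * y)) - b * exp (- (b * y)) =
      (a - b) * exp (- (a * y)) + b * (exp (- (a * y)) - exp (- (b * y)))"
    by (simp add: algebra_simps)
  then have "\<bar>a * exp (- (a * y)) - b * exp (- (b * y))\<bar> \<le>
      \<bar>(a - b) * exp (- (a * y))\<bar> + \<bar>b * (exp (- (a * y)) - exp (- (b * y)))\<bar>"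
    by (simp only: abs_triangle_ineq)
  also have "\<dots> = \<bar>a - b\<bar> * exp (- (a * y)) + b * \<bar>exp (- (a * y)) - exp (- (b * y))\<bar>"
    using b0 by (simp add: abs_mult)
  also have "\<dots> \<le> \<bar>a - b\<bar> * exp (- (\<nu> * y)) + M * (\<bar>a - b\<bar> * y * exp (- (\<nu> * y)))"
    using assms b0 diff e1 by (intro add_mono mult_mono mult_left_mono) auto
  also have "\<dots> = \<bar>a - b\<bar> * (1 + M * y) * exp (- (\<nu> * y))" by (simp add: algebra_simps)
  finally show ?thesis .
qed

text \<open>The inner sum over \<open>n\<close> of a Lambert series with the coefficients \<open>\<phi> m * (real n * alt_ind N l n)\<close>, at \<open>x = m s\<close>.\<close>

definition alt_kernel :: "nat \<Rightarrow> nat \<Rightarrow> real \<Rightarrow> real" where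
  "alt_kernel N l x = (\<Sum>\<^sub>\<infinity>n\<in>{1..}. real n * alt_ind N (int l) n * nome x ^ n)"

lemma weighted_geometric_summable:
  assumes "x > 0" "\<And>n. \<bar>c n\<bar> \<le> B"
  shows "(\<lambda>n. real n * c n * nome x ^ n) summable_on {1..}"
proof -
  have "(\<lambda>n. B * 6 / x ^ 3 * (1 / real n ^ 2)) summable_on {1..}"
    by (rule summable_on_cmult_right[OF inverse_squares_summable(3)])
  then have "(\<lambda>n. norm (real n * c n * nome x ^ n)) summable_on {1..}"
  proof (rule summable_on_comparison_test)
    fix n :: nat assume n: "n \<in> {1..}"
    have "norm (real n * c n * nome x ^ n) = real n * (\<bar>c n\<bar> * nome x ^ n)"
      by (simp add: abs_mult)
    also have "\<dots> \<le> real n * (B * (fact 3 / x ^ 3 / real n ^ 3))"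
      using assms n order_trans[OF abs_ge_zero assms(2)]
      by (intro mult_left_mono mult_mono exp_power_decay) auto
    also have "\<dots> = B * 6 / x ^ 3 * (1 / real n ^ 2)"
      using n by (simp add: fact_numeral power2_eq_square power3_eq_cube)
    finally show "norm (real n * c n * nome x ^ n) \<le> B * 6 / x ^ 3 * (1 / real n ^ 2)" .
  qed auto
  then show ?thesis by (rule abs_summable_summable)
qed

lemma alt_kernel_has_sum:
  assumes "x > 0"
  shows "((\<lambda>n. real n * alt_ind N (int l) n * nome x ^ n) has_sum alt_kernel N l x) {1..}"
  unfolding alt_kernel_def
  by (rule has_sum_infsum[OF weighted_geometric_summable[OF assms abs_alt_ind_le]])

text \<open>The terms of a single residue class have moments of order \<open>1 / n\<close>, whose sum diverges. Pairing
  \<open>l + N j\<close> with \<open>N - l + N j\<close> gives an absolutely convergent series of moments.\<close>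

lemma alt_kernel_paired:
  assumes l: "1 \<le> l" "l < N" and x: "x > 0"
  shows "((\<lambda>j. real (l + N * j) * nome x ^ (l + N * j) - real (N - l + N * j) * nome x ^ (N - l + N * j))
           has_sum alt_kernel N l x) UNIV"
proof -
  have half: "\<exists>S. ((\<lambda>n. real n * residue_ind N (int k) n * nome x ^ n) has_sum S) {1..} \<and>
      ((\<lambda>j. real (k + N * j) * nome x ^ (k + N * j)) has_sum S) UNIV" if k: "1 \<le> k" "k \<le> N" for k
  proof -
    have "\<bar>residue_ind N (int k) n\<bar> \<le> (1::real)" for n by (simp add: residue_ind_def)
    from weighted_geometric_summable[OF x this]
    obtain S where S: "((\<lambda>n. real n * residue_ind N (int k) n * nome x ^ n) has_sum S) {1..}"
      unfolding summable_on_def by (rule exE)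
    have "((\<lambda>n. real n * residue_ind N (int k) n * nome x ^ n) has_sum S) {1..} \<longleftrightarrow>
        ((\<lambda>n. real n * nome x ^ n) has_sum S) {n. n \<ge> 1 \<and> [int n = int k] (mod int N)}"
      by (rule has_sum_cong_neutral) (auto simp: residue_ind_def split: if_splits)
    also have "\<dots> \<longleftrightarrow> ((\<lambda>j. real (k + N * j) * nome x ^ (k + N * j)) has_sum S) UNIV"
      by (rule has_sum_reindex_bij_betw[OF residue_class_bij[OF k], symmetric])
    finally show ?thesis using S by (intro exI[of _ S] conjI) simp_all
  qed
  obtain S where S: "((\<lambda>n. real n * residue_ind N (int l) n * nome x ^ n) has_sum S) {1..}"
    "((\<lambda>j. real (l + N * j) * nome x ^ (l + N * j)) has_sum S) UNIV"
    using half[of l] l by auto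
  obtain T where T: "((\<lambda>n. real n * residue_ind N (- int l) n * nome x ^ n) has_sum T) {1..}"
    "((\<lambda>j. real (N - l + N * j) * nome x ^ (N - l + N * j)) has_sum T) UNIV"
  proof -
    have "1 \<le> N - l" "N - l \<le> N" using l by auto
    from half[OF this, unfolded residue_ind_complement[OF less_imp_le[OF l(2)]]]
    show ?thesis by (elim exE conjE) (rule that)
  qed
  have "((\<lambda>n. real n * residue_ind N (int l) n * nome x ^ n - real n * residue_ind N (- int l) n * nome x ^ n)
      has_sum (S - T)) {1..}"
    by (rule has_sum_real_diff[OF S(1) T(1)])
  then have "((\<lambda>n. real n * alt_ind N (int l) n * nome x ^ n) has_sum (S - T)) {1..}"
    by (simp add: alt_ind_def algebra_simps)
  then have "alt_kernel N l x = S - T" using alt_kernel_has_sum[OF x] has_sum_unique by blast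
  then show ?thesis using has_sum_real_diff[OF S(2) T(2)] by simp
qed

lemma alt_kernel_moment:
  assumes l: "1 \<le> l" "l < N"
  shows "(\<lambda>x. x * alt_kernel N l x) absolutely_integrable_on {0<..}"
    and "integral {0<..} (\<lambda>x. x * alt_kernel N l x) = cot (pi * l / N) / (4 * pi * N)"
proof -
  define c where "c = 2 * pi"
  have c: "c > 0" by (simp add: c_def)
  define n1 where "n1 = (\<lambda>j. real (l + N * j))"
  define n2 where "n2 = (\<lambda>j. real (N - l + N * j))"
  define f where "f = (\<lambda>j x. n1 j * (x ^ 1 * exp (- (c * n1 j * x))) - n2 j * (x ^ 1 * exp (- (c * n2 j * x))))"
  have n_pos: "n1 j > 0" "n2 j > 0" for j
    unfolding n1_def n2_def of_nat_0_less_iff using l by auto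
  note mom1 = exp_moment[OF mult_pos_pos[OF c n_pos(1)], of 1] and mom2 = exp_moment[OF mult_pos_pos[OF c n_pos(2)], of 1]
  have fI: "f j absolutely_integrable_on {0<..}" for j
    unfolding f_def by (intro set_integral_diff set_integrable_mult_right mom1 mom2)
  have f_int: "integral {0<..} (f j) = 1 / (c\<^sup>2 * N) * (1 / (l / N + real j) - 1 / (1 - l / N + real j))" for j
  proof -
    have I1: "(\<lambda>x. n1 j * (x ^ 1 * exp (- (c * n1 j * x)))) integrable_on {0<..}"
      and I2: "(\<lambda>x. n2 j * (x ^ 1 * exp (- (c * n2 j * x)))) integrable_on {0<..}"
      by (intro set_lebesgue_integral_eq_integral(1) set_integrable_mult_right mom1 mom2)+
    have "integral {0<..} (f j) = n1 j * (fact 1 / (c * n1 j) ^ Suc 1) - n2 j * (fact 1 / (c * n2 j) ^ Suc 1)"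
      unfolding f_def integral_diff[OF I1 I2] integral_mult_right mom1(2) mom2(2) ..
    also have "\<dots> = 1 / (c\<^sup>2 * n1 j) - 1 / (c\<^sup>2 * n2 j)"
      using n_pos[of j] c by (simp add: power2_eq_square field_simps)
    also have "\<dots> = 1 / (c\<^sup>2 * N) * (1 / (l / N + real j) - 1 / (1 - l / N + real j))"
    proof -
      have "n1 j = N * (l / N + real j)" "n2 j = N * (1 - l / N + real j)"
        using l by (auto simp: n1_def n2_def field_simps of_nat_diff)
      then show ?thesis by (simp add: right_diff_distrib)
    qed
    finally show ?thesis .
  qed
  \<comment> \<open>Both \<open>n1 j\<close> and \<open>n2 j\<close> lie between \<open>j + 1\<close> and \<open>N (j + 1)\<close>, and they differ by at most \<open>N\<close>, so
    \<open>weighted_exp_difference\<close> bounds \<open>f j\<close> by \<open>D j\<close>, whose integral is of order \<open>1 / (j + 1)\<^sup>2\<close>.\<close>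
  define D where "D = (\<lambda>j x. N * (x ^ 1 * exp (- (c * real (Suc j) * x))) + N * (N * real (Suc j)) * c * (x ^ 2 * exp (- (c * real (Suc j) * x))))"
  have f_bound: "norm (f j x) \<le> D j x" if x: "x > 0" for j x
  proof -
    have n1: "real (Suc j) \<le> n1 j" "n1 j \<le> N * real (Suc j)" and n2: "real (Suc j) \<le> n2 j" "n2 j \<le> N * real (Suc j)"
    proof -
      have jN: "j \<le> N * j" using l by (cases N) auto
      then have "Suc j \<le> l + N * j" "Suc j \<le> N - l + N * j" "l + N * j \<le> N * Suc j" "N - l + N * j \<le> N * Suc j"
        unfolding mult_Suc_right using l jN by linarith+
      then show "real (Suc j) \<le> n1 j" "n1 j \<le> N * real (Suc j)" "real (Suc j) \<le> n2 j" "n2 j \<le> N * real (Suc j)"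
        unfolding n1_def n2_def of_nat_mult[symmetric] of_nat_le_iff by auto
    qed
    have nn: "\<bar>n1 j - n2 j\<bar> \<le> N" using l by (auto simp: n1_def n2_def of_nat_diff)
    have "\<bar>n1 j * exp (- (n1 j * (c * x))) - n2 j * exp (- (n2 j * (c * x)))\<bar> \<le>
        \<bar>n1 j - n2 j\<bar> * (1 + N * real (Suc j) * (c * x)) * exp (- (real (Suc j) * (c * x)))"
      by (rule weighted_exp_difference) (use n1 n2 c x in auto)
    also have "\<dots> \<le> N * (1 + N * real (Suc j) * (c * x)) * exp (- (real (Suc j) * (c * x)))"
      using nn c x by (intro mult_right_mono) auto
    finally have "x * \<bar>n1 j * exp (- (n1 j * (c * x))) - n2 j * exp (- (n2 j * (c * x)))\<bar> \<le>
        x * (N * (1 + N * real (Suc j) * (c * x)) * exp (- (real (Suc j) * (c * x))))"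
      using x by (intro mult_left_mono) auto
    moreover have "norm (f j x) = x * \<bar>n1 j * exp (- (n1 j * (c * x))) - n2 j * exp (- (n2 j * (c * x)))\<bar>"
    proof -
      have "f j x = x * (n1 j * exp (- (n1 j * (c * x))) - n2 j * exp (- (n2 j * (c * x))))"
        by (simp add: f_def algebra_simps)
      then show ?thesis using x by (simp add: abs_mult)
    qed
    moreover have "x * (N * (1 + N * real (Suc j) * (c * x)) * exp (- (real (Suc j) * (c * x)))) = D j x"
    proof -
      have "real (Suc j) * (c * x) = c * real (Suc j) * x" by simp
      then show ?thesis unfolding D_def by (simp only:) (simp add: power2_eq_square distrib_left distrib_right mult_ac del: of_nat_Suc)
    qed
    ultimately show ?thesis by simp
  qed
  have cs: "c * real (Suc j) > 0" for j using c by simp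
  note momS = exp_moment[OF cs]
  have DI: "D j absolutely_integrable_on {0<..}" for j
    unfolding D_def by (intro set_integral_add set_integrable_mult_right momS)
  have D_int: "integral {0<..} (D j) = N * (1 + 2 * N) / c\<^sup>2 * (1 / real (Suc j) ^ 2)" for j
  proof -
    have I1: "(\<lambda>x. N * (x ^ 1 * exp (- (c * real (Suc j) * x)))) integrable_on {0<..}"
      and I2: "(\<lambda>x. N * (N * real (Suc j)) * c * (x ^ 2 * exp (- (c * real (Suc j) * x)))) integrable_on {0<..}"
      by (intro set_lebesgue_integral_eq_integral(1) set_integrable_mult_right momS)+
    have "integral {0<..} (D j) = N * (fact 1 / (c * real (Suc j)) ^ Suc 1) +
        N * (N * real (Suc j)) * c * (fact 2 / (c * real (Suc j)) ^ Suc 2)"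
      unfolding D_def integral_add[OF I1 I2] integral_mult_right momS(2) ..
    also have "\<dots> = N * (1 + 2 * N) / c\<^sup>2 * (1 / real (Suc j) ^ 2)"
    proof -
      define s where "s = real (Suc j)"
      have "s > 0" by (simp add: s_def)
      then show ?thesis using c unfolding s_def[symmetric]
        by (simp add: field_simps power2_eq_square power3_eq_cube eval_nat_numeral)
    qed
    finally show ?thesis .
  qed
  have sm: "(\<lambda>j. integral {0<..} (\<lambda>x. norm (f j x))) summable_on UNIV"
  proof (rule summable_on_comparison_test)
    have "summable (\<lambda>j. N * (1 + 2 * N) / c\<^sup>2 * (1 / real (Suc j) ^ 2))"
      by (rule summable_mult[OF inverse_squares_summable(2)])
    then show "(\<lambda>j. N * (1 + 2 * N) / c\<^sup>2 * (1 / real (Suc j) ^ 2)) summable_on UNIV"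
      by (intro norm_summable_imp_summable_on) simp
    fix j :: nat
    have cont: "continuous_on {0<..} (f j)"
      unfolding f_def by (auto intro!: continuous_intros)
    show "integral {0<..} (\<lambda>x. norm (f j x)) \<le> N * (1 + 2 * N) / c\<^sup>2 * (1 / real (Suc j) ^ 2)"
      using abs_integrable_bound(2)[OF cont DI f_bound] unfolding D_int .
    show "0 \<le> integral {0<..} (\<lambda>x. norm (f j x))"
      by (intro integral_nonneg) (use fI in \<open>auto simp: absolutely_integrable_on_def\<close>)
  qed
  have F: "((\<lambda>j. f j x) has_sum (x * alt_kernel N l x)) UNIV" if x: "x \<in> {0<..}" for x
  proof -
    have "nome x ^ n = exp (- (c * real n * x))" for n
      by (simp add: exp_of_nat_mult[symmetric] c_def mult_ac)
    then have "x * (real (l + N * j) * nome x ^ (l + N * j) - real (N - l + N * j) * nome x ^ (N - l + N * j)) = f j x" for j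
      unfolding f_def n1_def n2_def by (simp add: right_diff_distrib mult_ac del: of_nat_add of_nat_mult)
    then show ?thesis
      using has_sum_cmult_right[OF alt_kernel_paired[OF l], of x x] x by simp
  qed
  have abs: "(\<lambda>j. norm (f j x)) summable_on UNIV" if x: "x \<in> {0<..}" for x
    by (rule has_sum_real_imp_abs_summable[OF F[OF x]])
  have K: "countable (UNIV :: nat set)" "infinite (UNIV :: nat set)" by auto
  show "(\<lambda>x. x * alt_kernel N l x) absolutely_integrable_on {0<..}"
    by (rule has_sum_integral(1)[OF halfline_lebesgue K fI sm abs F])
  have "(\<lambda>j. integral {0<..} (f j)) sums integral {0<..} (\<lambda>x. x * alt_kernel N l x)"
    by (rule has_sum_imp_sums[OF has_sum_integral(2)[OF halfline_lebesgue K fI sm abs F]])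
  moreover have "(\<lambda>j. integral {0<..} (f j)) sums (1 / (c\<^sup>2 * N) * (pi * cot (pi * (l / N))))"
    unfolding f_int by (intro sums_mult cot_partial_fractions) (use l in auto)
  ultimately have "integral {0<..} (\<lambda>x. x * alt_kernel N l x) = 1 / (c\<^sup>2 * N) * (pi * cot (pi * (l / N)))"
    by (rule sums_unique2)
  then show "integral {0<..} (\<lambda>x. x * alt_kernel N l x) = cot (pi * l / N) / (4 * pi * N)"
    by (simp add: c_def power2_eq_square)
qed

lemma cot_cong:
  assumes N: "N > 0" and l: "\<not> int N dvd b" and cong: "[k = b] (mod int N)"
  shows "cot (pi * of_int k / real N) = cot (pi * of_int b / real N)"
proof -
  have nk: "\<not> int N dvd k"
    using l root1_cong[OF N cong] root1_eq_1_iff[OF N, of k] root1_eq_1_iff[OF N, of b] by simp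
  have "\<i> * of_real (cot (pi * of_int k / real N)) = (1 + root1 N k) / (1 - root1 N k)"
    by (rule cot_eq_root1[OF N nk, symmetric])
  also have "\<dots> = \<i> * of_real (cot (pi * of_int b / real N))"
    unfolding root1_cong[OF N cong] by (rule cot_eq_root1[OF N l])
  finally show ?thesis by simp
qed

text \<open>The weight \<open>n\<close> prevents absolute convergence of the double series of the moments. The sum over \<open>n\<close> is
  therefore carried out first, inside \<open>alt_kernel\<close>, and the substitution \<open>x = m s\<close> then extracts the
  factor \<open>1 / m\<^sup>2\<close> from each moment.\<close>

theorem lambert_alt_first_moment:
  fixes \<phi> :: "nat \<Rightarrow> real"
  assumes N: "N > 0" and nb: "\<not> int N dvd b" and bd: "\<And>n. \<bar>\<phi> n\<bar> \<le> B"
    and sum_a: "((\<lambda>m. \<phi> m / real m ^ 2) has_sum a) {1..}"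
  defines "F \<equiv> \<lambda>s. s * lambert (\<lambda>m n. \<phi> m * (real n * alt_ind N b n)) (nome s)"
  shows "F absolutely_integrable_on {0<..}"
    "integral {0<..} F = a * cot (pi * b / N) / (4 * pi * N)"
proof -
  interpret nonzero_residues N b b using N nb by unfold_locales
  define l where "l = lA"
  have l: "1 \<le> l" "l < N" using range by (simp_all add: l_def)
  define h where "h = (\<lambda>x. x * alt_kernel N l x)"
  note h = alt_kernel_moment[OF l, folded h_def]
  define H where "H = integral {0<..} (\<lambda>x. norm (h x))"
  define f where "f = (\<lambda>m s. \<phi> m * (s * alt_kernel N l (real m * s)))"
  have K: "countable {1::nat..}" "infinite {1::nat..}" by (auto simp: infinite_Ici)
  have sc: "(\<lambda>s. s * alt_kernel N l (real m * s)) absolutely_integrable_on {0<..}"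
    "integral {0<..} (\<lambda>s. s * alt_kernel N l (real m * s)) = integral {0<..} h / real m ^ 2"
    "integral {0<..} (\<lambda>s. norm (s * alt_kernel N l (real m * s))) = H / real m ^ 2" if m: "m \<ge> 1" for m
  proof -
    have m0: "real m > 0" using m by simp
    have e: "s * alt_kernel N l (real m * s) = (1 / real m ^ 2) * (real m *\<^sub>R h (real m * s))" for s
      using m0 by (simp add: h_def power2_eq_square)
    have A: "(\<lambda>s. real m *\<^sub>R h (real m * s)) absolutely_integrable_on {0<..}"
      "integral {0<..} (\<lambda>s. real m *\<^sub>R h (real m * s)) = integral {0<..} h"
      using scale_halfline[OF m0, of h "integral {0<..} h"] h(1) by blast+
    show "(\<lambda>s. s * alt_kernel N l (real m * s)) absolutely_integrable_on {0<..}"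
      unfolding e by (rule set_integrable_mult_right) (rule A(1))
    show "integral {0<..} (\<lambda>s. s * alt_kernel N l (real m * s)) = integral {0<..} h / real m ^ 2"
      unfolding e integral_mult_right A(2) by simp
    have "(\<lambda>x. norm (h x)) absolutely_integrable_on {0<..}"
      using h(1) by (rule absolutely_integrable_norm[unfolded o_def])
    then have B: "integral {0<..} (\<lambda>s. real m *\<^sub>R norm (h (real m * s))) = H"
      using scale_halfline[OF m0, of "\<lambda>x. norm (h x)" H] unfolding H_def by blast
    have e': "norm (s * alt_kernel N l (real m * s)) = (1 / real m ^ 2) * (real m *\<^sub>R norm (h (real m * s)))" for s
      unfolding e using m0 by (simp add: abs_mult)
    show "integral {0<..} (\<lambda>s. norm (s * alt_kernel N l (real m * s))) = H / real m ^ 2"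
      unfolding e' integral_mult_right B by simp
  qed
  have fI: "f m absolutely_integrable_on {0<..}" and f_int: "integral {0<..} (f m) = \<phi> m / real m ^ 2 * integral {0<..} h"
    and f_norm: "integral {0<..} (\<lambda>s. norm (f m s)) = \<bar>\<phi> m / real m ^ 2\<bar> * H" if m: "m \<in> {1..}" for m
  proof -
    have m: "m \<ge> 1" using m by simp
    show "f m absolutely_integrable_on {0<..}"
      unfolding f_def by (rule set_integrable_mult_right) (rule sc(1)[OF m])
    show "integral {0<..} (f m) = \<phi> m / real m ^ 2 * integral {0<..} h"
      unfolding f_def integral_mult_right sc(2)[OF m] by simp
    show "integral {0<..} (\<lambda>s. norm (f m s)) = \<bar>\<phi> m / real m ^ 2\<bar> * H"
      unfolding f_def norm_mult[of "\<phi> m"] integral_mult_right sc(3)[OF m] by simp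
  qed
  have "(\<lambda>m. \<bar>\<phi> m / real m ^ 2\<bar>) summable_on {1..}"
    using has_sum_real_imp_abs_summable[OF sum_a] by (simp only: real_norm_def)
  then have "(\<lambda>m. \<bar>\<phi> m / real m ^ 2\<bar> * H) summable_on {1..}" by (rule summable_on_cmult_left)
  then have sm: "(\<lambda>m. integral {0<..} (\<lambda>s. norm (f m s))) summable_on {1..}"
    by (rule iffD1[OF summable_on_cong, rotated]) (simp only: f_norm)
  have pg: "poly_growth (\<lambda>m n. \<phi> m * (real n * alt_ind N b n))"
  proof (rule poly_growthI[of _ "\<bar>B\<bar> * 2" 1])
    fix m n :: nat assume m: "m \<ge> 1" "n \<ge> 1"
    have "\<bar>\<phi> m\<bar> * (real n * \<bar>alt_ind N b n\<bar>) \<le> \<bar>B\<bar> * (real (m * n) * 2)"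
      using m order_trans[OF bd[of m] abs_ge_self[of B]]
      by (intro mult_mono abs_alt_ind_le) auto
    then show "norm (\<phi> m * (real n * alt_ind N b n)) \<le> \<bar>B\<bar> * 2 * real (m * n) ^ 1"
      by (simp add: abs_mult mult_ac)
  qed
  have F: "((\<lambda>m. f m s) has_sum F s) {1..}" if s: "s \<in> {0<..}" for s
  proof -
    have "\<bar>nome s\<bar> < 1" using s by simp
    then have hs: "((\<lambda>(m, n). \<phi> m * (real n * alt_ind N b n) * nome s ^ (m * n)) has_sum
        lambert (\<lambda>m n. \<phi> m * (real n * alt_ind N b n)) (nome s)) pairs"
      by (intro lambert_has_sum pg) simp
    have "((\<lambda>m. \<phi> m * alt_kernel N l (real m * s)) has_sum lambert (\<lambda>m n. \<phi> m * (real n * alt_ind N b n)) (nome s)) {1..}"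
    proof (rule has_sum_SigmaD[OF hs])
      fix m :: nat assume "m \<in> {1..}"
      then have ms: "real m * s > 0" using s by simp
      have "nome (real m * s) ^ n = nome s ^ (m * n)" for n
        by (simp add: exp_of_nat_mult[symmetric] mult_ac)
      then show "((\<lambda>y. case (m, y) of (m, n) \<Rightarrow> \<phi> m * (real n * alt_ind N b n) * nome s ^ (m * n)) has_sum
          \<phi> m * alt_kernel N l (real m * s)) {1..}"
        using has_sum_cmult_right[OF alt_kernel_has_sum[OF ms, of N l], of "\<phi> m"]
        unfolding l_def inds by (simp add: mult_ac)
    qed
    from has_sum_cmult_right[OF this, of s] show ?thesis
      unfolding f_def F_def by (simp add: mult_ac)
  qed
  have abs: "(\<lambda>m. norm (f m s)) summable_on {1..}" if s: "s \<in> {0<..}" for s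
    by (rule has_sum_real_imp_abs_summable[OF F[OF s]])
  show "F absolutely_integrable_on {0<..}"
    by (rule has_sum_integral(1)[OF halfline_lebesgue K fI sm abs F])
  have "((\<lambda>m. integral {0<..} (f m)) has_sum integral {0<..} F) {1..}"
    by (rule has_sum_integral(2)[OF halfline_lebesgue K fI sm abs F])
  moreover have "((\<lambda>m. integral {0<..} (f m)) has_sum (a * integral {0<..} h)) {1..}"
    by (rule iffD1[OF has_sum_cong has_sum_cmult_left[OF sum_a]]) (simp only: f_int)
  ultimately have "integral {0<..} F = a * integral {0<..} h" by (rule has_sum_unique)
  also have "integral {0<..} h = cot (pi * b / N) / (4 * pi * N)"
    using h(2) cot_cong[OF N nb cong_lA] by (simp add: l_def)
  finally show "integral {0<..} F = a * cot (pi * b / N) / (4 * pi * N)" by simp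
qed

section \<open>The L-value as a Mellin transform\<close>

lemma norm_of_real_powr: "t > 0 \<Longrightarrow> norm (of_real t powr (z :: complex)) = t powr Re z"
  by (simp add: norm_powr_real_powr)

lemma real_Gamma_integral_scaled:
  fixes x a :: real
  assumes x: "x > 0" and a: "a > 0"
  shows "(\<lambda>t. t powr (x - 1) * exp (- (a * t))) absolutely_integrable_on {0<..}"
    and "integral {0<..} (\<lambda>t. t powr (x - 1) * exp (- (a * t))) = Gamma x / a powr x"
proof -
  let ?f = "\<lambda>t. of_real t powr (of_real x - 1) * of_real (exp (- (a * t))) :: complex"
  have eq: "t powr (x - 1) * exp (- (a * t)) = Re (?f t)" if "t \<in> {0<..}" for t
  proof -
    have "of_real t powr (of_real x - 1 :: complex) = of_real (t powr (x - 1))"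
      using that powr_of_real[of t "x - 1"] by simp
    then show ?thesis by simp
  qed
  have z: "Re (of_real x) > 0" using x by simp
  note G = Gamma_integral_scaled[OF z a]
  have "(Re \<circ> ?f) absolutely_integrable_on {0<..}"
    by (rule absolutely_integrable_linear[OF G(1) bounded_linear_Re])
  then show "(\<lambda>t. t powr (x - 1) * exp (- (a * t))) absolutely_integrable_on {0<..}"
    by (rule absolutely_integrable_spike[OF _ negligible_empty]) (use eq in auto)
  have "integral {0<..} (\<lambda>t. t powr (x - 1) * exp (- (a * t))) = integral {0<..} (Re \<circ> ?f)"
    by (rule integral_cong) (use eq in auto)
  also have "\<dots> = Re (Gamma (of_real x) / of_real a powr (of_real x))"
    using integral_linear[OF set_lebesgue_integral_eq_integral(1)[OF G(1)] bounded_linear_Re] G(2) by simp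
  also have "\<dots> = Gamma x / a powr x"
    using a by (simp add: Gamma_complex_of_real powr_of_real flip: of_real_divide)
  finally show "integral {0<..} (\<lambda>t. t powr (x - 1) * exp (- (a * t))) = Gamma x / a powr x" .
qed

text \<open>The restriction to the imaginary axis of a q-series without constant term. The boundedness near
  \<open>u = 0\<close>, which for a modular form comes from its behaviour at the cusp \<open>0\<close>, extends the Mellin
  transform beyond the half-plane of convergence of the Dirichlet series.\<close>

locale bounded_cusp_series =
  fixes c :: "nat \<Rightarrow> complex" and K :: real and p :: nat and M :: real and \<phi> :: "real \<Rightarrow> complex"
  assumes growth: "\<And>n. norm (c n) \<le> K * real (Suc n) ^ p"
    and sums: "\<And>u. u > 0 \<Longrightarrow> (\<lambda>n. c (Suc n) * of_real (nome u ^ Suc n)) sums \<phi> u"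
    and bounded: "\<And>u. 0 < u \<Longrightarrow> u \<le> 1 \<Longrightarrow> norm (\<phi> u) \<le> M"
begin

lemma K_nonneg: "K \<ge> 0"
  using order_trans[OF norm_ge_zero growth[of 0]] by simp

lemma M_nonneg: "M \<ge> 0"
  using order_trans[OF norm_ge_zero bounded[of 1]] by simp

lemma abs_summable:
  assumes "u > 0"
  shows "summable (\<lambda>n. norm (c (Suc n) * of_real (nome u ^ Suc n)))"
proof (rule summable_comparison_test')
  let ?k = "p + 2"
  show "summable (\<lambda>n. K * 2 ^ p * (fact ?k / u ^ ?k) * (1 / real (Suc n) ^ 2))"
    by (rule summable_mult[OF inverse_squares_summable(2)])
  fix n
  have "real (Suc (Suc n)) ^ p \<le> (2 * real (Suc n)) ^ p" by (intro power_mono) auto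
  then have "norm (c (Suc n)) \<le> K * (2 * real (Suc n)) ^ p"
    using growth[of "Suc n"] K_nonneg by (meson mult_left_mono order_trans)
  then have "norm (c (Suc n)) * nome u ^ Suc n \<le> (K * (2 * real (Suc n)) ^ p) * (fact ?k / u ^ ?k / real (Suc n) ^ ?k)"
    by (intro mult_mono exp_power_decay) (use assms K_nonneg in auto)
  also have "\<dots> = K * 2 ^ p * (fact ?k / u ^ ?k) * (1 / real (Suc n) ^ 2)"
  proof -
    define s where "s = real (Suc n)"
    have "s > 0" by (simp add: s_def)
    then show ?thesis unfolding s_def[symmetric]
      by (simp add: power_add power_mult_distrib power2_eq_square mult_ac)
  qed
  finally show "norm (norm (c (Suc n) * of_real (nome u ^ Suc n))) \<le> K * 2 ^ p * (fact ?k / u ^ ?k) * (1 / real (Suc n) ^ 2)"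
    by (simp add: norm_mult norm_power)
qed

lemma \<phi>_decay:
  obtains C where "C \<ge> 0" "\<And>u. u \<ge> 1 \<Longrightarrow> norm (\<phi> u) \<le> C * exp (- (pi * u))"
proof
  \<comment> \<open>The series at \<open>u \<ge> 1\<close> is compared with the one at \<open>1 / 2\<close>: for \<open>n \<ge> 1\<close>, each exponent gains
    \<open>2 n u - n \<ge> u\<close>, in units of \<open>\<pi>\<close>.\<close>
  let ?t = "\<lambda>n. norm (c (Suc n) * of_real (nome (1 / 2) ^ Suc n))"
  have sm: "summable ?t" by (rule abs_summable) simp
  show "0 \<le> (\<Sum>n. ?t n)" by (rule suminf_nonneg[OF sm]) simp
  fix u :: real assume u: "u \<ge> 1"
  have "norm (\<phi> u) \<le> (\<Sum>n. norm (c (Suc n) * of_real (nome u ^ Suc n)))"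
    using summable_norm[OF abs_summable[of u]] sums_unique[OF sums[of u]] u by simp
  also have "\<dots> \<le> (\<Sum>n. ?t n * exp (- (pi * u)))"
  proof (rule suminf_le)
    fix n
    have "nome u ^ Suc n \<le> nome (1 / 2) ^ Suc n * exp (- (pi * u))"
    proof -
      have "pi * real (Suc n) + pi * u \<le> 2 * pi * u * real (Suc n)"
      proof -
        have "s + u \<le> 2 * (s * u)" if "s \<ge> 1" for s
        proof -
          have "s * 1 \<le> s * u" "1 * u \<le> s * u"
            using u that by (intro mult_left_mono mult_right_mono; simp)+
          then show ?thesis by linarith
        qed
        from this[of "real (Suc n)"] have "pi * (real (Suc n) + u) \<le> pi * (2 * (real (Suc n) * u))"
          by (intro mult_left_mono pi_ge_zero) simp
        then show ?thesis by (simp only: distrib_left mult_ac)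
      qed
      then have "exp (- (2 * pi * u * real (Suc n))) \<le> exp (- (pi * real (Suc n)) + - (pi * u))" by simp
      moreover have "nome u ^ Suc n = exp (- (2 * pi * u * real (Suc n)))"
        unfolding exp_of_nat_mult[symmetric] by (simp add: mult_ac)
      moreover have "nome (1 / 2) ^ Suc n = exp (- (pi * real (Suc n)))"
        unfolding exp_of_nat_mult[symmetric] by (simp add: mult_ac)
      ultimately show ?thesis by (simp only: exp_add)
    qed
    then have "norm (c (Suc n)) * nome u ^ Suc n \<le> norm (c (Suc n)) * (nome (1 / 2) ^ Suc n * exp (- (pi * u)))"
      by (intro mult_left_mono) auto
    then show "norm (c (Suc n) * of_real (nome u ^ Suc n)) \<le> ?t n * exp (- (pi * u))"
      by (simp add: norm_mult norm_power mult_ac)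
  next
    show "summable (\<lambda>n. norm (c (Suc n) * of_real (nome u ^ Suc n)))" by (rule abs_summable) (use u in simp)
    show "summable (\<lambda>n. ?t n * exp (- (pi * u)))" by (rule summable_mult2[OF sm])
  qed
  also have "\<dots> = (\<Sum>n. ?t n) * exp (- (pi * u))" by (rule suminf_mult2[OF sm, symmetric])
  finally show "norm (\<phi> u) \<le> (\<Sum>n. ?t n) * exp (- (pi * u))" .
qed

lemma \<phi>_continuous: "continuous_on {0<..} \<phi>"
proof -
  define g where "g = (\<lambda>x::complex. \<Sum>n. c n * x ^ n)"
  have sm: "summable (\<lambda>n. c n * of_real x ^ n)" if "0 < x" "x < 1" for x :: real
  proof -
    define u where "u = - ln x / (2 * pi)"
    have u: "u > 0" "nome u = x" using that by (auto simp: u_def divide_less_0_iff ln_less_zero)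
    have "summable (\<lambda>n. c (Suc n) * of_real (nome u ^ Suc n))" using sums[OF u(1)] by (simp add: sums_iff)
    then show ?thesis unfolding u(2)
      using summable_Suc_iff[of "\<lambda>n. c n * of_real x ^ n"] by simp
  qed
  have gc: "continuous_on (ball 0 1) g"
  proof (rule continuous_at_imp_continuous_on, rule ballI)
    fix x :: complex assume x: "x \<in> ball 0 1"
    define r where "r = (1 + norm x) / 2"
    have r: "0 < r" "r < 1" "norm x < r" using x by (auto simp: r_def add_pos_nonneg)
    show "isCont g x" unfolding g_def
      by (rule isCont_powser[OF sm[OF r(1,2)]]) (use r in simp)
  qed
  have eq: "\<phi> u = g (of_real (nome u)) - c 0" if "u \<in> {0<..}" for u
  proof -
    have "(\<lambda>n. c (Suc n) * of_real (nome u) ^ Suc n) sums \<phi> u" using sums[of u] that by simp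
    then have "(\<lambda>n. c n * of_real (nome u) ^ n) sums (\<phi> u + c 0)"
      by (subst (asm) sums_Suc_iff) simp
    then show ?thesis by (simp add: g_def sums_iff)
  qed
  have "continuous_on {0<..} (\<lambda>u::real. g (of_real (nome u)) - c 0)"
    by (intro continuous_intros continuous_on_compose2[OF gc]) auto
  then show ?thesis by (rule continuous_on_eq) (simp add: eq)
qed

definition "mellin z = integral {0<..} (\<lambda>u. of_real u powr (z - 1) * \<phi> u)"

lemma integrand_continuous: "continuous_on {0<..} (\<lambda>u. of_real u powr (z - 1) * \<phi> u)"
  by (intro continuous_intros \<phi>_continuous) auto

lemma integrand_bound:
  obtains W where "W \<ge> 0" "\<And>z u. 1 \<le> Re z \<Longrightarrow> Re z \<le> R \<Longrightarrow> u > 0 \<Longrightarrow>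
      norm (of_real u powr (z - 1) * \<phi> u) \<le> W * exp (- u)"
proof -
  obtain C where C: "C \<ge> 0" "\<And>u. u \<ge> 1 \<Longrightarrow> norm (\<phi> u) \<le> C * exp (- (pi * u))" by (rule \<phi>_decay) blast
  define k where "k = nat \<lceil>R\<rceil>"
  define W where "W = M * exp 1 + fact k * C"
  show ?thesis
  proof (rule that[of W])
    show "W \<ge> 0" using M_nonneg C by (simp add: W_def)
    fix z :: complex and u :: real assume z: "1 \<le> Re z" "Re z \<le> R" and u: "u > 0"
    show "norm (of_real u powr (z - 1) * \<phi> u) \<le> W * exp (- u)"
    proof (cases "u \<le> 1")
      case True
      have "u powr (Re z - 1) \<le> 1" using u True z by (intro powr_le1) auto
      then have "u powr (Re z - 1) * norm (\<phi> u) \<le> 1 * M"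
        using bounded[OF u True] by (intro mult_mono) auto
      also have "\<dots> \<le> M * (exp 1 * exp (- u))"
        using M_nonneg True unfolding exp_add[symmetric] by (simp add: mult_le_cancel_left1)
      also have "\<dots> \<le> W * exp (- u)"
        using C by (simp add: W_def distrib_right)
      finally show ?thesis using u by (simp add: norm_mult norm_of_real_powr)
    next
      case False
      have "Re z - 1 \<le> real k" using z real_nat_ceiling_ge[of R] unfolding k_def by linarith
      then have "u powr (Re z - 1) \<le> u powr real k" using False by (intro powr_mono) auto
      also have "\<dots> = u ^ k" using u by (simp add: powr_realpow)
      also have "\<dots> \<le> fact k * exp u" using u by (intro power_le_fact_exp) simp
      finally have "u powr (Re z - 1) * norm (\<phi> u) \<le> (fact k * exp u) * (C * exp (- (pi * u)))"
        using C(2)[of u] False by (intro mult_mono) auto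
      also have "\<dots> = fact k * C * exp (u - pi * u)"
        by (simp add: exp_diff exp_minus field_simps)
      also have "\<dots> \<le> fact k * C * exp (- u)"
      proof -
        have "2 * u \<le> pi * u" using pi_gt3 u by (intro mult_right_mono) auto
        then show ?thesis using C by (intro mult_left_mono) auto
      qed
      also have "\<dots> \<le> W * exp (- u)" using M_nonneg by (simp add: W_def distrib_right)
      finally show ?thesis using u by (simp add: norm_mult norm_of_real_powr)
    qed
  qed
qed

lemma exp_integrable: "(\<lambda>u::real. W * exp (- u)) absolutely_integrable_on {0<..}"
  using exp_moment(1)[of 1 0] by (intro set_integrable_mult_right) simp

lemma integrand_integrable:
  assumes "Re z \<ge> 1"
  shows "(\<lambda>u. of_real u powr (z - 1) * \<phi> u) absolutely_integrable_on {0<..}"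
proof -
  obtain W where W: "\<And>w u. 1 \<le> Re w \<Longrightarrow> Re w \<le> Re z \<Longrightarrow> u > 0 \<Longrightarrow>
      norm (of_real u powr (w - 1) * \<phi> u) \<le> W * exp (- u)"
    by (rule integrand_bound[of "Re z"]) blast
  show ?thesis
    by (rule abs_integrable_bound(1)[OF integrand_continuous exp_integrable W]) (use assms in auto)
qed

text \<open>Away from \<open>0\<close> and \<open>\<infinity>\<close> the integrand is continuous and holomorphic in the parameter, so differentiation
  under the integral applies.\<close>

lemma truncated_mellin_holomorphic:
  assumes "0 < a"
  shows "(\<lambda>z. integral {a..b} (\<lambda>u. of_real u powr (z - 1) * \<phi> u)) holomorphic_on UNIV"
proof -
  let ?e = "\<lambda>z u. exp ((z - 1) * of_real (ln u)) * \<phi> u"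
  have \<phi>c: "continuous_on {a..b} \<phi>"
    by (rule continuous_on_subset[OF \<phi>_continuous]) (use assms in auto)
  have lnc: "continuous_on {a..b} ln"
    by (rule continuous_on_ln) (use assms in \<open>auto intro: continuous_intros\<close>)
  have "(\<lambda>z. integral (cbox a b) (?e z)) holomorphic_on UNIV"
  proof (rule leibniz_rule_holomorphic[where fx = "\<lambda>z u. of_real (ln u) * ?e z u"])
    show "((\<lambda>z. ?e z u) has_field_derivative of_real (ln u) * ?e z u) (at z within UNIV)" for z u
      by (auto intro!: derivative_eq_intros)
    show "?e z integrable_on cbox a b" for z
      by (rule integrable_continuous) (use \<phi>c lnc in \<open>auto intro!: continuous_intros\<close>)
    have \<phi>2: "continuous_on (UNIV \<times> {a..b}) (\<lambda>x. \<phi> (snd x))"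
      by (rule continuous_on_compose2[OF \<phi>c continuous_on_snd[OF continuous_on_id]]) force
    have ln2: "continuous_on (UNIV \<times> {a..b}) (\<lambda>x. ln (snd x))"
      by (rule continuous_on_compose2[OF lnc continuous_on_snd[OF continuous_on_id]]) force
    show "continuous_on (UNIV \<times> cbox a b) (\<lambda>(z, u). of_real (ln u) * ?e z u)"
      unfolding case_prod_unfold box_real
      by (intro continuous_on_mult continuous_on_of_real continuous_on_exp continuous_on_diff
          continuous_on_fst continuous_on_id continuous_on_const \<phi>2 ln2)
  qed auto
  moreover have "integral (cbox a b) (?e z) = integral {a..b} (\<lambda>u. of_real u powr (z - 1) * \<phi> u)" for z
    unfolding box_real
    by (rule integral_cong) (use assms in \<open>auto simp: powr_def Ln_of_real mult.commute\<close>)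
  ultimately show ?thesis by simp
qed

text \<open>The Mellin transform is the locally uniform limit of the truncated ones, the error being at most \<open>W\<close>
  times the integral of \<open>exp (- u)\<close> outside of the truncation interval.\<close>

lemma mellin_holomorphic: "mellin holomorphic_on {z. Re z > 1}"
proof -
  define A where "A = (\<lambda>j::nat. {1 / real (Suc j)..real (Suc j)})"
  define T where "T = (\<lambda>j z. integral (A j) (\<lambda>u. of_real u powr (z - 1) * \<phi> u))"
  have A_sub: "A j \<subseteq> {0<..}" for j
  proof
    fix u assume "u \<in> A j"
    then have "1 / real (Suc j) \<le> u" by (simp add: A_def)
    moreover have "0 < 1 / real (Suc j)" by simp
    ultimately show "u \<in> {0<..}" by (simp only: greaterThan_iff)
  qed
  define \<epsilon> where "\<epsilon> = (\<lambda>j. integral {0<..} (\<lambda>u. if u \<in> A j then 0 else exp (- u)))"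
  have e_int: "(\<lambda>u::real. exp (- u)) integrable_on {0<..}"
    using exp_integrable[of 1] by (simp add: absolutely_integrable_on_def)
  have e_intA: "(\<lambda>u. if u \<in> A j then 0 else exp (- u)) integrable_on {0<..}" for j
  proof -
    have "(\<lambda>u. exp (- u)) integrable_on A j"
      unfolding A_def by (intro integrable_continuous_real continuous_intros)
    then have "(\<lambda>u. if u \<in> A j then exp (- u) else 0) integrable_on {0<..}"
      using integrable_restrict_Int[of "A j" "\<lambda>u. exp (- u)" "{0<..}"] A_sub[of j] by (simp add: Int_absorb2)
    from integrable_diff[OF e_int this] show ?thesis
      by (rule integrable_eq) auto
  qed
  have eps0: "\<epsilon> \<longlonglongrightarrow> 0"
  proof -
    have "(\<lambda>j. integral {0<..} (\<lambda>u. if u \<in> A j then 0 else exp (- u))) \<longlonglongrightarrow> integral {0<..} (\<lambda>u::real. 0 :: real)"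
    proof (rule dominated_convergence(2)[OF e_intA e_int])
      fix u :: real assume u: "u \<in> {0<..}"
      obtain j0 where j0: "max u (1 / u) \<le> real j0" using real_arch_simple by blast
      have "u \<in> A j" if "j \<ge> j0" for j
      proof -
        have "u \<le> real (Suc j)" "1 / u \<le> real (Suc j)" using j0 that by auto
        then show ?thesis using u by (simp add: A_def field_simps del: of_nat_Suc)
      qed
      then have "eventually (\<lambda>j. (if u \<in> A j then 0 else exp (- u)) = 0) sequentially"
        unfolding eventually_sequentially by auto
      then show "(\<lambda>j. if u \<in> A j then 0 else exp (- u)) \<longlonglongrightarrow> 0"
        by (rule tendsto_eventually)
    qed auto
    then show ?thesis by (simp add: \<epsilon>_def)
  qed
  show ?thesis
  proof (rule holomorphic_uniform_sequence[where f = T])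
    show "open {z. Re z > 1}" by (rule open_halfspace_Re_gt)
    show "T j holomorphic_on {z. Re z > 1}" for j
      unfolding T_def A_def by (rule holomorphic_on_subset[OF truncated_mellin_holomorphic]) auto
    fix x assume x: "x \<in> {z. Re z > 1}"
    define d where "d = (Re x - 1) / 2"
    have d: "d > 0" using x by (simp add: d_def)
    have re: "1 \<le> Re z" "Re z \<le> Re x + d" "Re z > 1" if "z \<in> cball x d" for z
    proof -
      have "\<bar>Re z - Re x\<bar> \<le> d"
        using that abs_Re_le_cmod[of "z - x"] by (simp add: dist_norm norm_minus_commute)
      then have "Re z \<ge> Re x - d" "Re z \<le> Re x + d" by linarith+
      moreover have "Re x - d > 1" using x by (simp add: d_def field_simps)
      ultimately show "1 \<le> Re z" "Re z \<le> Re x + d" "Re z > 1" by linarith+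
    qed
    obtain W where W: "W \<ge> 0" "\<And>w u. 1 \<le> Re w \<Longrightarrow> Re w \<le> Re x + d \<Longrightarrow> u > 0 \<Longrightarrow>
        norm (of_real u powr (w - 1) * \<phi> u) \<le> W * exp (- u)"
      by (rule integrand_bound[of "Re x + d"]) blast
    have est: "norm (T j z - mellin z) \<le> W * \<epsilon> j" if z: "z \<in> cball x d" for j z
    proof -
      let ?g = "\<lambda>u. of_real u powr (z - 1) * \<phi> u"
      have gI: "?g integrable_on {0<..}"
        using integrand_integrable[OF re(1)[OF z]] by (simp add: absolutely_integrable_on_def)
      have "?g integrable_on A j"
        unfolding A_def
        by (intro integrable_continuous_real continuous_on_subset[OF integrand_continuous])
           (use A_sub[of j] in \<open>simp add: A_def\<close>)
      then have gA: "(\<lambda>u. if u \<in> A j then ?g u else 0) integrable_on {0<..}"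
        using integrable_restrict_Int[of "A j" ?g "{0<..}"] A_sub[of j] by (simp add: Int_absorb2)
      have "integral {0<..} (\<lambda>u. if u \<in> A j then ?g u else 0) = T j z"
        using integral_restrict_Int[of "{0<..}" "A j" ?g] A_sub[of j] by (simp add: T_def Int_absorb1 Int_absorb2)
      then have "mellin z - T j z = integral {0<..} (\<lambda>u. ?g u - (if u \<in> A j then ?g u else 0))"
        unfolding integral_diff[OF gI gA] by (simp add: mellin_def)
      also have "norm \<dots> \<le> integral {0<..} (\<lambda>u. W * (if u \<in> A j then 0 else exp (- u)))"
      proof (rule integral_norm_bound_integral)
        show "(\<lambda>u. ?g u - (if u \<in> A j then ?g u else 0)) integrable_on {0<..}"
          by (rule integrable_diff[OF gI gA])
        show "(\<lambda>u. W * (if u \<in> A j then 0 else exp (- u))) integrable_on {0<..}"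
          by (rule integrable_on_mult_right[OF e_intA])
        fix u :: real assume "u \<in> {0<..}"
        then show "norm (?g u - (if u \<in> A j then ?g u else 0)) \<le> W * (if u \<in> A j then 0 else exp (- u))"
          using W(2)[OF re(1,2)[OF z], of u] by auto
      qed
      also have "\<dots> = W * \<epsilon> j" unfolding \<epsilon>_def by (rule integral_mult_right)
      finally show ?thesis by (simp add: norm_minus_commute)
    qed
    have "uniform_limit (cball x d) T mellin sequentially"
    proof (rule uniform_limitI)
      fix e :: real assume e: "e > 0"
      have "(\<lambda>j. W * \<epsilon> j) \<longlonglongrightarrow> W * 0" by (intro tendsto_intros eps0)
      then have "eventually (\<lambda>j. W * \<epsilon> j < e) sequentially" using e by (intro order_tendstoD(2)[of _ "W * 0"]) auto
      then show "eventually (\<lambda>j. \<forall>z\<in>cball x d. dist (T j z) (mellin z) < e) sequentially"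
      proof eventually_elim
        case (elim j)
        show ?case
        proof
          fix z assume "z \<in> cball x d"
          from est[OF this, of j] elim show "dist (T j z) (mellin z) < e" by (simp add: dist_norm)
        qed
      qed
    qed
    moreover have "cball x d \<subseteq> {z. Re z > 1}" using re(3) by blast
    ultimately show "\<exists>d>0. cball x d \<subseteq> {z. Re z > 1} \<and> uniform_limit (cball x d) T mellin sequentially"
      using d by blast
  qed
qed

text \<open>Termwise, the integral of \<open>u^(z - 1) exp (- 2 \<pi> n u)\<close> is \<open>\<Gamma>(z) / (2 \<pi> n)^z\<close>. Writing the inverse
  Gamma factor as \<open>rGamma\<close> keeps the right-hand side holomorphic.\<close>

lemma dirichlet_series_sums:
  assumes z: "Re z > real p + 1"
  shows "(\<lambda>n. c (Suc n) / of_nat (Suc n) powr z) sums (of_real (2 * pi) powr z * rGamma z * mellin z)"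
proof -
  have z0: "Re z > 0" using z by linarith
  define f where "f = (\<lambda>n u. c (Suc n) * (of_real u powr (z - 1) * of_real (exp (- (2 * pi * real (Suc n) * u)))))"
  have pos: "2 * pi * real (Suc n) > 0" for n by simp
  note G = Gamma_integral_scaled[OF z0 pos] and RG = real_Gamma_integral_scaled[OF z0 pos]
  have fI: "f n absolutely_integrable_on {0<..}" for n
    unfolding f_def by (rule set_integrable_mult_right) (rule G(1))
  have f_int: "integral {0<..} (f n) = c (Suc n) * (Gamma z / of_real (2 * pi * real (Suc n)) powr z)" for n
    unfolding f_def integral_mult_right G(2) ..
  have f_norm: "integral {0<..} (\<lambda>u. norm (f n u)) = norm (c (Suc n)) * (Gamma (Re z) / (2 * pi * real (Suc n)) powr Re z)" for n
  proof -
    have "integral {0<..} (\<lambda>u. norm (f n u)) =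
        integral {0<..} (\<lambda>u. norm (c (Suc n)) * (u powr (Re z - 1) * exp (- (2 * pi * real (Suc n) * u))))"
    proof (rule integral_cong)
      fix u :: real assume "u \<in> {0<..}"
      then show "norm (f n u) = norm (c (Suc n)) * (u powr (Re z - 1) * exp (- (2 * pi * real (Suc n) * u)))"
        unfolding f_def norm_mult by (simp add: norm_of_real_powr)
    qed
    then show ?thesis unfolding integral_mult_right RG(2) .
  qed
  have sm: "(\<lambda>n. integral {0<..} (\<lambda>u. norm (f n u))) summable_on UNIV"
  proof (rule norm_summable_imp_summable_on, rule summable_comparison_test')
    have "summable (\<lambda>n. real n powr (real p - Re z))"
      using z by (subst summable_real_powr_iff) simp
    then have "summable (\<lambda>n. real (Suc n) powr (real p - Re z))"
      by (rule iffD2[OF summable_Suc_iff[of "\<lambda>n. real n powr (real p - Re z)"]])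
    then show "summable (\<lambda>n. K * 2 ^ p * Gamma (Re z) * real (Suc n) powr (real p - Re z))"
      by (rule summable_mult)
    fix n
    define s where "s = real (Suc n)"
    have s: "s > 0" by (simp add: s_def)
    have G0: "Gamma (Re z) > 0" using z0 by (rule Gamma_real_pos)
    have "real (Suc (Suc n)) ^ p \<le> (2 * s) ^ p" unfolding s_def by (intro power_mono) auto
    then have n1: "norm (c (Suc n)) \<le> K * (2 * s) ^ p"
      using growth[of "Suc n"] K_nonneg by (meson mult_left_mono order_trans)
    have "1 * s \<le> 2 * pi * s" using s pi_gt3 by (intro mult_right_mono) auto
    then have "s powr Re z \<le> (2 * pi * s) powr Re z" using s z0 by (intro powr_mono2) auto
    then have n2: "Gamma (Re z) / (2 * pi * s) powr Re z \<le> Gamma (Re z) / s powr Re z"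
      using s G0 by (intro divide_left_mono) auto
    have "norm (c (Suc n)) * (Gamma (Re z) / (2 * pi * s) powr Re z) \<le> (K * (2 * s) ^ p) * (Gamma (Re z) / s powr Re z)"
      using n1 n2 K_nonneg s G0 by (intro mult_mono) auto
    also have "\<dots> = K * 2 ^ p * Gamma (Re z) * s powr (real p - Re z)"
      using s by (simp add: powr_diff powr_realpow power_mult_distrib)
    finally show "norm (norm (integral {0<..} (\<lambda>u. norm (f n u)))) \<le> K * 2 ^ p * Gamma (Re z) * real (Suc n) powr (real p - Re z)"
      unfolding f_norm s_def[symmetric] using G0 by (simp add: abs_mult)
  qed
  have F: "((\<lambda>n. f n u) has_sum (of_real u powr (z - 1) * \<phi> u)) UNIV"
    and abs: "(\<lambda>n. norm (f n u)) summable_on UNIV" if u: "u \<in> {0<..}" for u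
  proof -
    have eq: "f n u = of_real u powr (z - 1) * (c (Suc n) * of_real (nome u ^ Suc n))" for n
    proof -
      have "exp (- (2 * pi * real (Suc n) * u)) = nome u ^ Suc n"
        unfolding exp_of_nat_mult[symmetric] by (simp add: mult_ac)
      then show ?thesis unfolding f_def by (simp only: mult_ac)
    qed
    have sm: "summable (\<lambda>n. norm (f n u))"
      unfolding eq norm_mult[of "of_real u powr (z - 1)"]
      by (rule summable_mult[OF abs_summable]) (use u in simp)
    have "(\<lambda>n. f n u) sums (of_real u powr (z - 1) * \<phi> u)"
      unfolding eq by (rule sums_mult[OF sums]) (use u in simp)
    then show "((\<lambda>n. f n u) has_sum (of_real u powr (z - 1) * \<phi> u)) UNIV"
      by (rule norm_summable_imp_has_sum[OF sm])
    show "(\<lambda>n. norm (f n u)) summable_on UNIV"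
      by (rule norm_summable_imp_summable_on) (use sm in simp)
  qed
  have C: "countable (UNIV :: nat set)" "infinite (UNIV :: nat set)" by auto
  have "(\<lambda>n. integral {0<..} (f n)) sums mellin z"
    unfolding mellin_def
    by (rule has_sum_imp_sums[OF has_sum_integral(2)[OF halfline_lebesgue C fI sm abs F]])
  from sums_mult[OF this, of "of_real (2 * pi) powr z * rGamma z"]
  have "(\<lambda>n. of_real (2 * pi) powr z * rGamma z * integral {0<..} (f n)) sums
      (of_real (2 * pi) powr z * rGamma z * mellin z)" .
  moreover have "of_real (2 * pi) powr z * rGamma z * integral {0<..} (f n) = c (Suc n) / of_nat (Suc n) powr z" for n
  proof -
    have "rGamma z * Gamma z = 1"
    proof -
      have "z \<notin> \<int>\<^sub>\<le>\<^sub>0" using z0 by (auto elim!: nonpos_Ints_cases)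
      then show ?thesis by (simp add: rGamma_inverse_Gamma Gamma_eq_zero_iff)
    qed
    moreover have "(of_real (2 * pi * real (Suc n)) :: complex) powr z = of_real (2 * pi) powr z * of_nat (Suc n) powr z"
      using powr_times_real[of "of_real (2 * pi)" "of_nat (Suc n)" z] by (simp del: of_nat_Suc)
    moreover have "(of_real (2 * pi) :: complex) powr z \<noteq> 0" by simp
    ultimately show ?thesis unfolding f_int by (simp add: field_simps del: of_nat_Suc)
  qed
  ultimately show ?thesis by simp
qed

theorem L_value_at_2:
  "has_L_value c 2 (4 * of_real pi ^ 2 * integral {0<..} (\<lambda>u. of_real u * \<phi> u))"
proof -
  define F where "F = (\<lambda>z. of_real (2 * pi) powr z * rGamma z * mellin z)"
  have "F holomorphic_on {z. 1 < Re z}"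
    unfolding F_def by (intro holomorphic_intros mellin_holomorphic)
  moreover have "(\<lambda>n. c (Suc n) / of_nat (Suc n) powr z) sums F z" if "1 < Re z \<and> real p + 1 < Re z" for z
    unfolding F_def by (rule dirichlet_series_sums) (use that in simp)
  moreover have "F 2 = 4 * of_real pi ^ 2 * integral {0<..} (\<lambda>u. of_real u * \<phi> u)"
  proof -
    have "(of_real (2 * pi) :: complex) powr 2 = 4 * of_real pi ^ 2"
      using powr_nat[of "of_real (2 * pi) :: complex" 2] by (simp add: power2_eq_square)
    moreover have "rGamma 2 = (1 :: complex)"
      using Gamma_fact[of 1, where 'a = complex] by (simp add: rGamma_inverse_Gamma)
    moreover have "mellin 2 = integral {0<..} (\<lambda>u. of_real u * \<phi> u)"
      unfolding mellin_def by (rule integral_cong) simp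
    ultimately show ?thesis by (simp add: F_def)
  qed
  ultimately show ?thesis
    unfolding has_L_value_def by (intro exI[of _ F] exI[of _ "real p + 1"] exI[of _ 1]) auto
qed

end

section \<open>Fourier expansions\<close>

text \<open>The polynomial bound makes the associated Dirichlet series converge in some half-plane. It is stated
  with \<open>Suc n\<close> so that it also covers the constant term.\<close>

definition moderate_qexp :: "(complex \<Rightarrow> complex) \<Rightarrow> (nat \<Rightarrow> complex) \<Rightarrow> bool" where
  "moderate_qexp f c \<longleftrightarrow>
     has_q_expansion f c \<and> (\<exists>K p. \<forall>n. norm (c n) \<le> K * real (Suc n) ^ p)"

lemma moderate_qexp_abs_summable:
  assumes "has_q_expansion f c" "Im \<tau> > 0"
  shows "summable (\<lambda>n. norm (c n * qpar \<tau> ^ n))"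
proof (rule powser_insidea)
  let ?\<tau>' = "Complex 0 (Im \<tau> / 2)"
  show "summable (\<lambda>n. c n * qpar ?\<tau>' ^ n)"
    using assms unfolding has_q_expansion_def by (simp add: sums_iff)
  show "norm (qpar \<tau>) < norm (qpar ?\<tau>')"
    using assms by (simp add: norm_qpar)
qed

lemma moderate_qexp_mult:
  assumes "moderate_qexp f c" "moderate_qexp g d"
  shows "moderate_qexp (\<lambda>\<tau>. f \<tau> * g \<tau>) (\<lambda>n. \<Sum>i\<le>n. c i * d (n - i))"
proof -
  have f: "has_q_expansion f c" and g: "has_q_expansion g d"
    using assms by (simp_all add: moderate_qexp_def)
  obtain K p where K: "\<And>n. norm (c n) \<le> K * real (Suc n) ^ p"
    using assms unfolding moderate_qexp_def by blast
  obtain L r where L: "\<And>n. norm (d n) \<le> L * real (Suc n) ^ r"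
    using assms unfolding moderate_qexp_def by blast
  have KL: "K \<ge> 0" "L \<ge> 0"
    using order_trans[OF norm_ge_zero K[of 0]] order_trans[OF norm_ge_zero L[of 0]] by simp_all
  have "(\<lambda>n. (\<Sum>i\<le>n. c i * d (n - i)) * qpar \<tau> ^ n) sums (f \<tau> * g \<tau>)" if \<tau>: "Im \<tau> > 0" for \<tau>
  proof -
    have "(\<Sum>i\<le>n. c i * d (n - i)) * qpar \<tau> ^ n = (\<Sum>i\<le>n. (c i * qpar \<tau> ^ i) * (d (n - i) * qpar \<tau> ^ (n - i)))" for n
      unfolding sum_distrib_right
    proof (rule sum.cong)
      fix i assume "i \<in> {..n}"
      then have "qpar \<tau> ^ n = qpar \<tau> ^ i * qpar \<tau> ^ (n - i)" by (simp flip: power_add)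
      then show "c i * d (n - i) * qpar \<tau> ^ n = (c i * qpar \<tau> ^ i) * (d (n - i) * qpar \<tau> ^ (n - i))"
        by simp
    qed simp
    moreover have "(\<Sum>n. c n * qpar \<tau> ^ n) = f \<tau>" "(\<Sum>n. d n * qpar \<tau> ^ n) = g \<tau>"
      using f g \<tau> unfolding has_q_expansion_def by (simp_all add: sums_iff)
    ultimately show ?thesis
      using Cauchy_product_sums[OF moderate_qexp_abs_summable[OF f \<tau>] moderate_qexp_abs_summable[OF g \<tau>]] by simp
  qed
  moreover have "norm (\<Sum>i\<le>n. c i * d (n - i)) \<le> (K * L) * real (Suc n) ^ (Suc (p + r))" for n
  proof -
    have "norm (\<Sum>i\<le>n. c i * d (n - i)) \<le> real (card {..n}) * (K * L * real (Suc n) ^ (p + r))"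
    proof (rule sum_norm_bound)
      fix i assume i: "i \<in> {..n}"
      have "real (Suc i) ^ p \<le> real (Suc n) ^ p" "real (Suc (n - i)) ^ r \<le> real (Suc n) ^ r"
        using i by (auto intro!: power_mono)
      then have "norm (c i) \<le> K * real (Suc n) ^ p" "norm (d (n - i)) \<le> L * real (Suc n) ^ r"
        using K[of i] L[of "n - i"] KL by (meson mult_left_mono order_trans)+
      then have "norm (c i) * norm (d (n - i)) \<le> (K * real (Suc n) ^ p) * (L * real (Suc n) ^ r)"
        using KL by (intro mult_mono) auto
      then show "norm (c i * d (n - i)) \<le> K * L * real (Suc n) ^ (p + r)"
        unfolding norm_mult power_add by (simp only: mult_ac)
    qed
    then show ?thesis by (simp add: mult_ac)
  qed
  ultimately show ?thesis unfolding moderate_qexp_def has_q_expansion_def by blast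
qed

lemma moderate_qexp_diff:
  assumes "moderate_qexp f c" "moderate_qexp g d"
  shows "moderate_qexp (\<lambda>\<tau>. f \<tau> - g \<tau>) (\<lambda>n. c n - d n)"
proof -
  obtain K p where K: "\<And>n. norm (c n) \<le> K * real (Suc n) ^ p"
    using assms unfolding moderate_qexp_def by blast
  obtain L r where L: "\<And>n. norm (d n) \<le> L * real (Suc n) ^ r"
    using assms unfolding moderate_qexp_def by blast
  have KL: "K \<ge> 0" "L \<ge> 0"
    using order_trans[OF norm_ge_zero K[of 0]] order_trans[OF norm_ge_zero L[of 0]] by simp_all
  have "(\<lambda>n. (c n - d n) * qpar \<tau> ^ n) sums (f \<tau> - g \<tau>)" if "Im \<tau> > 0" for \<tau>
    using assms that sums_diff unfolding moderate_qexp_def has_q_expansion_def left_diff_distrib by blast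
  moreover have "norm (c n - d n) \<le> (K + L) * real (Suc n) ^ (p + r)" for n
  proof -
    have "real (Suc n) ^ p \<le> real (Suc n) ^ (p + r)" "real (Suc n) ^ r \<le> real (Suc n) ^ (p + r)"
      by (intro power_increasing; simp)+
    then have "norm (c n) \<le> K * real (Suc n) ^ (p + r)" "norm (d n) \<le> L * real (Suc n) ^ (p + r)"
      using K[of n] L[of n] KL by (meson mult_left_mono order_trans)+
    then show ?thesis using norm_triangle_ineq4[of "c n" "d n"] by (simp add: distrib_right)
  qed
  ultimately show ?thesis unfolding moderate_qexp_def has_q_expansion_def by blast
qed

lemma moderate_qexp_lambert:
  assumes "poly_growth c"
  shows "moderate_qexp (\<lambda>\<tau>. k + lambert c (qpar \<tau>)) (\<lambda>n. if n = 0 then k else dirichlet_coeff c n)"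
proof -
  obtain K p where K: "K \<ge> 0" "\<And>n. norm (dirichlet_coeff c n) \<le> K * real n ^ p"
    using dirichlet_coeff_growth[OF assms] by blast
  have "(\<lambda>n. (if n = 0 then k else dirichlet_coeff c n) * qpar \<tau> ^ n) sums (k + lambert c (qpar \<tau>))"
    if "Im \<tau> > 0" for \<tau>
  proof -
    have "(\<lambda>n. (if n = 0 then k else 0) + dirichlet_coeff c n * qpar \<tau> ^ n) sums (k + lambert c (qpar \<tau>))"
      by (intro sums_add lambert_sums assms norm_qpar_less_1 that) (rule sums_single)
    moreover have "(if n = 0 then k else 0) + dirichlet_coeff c n * qpar \<tau> ^ n =
        (if n = 0 then k else dirichlet_coeff c n) * qpar \<tau> ^ n" for n by simp
    ultimately show ?thesis by simp
  qed
  moreover have "norm (if n = 0 then k else dirichlet_coeff c n) \<le> (norm k + K) * real (Suc n) ^ p" for n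
  proof -
    have 1: "1 * norm k \<le> real (Suc n) ^ p * norm k" by (intro mult_right_mono one_le_power) auto
    have 2: "K * real n ^ p \<le> K * real (Suc n) ^ p"
      using K by (intro mult_left_mono power_mono) auto
    have 3: "0 \<le> K * real (Suc n) ^ p" "0 \<le> real (Suc n) ^ p * norm k" using K by auto
    have "(norm k + K) * real (Suc n) ^ p = real (Suc n) ^ p * norm k + K * real (Suc n) ^ p"
      by (simp only: distrib_right mult.commute)
    moreover have k1: "norm k \<le> real (Suc n) ^ p * norm k + K * real (Suc n) ^ p" using 1 3 by linarith
    have k2: "norm (dirichlet_coeff c n) \<le> real (Suc n) ^ p * norm k + K * real (Suc n) ^ p"
      using K(2)[of n] 2 3 by linarith
    have "norm (if n = 0 then k else dirichlet_coeff c n) \<le> real (Suc n) ^ p * norm k + K * real (Suc n) ^ p"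
      by (rule if_split[THEN iffD2]) (use k1 k2 in blast)
    ultimately show ?thesis by (simp only:)
  qed
  ultimately show ?thesis unfolding moderate_qexp_def has_q_expansion_def by blast
qed

subsection \<open>The Eisenstein series\<close>

definition eis_coeff :: "nat \<Rightarrow> int \<Rightarrow> int \<Rightarrow> nat \<Rightarrow> nat \<Rightarrow> complex" where
  "eis_coeff N a b m n = root1 N (a * int m + b * int n) - root1 N (- (a * int m + b * int n))"

lemma zeta_powi: "zeta N powi k = root1 N k"
proof -
  have "zeta N powi k = exp (of_int k * (2 * of_real pi * \<i> / of_nat N))"
    unfolding zeta_def by (rule exp_power_int)
  then show ?thesis by (simp add: root1_def qpar_def mult_ac)
qed

lemma poly_growth_eis_coeff: "poly_growth (eis_coeff N a b)"
proof (rule poly_growth_bounded)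
  show "norm (eis_coeff N a b m n) \<le> 1 + 1" for m n
    unfolding eis_coeff_def by (rule order_trans[OF norm_triangle_ineq4]) simp
qed

lemma eisenstein_eq:
  assumes "N > 0" "\<not> int N dvd a" "\<not> int N dvd b"
  shows "eisenstein N a b \<tau> =
    \<i> / 2 * of_real (cot (pi * a / N) + cot (pi * b / N)) + lambert (eis_coeff N a b) (qpar \<tau>)"
  unfolding eisenstein_def lambert_def zeta_powi eis_coeff_def
    cot_eq_root1[OF assms(1,2)] cot_eq_root1[OF assms(1,3)]
  by (simp add: distrib_left)

lemma eis_coeff_trig:
  "eis_coeff N a b m n = 2 * \<i> * of_real (csin N a m * ccos N b n + ccos N a m * csin N b n)"
proof -
  have "root1 N (a * int m + b * int n) = root1 N a ^ m * root1 N b ^ n"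
    unfolding root1_add root1_power ..
  moreover have "root1 N (- (a * int m + b * int n)) = root1 N (- a) ^ m * root1 N (- b) ^ n"
    unfolding root1_power root1_add[symmetric] by simp
  ultimately show ?thesis
    unfolding eis_coeff_def root1_power_eq by (simp add: complex_eq_iff ccos_uminus csin_uminus)
qed

lemma poly_growth_sc: "poly_growth (\<lambda>m n. csin N a m * ccos N b n)"
proof (rule poly_growth_bounded)
  show "norm (csin N a m * ccos N b n) \<le> 1 * 1" for m n
    unfolding real_norm_def abs_mult by (intro mult_mono abs_ccos_le abs_csin_le) auto
qed

text \<open>The values are purely imaginary, and each of the two summands has the form of the right-hand side of
  \<open>weight_one_inversion\<close>.\<close>

lemma eisenstein_imag_axis:
  assumes "N > 0" "\<not> int N dvd a" "\<not> int N dvd b" "u > 0"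
  shows "eisenstein N a b (Complex 0 u) = \<i> / 2 * of_real (
      (cot (pi * a / N) + 4 * lambert (\<lambda>m n. ccos N b m * csin N a n) (nome u)) +
      (cot (pi * b / N) + 4 * lambert (\<lambda>m n. ccos N a m * csin N b n) (nome u)))"
proof -
  have u: "norm (nome u) < 1" using assms by simp
  have "lambert (eis_coeff N a b) (qpar (Complex 0 u)) =
      2 * \<i> * lambert (\<lambda>m n. of_real (csin N a m * ccos N b n + ccos N a m * csin N b n)) (of_real (nome u))"
    unfolding qpar_imag lambert_cmult[symmetric] eis_coeff_trig[symmetric] ..
  also have "lambert (\<lambda>m n. of_real (csin N a m * ccos N b n + ccos N a m * csin N b n)) (of_real (nome u)) =
      complex_of_real (lambert (\<lambda>m n. csin N a m * ccos N b n + ccos N a m * csin N b n) (nome u))"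
    by (rule lambert_of_real) (use u poly_growth_sc poly_growth_real_products(2) in \<open>auto intro: poly_growth_add\<close>)
  also have "lambert (\<lambda>m n. csin N a m * ccos N b n + ccos N a m * csin N b n) (nome u) =
      lambert (\<lambda>m n. csin N a m * ccos N b n) (nome u) + lambert (\<lambda>m n. ccos N a m * csin N b n) (nome u)"
    by (rule lambert_add[OF poly_growth_sc poly_growth_real_products(2) u])
  also have "lambert (\<lambda>m n. csin N a m * ccos N b n) (nome u) = lambert (\<lambda>m n. ccos N b m * csin N a n) (nome u)"
    using lambert_swap[of "\<lambda>m n. ccos N b m * csin N a n" "nome u"] by (simp only: mult.commute)
  finally show ?thesis
    unfolding eisenstein_eq[OF assms(1-3)] by (simp add: algebra_simps)
qed

lemma eisenstein_sign:
  assumes "N > 0" "\<not> int N dvd a" "\<not> int N dvd b" "u > 0"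
  shows "eisenstein N a (- b) (Complex 0 u) = \<i> / 2 * of_real (
      (cot (pi * a / N) + 4 * lambert (\<lambda>m n. ccos N b m * csin N a n) (nome u)) -
      (cot (pi * b / N) + 4 * lambert (\<lambda>m n. ccos N a m * csin N b n) (nome u)))"
proof -
  have b: "\<not> int N dvd - b" using assms by simp
  have "lambert (\<lambda>m n. ccos N a m * csin N (- b) n) (nome u) = - lambert (\<lambda>m n. ccos N a m * csin N b n) (nome u)"
    unfolding lambert_uminus[symmetric] csin_uminus by simp
  moreover have "cot (pi * of_int (- b) / N) = - cot (pi * b / N)"
    by (simp add: cot_def)
  ultimately show ?thesis
    unfolding eisenstein_imag_axis[OF assms(1,2) b assms(4)] ccos_uminus by simp
qed

section \<open>The integral along the vertical line\<close>

lemma absolutely_integrable_has_integral: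
  fixes f :: "real \<Rightarrow> real"
  shows "f absolutely_integrable_on A \<Longrightarrow> integral A f = I \<Longrightarrow> (f has_integral I) A"
  using integrable_integral[OF set_lebesgue_integral_eq_integral(1)] by blast

locale regulator_data =
  fixes N :: nat and a b c :: int
  assumes N: "N > 0" and ac: "\<not> int N dvd a * c" and bc: "\<not> int N dvd b * c"
begin

lemma na: "\<not> int N dvd a" and nb: "\<not> int N dvd b"
  using ac bc by auto

definition r :: real where "r = 1 / (real N)\<^sup>2"

lemma r_pos: "r > 0"
  using N by (simp add: r_def)

lemma inversion_param: "r / t = 1 / ((real N)\<^sup>2 * t)"
  by (simp add: r_def)

text \<open>\<open>P\<close> and \<open>G\<close> result from the substitution in \<open>rogers_zudilin\<close>, and \<open>H\<close> from the inversion of \<open>G\<close>. The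
  second term of \<open>Phi\<close> is the contribution of \<open>cot (\<pi> b c / N)\<close>, the constant term of the Eisenstein
  series whose Lambert series is \<open>4 P\<close>.\<close>

definition "P u = lambert (\<lambda>m n. ccos N a m * csin N (b * c) n) (nome u)"
definition "H u = lambert (\<lambda>m n. ccos N (a * c) m * csin N b n) (nome u)"
definition "G u = lambert (\<lambda>m n. sym_ind N (a * c) m * alt_ind N b n) (nome (r / u))"
definition "Phi u = P u * G u + cot (pi * (b * c) / N) * (u * H u)"

lemma G_eq: "u > 0 \<Longrightarrow> G u = u * (cot (pi * b / N) + 4 * H u)"
  unfolding G_def H_def inversion_param by (rule weight_one_inversion[OF N ac nb])

lemma abs_csin_le_2: "\<bar>csin N k m\<bar> \<le> 2" and abs_ccos_le_2: "\<bar>ccos N k m\<bar> \<le> 2"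
  using abs_csin_le[of N k m] abs_ccos_le[of N k m] by linarith+

lemma sine_square_series:
  obtains S where "((\<lambda>m. csin N b m / real m ^ 2) has_sum S) {1..}"
proof -
  have "(\<lambda>m. csin N b m / real m ^ 2) summable_on {1..}"
  proof (rule abs_summable_summable, rule summable_on_comparison_test[OF inverse_squares_summable(3)])
    show "norm (csin N b m / real m ^ 2) \<le> 1 / real m ^ 2" for m
      using abs_csin_le[of N b m] by (simp add: divide_right_mono)
  qed auto
  then show ?thesis unfolding summable_on_def by (elim exE) (rule that)
qed

lemma PG_integrable: "(\<lambda>u. P u * G u) absolutely_integrable_on {0<..}"
  and rz_left_integrable: "(\<lambda>t. lambert (\<lambda>m n. ccos N a m / real m * sym_ind N (a * c) n) (nome (r / t)) *
        lambert (\<lambda>m n. csin N (b * c) m * (real n * alt_ind N b n)) (nome t)) absolutely_integrable_on {0<..}"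
  and rz_integral: "integral {0<..} (\<lambda>t. lambert (\<lambda>m n. ccos N a m / real m * sym_ind N (a * c) n) (nome (r / t)) *
        lambert (\<lambda>m n. csin N (b * c) m * (real n * alt_ind N b n)) (nome t)) = integral {0<..} (\<lambda>u. P u * G u)"
  using rogers_zudilin[of "ccos N a" 2 "sym_ind N (a * c)" "csin N (b * c)" "alt_ind N b",
      OF abs_ccos_le_2 abs_sym_ind_le abs_csin_le_2 abs_alt_ind_le r_pos]
  unfolding P_def G_def by blast+

lemma uH_integrable: "(\<lambda>u. u * H u) absolutely_integrable_on {0<..}"
  and uH_integral: "((\<lambda>m. csin N b m / real m ^ 2) has_sum S) {1..} \<Longrightarrow>
        integral {0<..} (\<lambda>u. u * H u) = B2 (of_int (a * c) / real N) * S / 4"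
proof -
  note M = lambert_first_moment[OF abs_ccos_le abs_csin_le B2_fourier[OF N ac]]
  obtain T where "((\<lambda>m. csin N b m / real m ^ 2) has_sum T) {1..}" by (rule sine_square_series)
  from M(1)[OF this] show "(\<lambda>u. u * H u) absolutely_integrable_on {0<..}" unfolding H_def .
  assume "((\<lambda>m. csin N b m / real m ^ 2) has_sum S) {1..}"
  from M(2)[OF this] show "integral {0<..} (\<lambda>u. u * H u) = B2 (of_int (a * c) / real N) * S / 4"
    unfolding H_def by simp
qed

lemma Phi_integrable: "Phi absolutely_integrable_on {0<..}"
  unfolding Phi_def by (intro set_integral_add set_integrable_mult_right PG_integrable uH_integrable)

lemma Phi_integral:
  "integral {0<..} Phi = integral {0<..} (\<lambda>u. P u * G u) + cot (pi * (b * c) / N) * integral {0<..} (\<lambda>u. u * H u)"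
proof -
  have "(\<lambda>u. P u * G u) integrable_on {0<..}" "(\<lambda>u. cot (pi * (b * c) / N) * (u * H u)) integrable_on {0<..}"
    by (intro set_lebesgue_integral_eq_integral(1) set_integrable_mult_right PG_integrable uH_integrable)+
  from integral_add[OF this] show ?thesis unfolding Phi_def integral_mult_right .
qed

abbreviation "logg t \<equiv> ln (cmod (modular_unit N a (Complex (of_int c / real N) t)))"
abbreviation "dargh t \<equiv> darg (modular_unit N b) (Complex (of_int c / real N) t) \<i>"

lemma logg_eq:
  fixes t :: real
  assumes "t > 0"
  shows "logg t = - (pi * B2 (of_int (a * c) / N) / (N * t)) -
    lambert (\<lambda>m n. ccos N a m / real m * sym_ind N (a * c) n) (nome (r / t))"
proof -
  interpret nonzero_residues N a "a * c" using N na ac by unfold_locales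
  show ?thesis
    unfolding inversion_param ln_norm_modular_unit[OF assms N] using log_inversion[OF assms] by simp
qed

text \<open>After the inversion of \<open>d arg g_b\<close> and the change of variable \<open>s = r / t\<close>, this is a first moment.\<close>

lemma dargh_over_t_integral:
  assumes S: "((\<lambda>m. csin N b m / real m ^ 2) has_sum S) {1..}"
  shows "(\<lambda>t. dargh t / t) absolutely_integrable_on {0<..}"
    and "integral {0<..} (\<lambda>t. dargh t / t) = N / 2 * S * cot (pi * (b * c) / N)"
proof -
  interpret nonzero_residues N b "b * c" using N nb bc by unfold_locales
  define F where "F = (\<lambda>s. s * lambert (\<lambda>m n. csin N b m * (real n * alt_ind N (b * c) n)) (nome s))"
  have F: "F absolutely_integrable_on {0<..}" "integral {0<..} F = S * cot (pi * (b * c) / N) / (4 * pi * N)"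
    using lambert_alt_first_moment[OF N bc abs_csin_le S] unfolding F_def by simp_all
  have inv: "(\<lambda>x. (r / x\<^sup>2) *\<^sub>R F (r / x)) absolutely_integrable_on {0<..}"
    "integral {0<..} (\<lambda>x. (r / x\<^sup>2) *\<^sub>R F (r / x)) = S * cot (pi * (b * c) / N) / (4 * pi * N)"
    using invert_halfline[OF r_pos, of F "S * cot (pi * (b * c) / N) / (4 * pi * N)"] F by blast+
  have eq: "dargh t / t = (2 * pi * N\<^sup>2) * ((r / t\<^sup>2) *\<^sub>R F (r / t))" if "t \<in> {0<..}" for t
  proof -
    have t: "t > 0" using that by simp
    have "dargh t / t = 2 * pi * (1 / ((real N)\<^sup>2 * t\<^sup>2) * lambert (\<lambda>m n. csin N b m * (real n * alt_ind N (b * c) n)) (nome (r / t))) / t"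
      unfolding darg_modular_unit[OF t N] darg_inversion[OF t] inversion_param ..
    also have "\<dots> = (2 * pi * N\<^sup>2) * ((r / t\<^sup>2) *\<^sub>R F (r / t))"
      using t N by (simp add: F_def r_def power2_eq_square mult_ac)
    finally show ?thesis .
  qed
  have "(\<lambda>t. (2 * pi * N\<^sup>2) * ((r / t\<^sup>2) *\<^sub>R F (r / t))) absolutely_integrable_on {0<..}"
    by (rule set_integrable_mult_right) (rule inv(1))
  then show "(\<lambda>t. dargh t / t) absolutely_integrable_on {0<..}"
    by (rule absolutely_integrable_spike[OF _ negligible_empty]) (use eq in auto)
  have "integral {0<..} (\<lambda>t. dargh t / t) = integral {0<..} (\<lambda>t. (2 * pi * N\<^sup>2) * ((r / t\<^sup>2) *\<^sub>R F (r / t)))"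
    by (rule integral_cong[OF eq])
  also have "\<dots> = (2 * pi * N\<^sup>2) * (S * cot (pi * (b * c) / N) / (4 * pi * N))"
    unfolding integral_mult_right inv(2) ..
  also have "\<dots> = N / 2 * S * cot (pi * (b * c) / N)"
    using N by (simp add: power2_eq_square)
  finally show "integral {0<..} (\<lambda>t. dargh t / t) = N / 2 * S * cot (pi * (b * c) / N)" .
qed

text \<open>The Lambert series part of \<open>log |g_a|\<close> gives the integral of \<open>P G\<close>. The elementary term gives
  \<open>- (\<pi> / 2) B2 (a c / N) S cot (\<pi> b c / N)\<close>, where \<open>S\<close> is the sine series. By \<open>uH_integral\<close> this is
  \<open>- 2 \<pi>\<close> times the integral of \<open>cot (\<pi> b c / N) u H(u)\<close>, and so completes \<open>P G\<close> to \<open>Phi\<close>.\<close>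

theorem log_darg_integral:
  "((\<lambda>t. logg t * dargh t) has_integral (- 2 * pi * integral {0<..} Phi)) {0<..}"
proof -
  obtain S where S: "((\<lambda>m. csin N b m / real m ^ 2) has_sum S) {1..}" by (rule sine_square_series)
  define k where "k = - (pi * B2 (of_int (a * c) / N) / N)"
  define F where "F = (\<lambda>t. lambert (\<lambda>m n. ccos N a m / real m * sym_ind N (a * c) n) (nome (r / t)) *
        lambert (\<lambda>m n. csin N (b * c) m * (real n * alt_ind N b n)) (nome t))"
  have eq: "k * (dargh t / t) - 2 * pi * F t = logg t * dargh t" if "t \<in> {0<..}" for t
  proof -
    have t: "t > 0" using that by simp
    show ?thesis
      unfolding logg_eq[OF t] F_def left_diff_distrib
      by (simp add: darg_modular_unit[OF t N] k_def)
  qed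
  have "((\<lambda>t. dargh t / t) has_integral (N / 2 * S * cot (pi * (b * c) / N))) {0<..}"
    by (rule absolutely_integrable_has_integral[OF dargh_over_t_integral[OF S]])
  moreover have "(F has_integral integral {0<..} (\<lambda>u. P u * G u)) {0<..}"
    unfolding F_def by (rule absolutely_integrable_has_integral[OF rz_left_integrable rz_integral])
  ultimately have "((\<lambda>t. k * (dargh t / t) - 2 * pi * F t) has_integral
      (k * (N / 2 * S * cot (pi * (b * c) / N)) - 2 * pi * integral {0<..} (\<lambda>u. P u * G u))) {0<..}"
    by (intro has_integral_diff has_integral_mult_right)
  also have "k * (N / 2 * S * cot (pi * (b * c) / N)) - 2 * pi * integral {0<..} (\<lambda>u. P u * G u) = - 2 * pi * integral {0<..} Phi"
    unfolding Phi_integral uH_integral[OF S] using N by (simp add: k_def algebra_simps)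
  finally have "((\<lambda>t. k * (dargh t / t) - 2 * pi * F t) has_integral - 2 * pi * integral {0<..} Phi) {0<..}" .
  then show ?thesis using eq by (rule has_integral_eq[rotated])
qed

text \<open>As \<open>u \<rightarrow> 0\<close>, \<open>P\<close> grows at most like a power of \<open>1 / u\<close>, while \<open>cot (\<pi> b / N) + 4 H(u) = G(u) / u\<close> decays
  faster than any power of \<open>u\<close>, because \<open>G\<close> is a Lambert series at \<open>r / u\<close>, without constant term.\<close>

lemma PG_products_bounded:
  obtains M where "\<And>u. 0 < u \<Longrightarrow> u \<le> 1 \<Longrightarrow> \<bar>(cot (pi * (b * c) / N) + 4 * P u) * (cot (pi * b / N) + 4 * H u)\<bar> \<le> M"
proof -
  obtain p where p: "\<And>k. k \<ge> p \<Longrightarrow> \<exists>C\<ge>0. \<forall>t>0. \<bar>P t\<bar> \<le> C / t ^ k"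
    unfolding P_def by (rule lambert_decay[OF poly_growth_real_products(2)[of N a "b * c"]]) blast
  obtain C1 where C1: "C1 \<ge> 0" "\<And>t. t > 0 \<Longrightarrow> \<bar>P t\<bar> \<le> C1 / t ^ p" using p[OF order_refl] by blast
  let ?g = "\<lambda>t. lambert (\<lambda>m n. sym_ind N (a * c) m * alt_ind N b n) (nome t)"
  obtain q where q: "\<And>k. k \<ge> q \<Longrightarrow> \<exists>C\<ge>0. \<forall>t>0. \<bar>?g t\<bar> \<le> C / t ^ k"
    by (rule lambert_decay[OF poly_growth_real_products(1)[of N "a * c" b]]) blast
  define k where "k = p + q + 1"
  obtain C2 where C2: "C2 \<ge> 0" "\<And>t. t > 0 \<Longrightarrow> \<bar>?g t\<bar> \<le> C2 / t ^ k" using q[of k] by (auto simp: k_def)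
  let ?\<beta> = "cot (pi * (b * c) / N)"
  show ?thesis
  proof (rule that)
    fix u :: real assume u: "0 < u" "u \<le> 1"
    have "\<bar>G u\<bar> \<le> C2 / (r / u) ^ k" unfolding G_def using C2(2)[of "r / u"] u r_pos by simp
    also have "\<dots> = C2 / r ^ k * u ^ k" using u r_pos by (simp add: power_divide)
    also have "u ^ k \<le> u ^ (p + 1)" using u by (intro power_decreasing) (auto simp: k_def)
    then have "C2 / r ^ k * u ^ k \<le> C2 / r ^ k * u ^ (p + 1)" using C2 r_pos by (intro mult_left_mono) auto
    finally have G1: "\<bar>G u\<bar> \<le> C2 / r ^ k * u ^ (p + 1)" .
    have "\<bar>cot (pi * b / N) + 4 * H u\<bar> = \<bar>G u\<bar> / u" using G_eq[OF u(1)] u by (simp add: abs_mult)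
    also have "\<dots> \<le> C2 / r ^ k * u ^ p" using G1 u by (simp add: divide_le_eq mult_ac)
    finally have A: "\<bar>cot (pi * b / N) + 4 * H u\<bar> \<le> C2 / r ^ k * u ^ p" .
    have "\<bar>?\<beta> + 4 * P u\<bar> \<le> \<bar>?\<beta>\<bar> + 4 * (C1 / u ^ p)"
      using C1(2)[OF u(1)] abs_triangle_ineq[of ?\<beta> "4 * P u"] by (simp add: abs_mult)
    then have "\<bar>(?\<beta> + 4 * P u) * (cot (pi * b / N) + 4 * H u)\<bar> \<le> (\<bar>?\<beta>\<bar> + 4 * (C1 / u ^ p)) * (C2 / r ^ k * u ^ p)"
      unfolding abs_mult using A C1 u by (intro mult_mono) auto
    also have "\<dots> = \<bar>?\<beta>\<bar> * (C2 / r ^ k) * u ^ p + 4 * C1 * (C2 / r ^ k)"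
    proof -
      have "(x + 4 * (C1 / v)) * (y * v) = x * y * v + 4 * C1 * y" if "v \<noteq> 0" for x y v :: real
        using that by (simp add: field_simps)
      moreover have "u ^ p \<noteq> 0" using u by simp
      ultimately show ?thesis by blast
    qed
    also have "\<dots> \<le> \<bar>?\<beta>\<bar> * (C2 / r ^ k) * 1 + 4 * C1 * (C2 / r ^ k)"
      using u C2 r_pos by (intro add_right_mono mult_left_mono power_le_one) auto
    finally show "\<bar>(?\<beta> + 4 * P u) * (cot (pi * b / N) + 4 * H u)\<bar> \<le> \<bar>?\<beta>\<bar> * (C2 / r ^ k) * 1 + 4 * C1 * (C2 / r ^ k)" .
  qed
qed

lemma Phi_eq:
  assumes "u > 0"
  shows "u * ((cot (pi * (b * c) / N) + 4 * P u) * (cot (pi * b / N) + 4 * H u) - cot (pi * (b * c) / N) * cot (pi * b / N)) = 4 * Phi u"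
  unfolding Phi_def G_eq[OF assms] by (simp add: algebra_simps)

end

theorem theorem1:
  fixes N :: nat and a b c :: int
  assumes "N \<ge> 1"
    and "\<not> int N dvd a * c"
    and "\<not> int N dvd b * c"
  shows "\<exists>coef I L.
           has_q_expansion (f_abc N a b c) coef \<and>
           has_L_value coef 2 L \<and>
           has_vertical_integral
             (regulator_form (modular_unit N a) (modular_unit N b)) I (of_int c / real N) \<and>
           complex_of_real I = 1 / (4 * of_real pi) * L"
proof -
  have N: "N > 0" using assms(1) by simp
  note ac = assms(2) and bc = assms(3)
  interpret A: regulator_data N a b c using N ac bc by unfold_locales
  \<comment> \<open>The two terms of the regulator form differ by the exchange of \<open>a\<close> and \<open>b\<close>.\<close>
  interpret B: regulator_data N b a c using N ac bc by unfold_locales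
  have nac: "\<not> int N dvd - (a * c)" and nbc: "\<not> int N dvd - (b * c)" using ac bc by simp_all
  define ct where "ct = (\<lambda>k::int. cot (pi * k / N))"
  have ct_neg: "ct (- k) = - ct k" for k by (simp add: ct_def cot_def)
  define e where "e = (\<lambda>k l n. if n = 0 then \<i> / 2 * of_real (ct k + ct l) else dirichlet_coeff (eis_coeff N k l) n)"
  have eis: "moderate_qexp (eisenstein N k l) (e k l)" if "\<not> int N dvd k" "\<not> int N dvd l" for k l
  proof -
    have "eisenstein N k l = (\<lambda>\<tau>. \<i> / 2 * of_real (ct k + ct l) + lambert (eis_coeff N k l) (qpar \<tau>))"
      using eisenstein_eq[OF N that] by (simp add: fun_eq_iff ct_def)
    then show ?thesis unfolding e_def by (simp only: moderate_qexp_lambert[OF poly_growth_eis_coeff])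
  qed
  define coef where "coef = (\<lambda>n. (\<Sum>i\<le>n. e a (b * c) i * e b (- (a * c)) (n - i)) -
      (\<Sum>i\<le>n. e a (- (b * c)) i * e b (a * c) (n - i)))"
  have qexp: "moderate_qexp (f_abc N a b c) coef"
    unfolding f_abc_def[abs_def] coef_def
    by (intro moderate_qexp_diff moderate_qexp_mult eis A.na A.nb ac bc nac nbc)
  have coef0: "coef 0 = of_real (- 1 / 2 * (ct (b * c) * ct b - ct (a * c) * ct a))"
    by (simp add: coef_def e_def ct_neg complex_eq_iff field_simps)
  define \<phi> where "\<phi> = (\<lambda>u. f_abc N a b c (Complex 0 u) - coef 0)"
  \<comment> \<open>Up to a factor, \<open>f_abc\<close> on the imaginary axis has the form
    \<open>(x + y) (z - w) - (x - y) (z + w) = 2 (y z - x w)\<close>, and \<open>XA = y z\<close>, \<open>XB = x w\<close>.\<close>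
  define XA where "XA = (\<lambda>u. (ct (b * c) + 4 * A.P u) * (ct b + 4 * A.H u))"
  define XB where "XB = (\<lambda>u. (ct (a * c) + 4 * B.P u) * (ct a + 4 * B.H u))"
  have f_axis: "f_abc N a b c (Complex 0 u) = of_real (- 1 / 2 * (XA u - XB u))" if u: "u > 0" for u
  proof -
    have eqs: "eisenstein N a (b * c) (Complex 0 u) = \<i> / 2 * of_real ((ct a + 4 * B.H u) + (ct (b * c) + 4 * A.P u))"
      "eisenstein N a (- (b * c)) (Complex 0 u) = \<i> / 2 * of_real ((ct a + 4 * B.H u) - (ct (b * c) + 4 * A.P u))"
      "eisenstein N b (a * c) (Complex 0 u) = \<i> / 2 * of_real ((ct b + 4 * A.H u) + (ct (a * c) + 4 * B.P u))"
      "eisenstein N b (- (a * c)) (Complex 0 u) = \<i> / 2 * of_real ((ct b + 4 * A.H u) - (ct (a * c) + 4 * B.P u))"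
      unfolding ct_def A.P_def A.H_def B.P_def B.H_def
      by (rule eisenstein_imag_axis eisenstein_sign; rule N A.na A.nb ac bc u)+
    have prod: "\<i> / 2 * complex_of_real x * (\<i> / 2 * of_real y) = of_real (- 1 / 4 * (x * y))" for x y
      by (simp add: complex_eq_iff)
    have "- 1 / 4 * ((A + B) * (C - D)) - - 1 / 4 * ((A - B) * (C + D)) = - 1 / 2 * (B * C - D * A)"
      for A B C D :: real by (simp add: field_simps)
    then show ?thesis
      unfolding f_abc_def eqs prod XA_def XB_def of_real_diff[symmetric] by (simp only:)
  qed
  have \<phi>_eq: "of_real u * \<phi> u = of_real (- 2 * (A.Phi u - B.Phi u))" if u: "u \<in> {0<..}" for u
  proof -
    have u: "u > 0" using u by simp
    have "u * (XA u - ct (b * c) * ct b) = 4 * A.Phi u" "u * (XB u - ct (a * c) * ct a) = 4 * B.Phi u"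
      using A.Phi_eq[OF u] B.Phi_eq[OF u] by (simp_all add: XA_def XB_def ct_def)
    then have "u * (- 1 / 2 * (XA u - XB u) - - 1 / 2 * (ct (b * c) * ct b - ct (a * c) * ct a)) = - 2 * (A.Phi u - B.Phi u)"
      by (simp add: algebra_simps diff_divide_distrib add_divide_distrib)
    then show ?thesis unfolding \<phi>_def f_axis[OF u] coef0 by (metis of_real_diff of_real_mult)
  qed
  obtain K p where growth: "\<And>n. norm (coef n) \<le> K * real (Suc n) ^ p"
    using qexp unfolding moderate_qexp_def by blast
  obtain MA where MA: "\<And>u. 0 < u \<Longrightarrow> u \<le> 1 \<Longrightarrow> \<bar>XA u\<bar> \<le> MA"
    using A.PG_products_bounded unfolding XA_def ct_def by auto
  obtain MB where MB: "\<And>u. 0 < u \<Longrightarrow> u \<le> 1 \<Longrightarrow> \<bar>XB u\<bar> \<le> MB"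
    using B.PG_products_bounded unfolding XB_def ct_def by auto
  interpret L: bounded_cusp_series coef K p "MA + MB + norm (coef 0)" \<phi>
  proof
    show "norm (coef n) \<le> K * real (Suc n) ^ p" for n by (rule growth)
    show "(\<lambda>n. coef (Suc n) * of_real (nome u ^ Suc n)) sums \<phi> u" if "u > 0" for u
    proof -
      have "(\<lambda>n. coef n * qpar (Complex 0 u) ^ n) sums f_abc N a b c (Complex 0 u)"
        using qexp that unfolding moderate_qexp_def has_q_expansion_def by simp
      then show ?thesis
        unfolding qpar_imag \<phi>_def
        using sums_Suc_iff[of "\<lambda>n. coef n * of_real (nome u) ^ n" "f_abc N a b c (Complex 0 u) - coef 0"] by simp
    qed
    show "norm (\<phi> u) \<le> MA + MB + norm (coef 0)" if u: "0 < u" "u \<le> 1" for u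
    proof -
      have "norm (f_abc N a b c (Complex 0 u)) = 1 / 2 * \<bar>XA u - XB u\<bar>"
        unfolding f_axis[OF u(1)] norm_of_real by (simp add: abs_mult)
      also have "\<dots> \<le> \<bar>XA u - XB u\<bar>" by simp
      also have "\<dots> \<le> \<bar>XA u\<bar> + \<bar>XB u\<bar>" by (rule abs_triangle_ineq4)
      also have "\<dots> \<le> MA + MB" by (intro add_mono MA MB u)
      finally show ?thesis
        using norm_triangle_ineq4[of "f_abc N a b c (Complex 0 u)" "coef 0"] by (simp add: \<phi>_def)
    qed
  qed
  define JA where "JA = integral {0<..} A.Phi"
  define JB where "JB = integral {0<..} B.Phi"
  have "integral {0<..} (\<lambda>u. of_real u * \<phi> u) = integral {0<..} (\<lambda>u. complex_of_real (- 2 * (A.Phi u - B.Phi u)))"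
    by (rule integral_cong[OF \<phi>_eq])
  also have "\<dots> = of_real (- 2 * (JA - JB))"
  proof -
    have "(A.Phi has_integral JA) {0<..}" "(B.Phi has_integral JB) {0<..}"
      unfolding JA_def JB_def
      by (rule absolutely_integrable_has_integral[OF A.Phi_integrable refl]
               absolutely_integrable_has_integral[OF B.Phi_integrable refl])+
    from has_integral_mult_right[OF has_integral_diff[OF this], of "-2"]
    have "((\<lambda>u. - 2 * (A.Phi u - B.Phi u)) has_integral (- 2 * (JA - JB))) {0<..}" .
    from has_integral_linear[OF this bounded_linear_of_real] show ?thesis
      by (intro integral_unique) (simp add: o_def)
  qed
  finally have L_int: "integral {0<..} (\<lambda>u. of_real u * \<phi> u) = complex_of_real (- 2 * (JA - JB))" .
  define I where "I = - 2 * pi * JA - (- 2 * pi * JB)"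
  have vert: "has_vertical_integral (regulator_form (modular_unit N a) (modular_unit N b)) I (of_int c / real N)"
    unfolding has_vertical_integral_def regulator_form_def I_def JA_def JB_def
    by (rule has_integral_diff[OF A.log_darg_integral B.log_darg_integral])
  have "complex_of_real I = 1 / (4 * of_real pi) * (4 * of_real pi ^ 2 * integral {0<..} (\<lambda>u. of_real u * \<phi> u))"
    unfolding L_int I_def by (simp add: power2_eq_square algebra_simps)
  with vert L.L_value_at_2 qexp show ?thesis
    unfolding moderate_qexp_def by blast
qed

end
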